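(* Each of the following three problems, whose input is (a finite presentation of) a definable graph $G$, is decidable: (1) VertexCover: does $G$ have a finite vertex cover? (2) FeedbackVertexSet: is there a finite set of vertices whose removal makes $G$ acyclic? (3) FeedbackArcSet: is there a finite set of edges whose removal makes $G$ acyclic?
   Context: Fix a countably infinite set $\mathbb{A}$ of atoms and an infinite set of atom variables. An expression is either a variable or a formal finite (possibly empty) union of set-builder expressions $\{e \mid x_1,\dots,x_k\in\mathbb{A},\ \varphi\}$ (with $k\ge 0$), where $e$ is an expression, the $x_i$ are bound variables, and $\varphi$ is a first-order formula over the atom variables with equality as the only relation symbol (interpreted in $(\mathbb{A},=)$). An expression $e$ with set of free variables $V$, together with a valuation $\sigma:V\to\mathbb{A}$, has a value $e[\sigma]$, defined in the obvious way by induction on $e$, which is an atom or a set; the sets arising this way are called definable. Pairs, tuples, integers, constants, disjoint unions etc. are encoded by standard set-theoretic means (e.g. $(x,y)=\{x,\{x,y\}\}$). A definable set is presented to an algorithm as a pair $(e,\sigma)$. A definable graph is a definable pair $G=(V,E)$: for VertexCover it is undirected ($E$ a set of two-element subsets of $V$); for FeedbackVertexSet and FeedbackArcSet it is directed ($E\subseteq V\times V$), as in Karp's original problems, and acyclic means having no directed cycle (cycles are finite). A vertex cover is a set of vertices containing at least one end of every edge. *)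

theory Defs
  imports "HOL-Library.Countable_Set_Type" "HOL-Library.Nat_Bijection"
begin

section \<open>Definable sets\<close>

type_synonym atom = nat
type_synonym var = nat

datatype fm =
    Eq var var
  | Neg fm
  | Conj fm fm
  | Disj fm fm
  | Ex var fm
  | All var fm

text \<open>
  \<open>UnionOf [b\<^sub>1, \<dots>, b\<^sub>n]\<close> is the formal union of the set-builder expressions \<open>b\<^sub>i\<close>, and
  \<open>Builder e [x\<^sub>1, \<dots>, x\<^sub>k] \<phi>\<close> is \<open>{e | x\<^sub>1, \<dots>, x\<^sub>k \<in> \<A>, \<phi>}\<close>.
\<close>

datatype expr =
    AVar var
  | UnionOf "builder list"
and builder =
    Builder expr "var list" fm

text \<open>
  Values of expressions. Since there are only countably many atoms, every definable set is
  hereditarily countable, so the hereditarily countable sets over the atoms are a large enough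
  universe. As a datatype it is extensional, well-founded, and keeps atoms apart from sets.
\<close>

datatype val = VAtom atom | VSet "val cset"

primrec members :: "val \<Rightarrow> val set" where
  "members (VAtom a) = {}"
| "members (VSet X) = rcset X"

primrec sat :: "fm \<Rightarrow> (var \<Rightarrow> atom) \<Rightarrow> bool" where
  "sat (Eq x y) \<rho> \<longleftrightarrow> \<rho> x = \<rho> y"
| "sat (Neg \<phi>) \<rho> \<longleftrightarrow> \<not> sat \<phi> \<rho>"
| "sat (Conj \<phi> \<psi>) \<rho> \<longleftrightarrow> sat \<phi> \<rho> \<and> sat \<psi> \<rho>"
| "sat (Disj \<phi> \<psi>) \<rho> \<longleftrightarrow> sat \<phi> \<rho> \<or> sat \<psi> \<rho>"
| "sat (Ex x \<phi>) \<rho> \<longleftrightarrow> (\<exists>a. sat \<phi> (\<rho>(x := a)))"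
| "sat (All x \<phi>) \<rho> \<longleftrightarrow> (\<forall>a. sat \<phi> (\<rho>(x := a)))"

text \<open>
  Environments are total functions; only their values on the free variables matter
  (see \<open>denot_cong\<close> below). \<open>acset\<close> is meaningful only on countable sets, which is what it is
  applied to here by \<open>countable_builder_vals\<close> below.
\<close>

fun denot :: "expr \<Rightarrow> (var \<Rightarrow> atom) \<Rightarrow> val"
  and builder_vals :: "builder \<Rightarrow> (var \<Rightarrow> atom) \<Rightarrow> val set" where
  "denot (AVar x) \<rho> = VAtom (\<rho> x)"
| "denot (UnionOf bs) \<rho> = VSet (acset (\<Union>b\<in>set bs. builder_vals b \<rho>))"
| "builder_vals (Builder e xs \<phi>) \<rho> =
     {denot e \<rho>' | \<rho>'. (\<forall>y. y \<notin> set xs \<longrightarrow> \<rho>' y = \<rho> y) \<and> sat \<phi> \<rho>'}"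

primrec fv_fm :: "fm \<Rightarrow> var set" where
  "fv_fm (Eq x y) = {x, y}"
| "fv_fm (Neg \<phi>) = fv_fm \<phi>"
| "fv_fm (Conj \<phi> \<psi>) = fv_fm \<phi> \<union> fv_fm \<psi>"
| "fv_fm (Disj \<phi> \<psi>) = fv_fm \<phi> \<union> fv_fm \<psi>"
| "fv_fm (Ex x \<phi>) = fv_fm \<phi> - {x}"
| "fv_fm (All x \<phi>) = fv_fm \<phi> - {x}"

fun fv :: "expr \<Rightarrow> var set"
  and fv_builder :: "builder \<Rightarrow> var set" where
  "fv (AVar x) = {x}"
| "fv (UnionOf bs) = (\<Union>b\<in>set bs. fv_builder b)"
| "fv_builder (Builder e xs \<phi>) = (fv e \<union> fv_fm \<phi>) - set xs"

lemma sat_cong: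
  "(\<And>x. x \<in> fv_fm \<phi> \<Longrightarrow> \<rho> x = \<rho>' x) \<Longrightarrow> sat \<phi> \<rho> \<longleftrightarrow> sat \<phi> \<rho>'"
proof (induction \<phi> arbitrary: \<rho> \<rho>')
  case (Ex x \<phi>)
  then have "sat \<phi> (\<rho>(x := a)) \<longleftrightarrow> sat \<phi> (\<rho>'(x := a))" for a
    by (intro Ex.IH) auto
  then show ?case by simp
next
  case (All x \<phi>)
  then have "sat \<phi> (\<rho>(x := a)) \<longleftrightarrow> sat \<phi> (\<rho>'(x := a))" for a
    by (intro All.IH) auto
  then show ?case by simp
next
  case (Conj \<phi> \<psi>)
  have "sat \<phi> \<rho> \<longleftrightarrow> sat \<phi> \<rho>'" "sat \<psi> \<rho> \<longleftrightarrow> sat \<psi> \<rho>'"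
    by (rule Conj.IH; rule Conj.prems; simp)+
  then show ?case by simp
next
  case (Disj \<phi> \<psi>)
  have "sat \<phi> \<rho> \<longleftrightarrow> sat \<phi> \<rho>'" "sat \<psi> \<rho> \<longleftrightarrow> sat \<psi> \<rho>'"
    by (rule Disj.IH; rule Disj.prems; simp)+
  then show ?case by simp
next
  case (Neg \<phi>)
  have "sat \<phi> \<rho> \<longleftrightarrow> sat \<phi> \<rho>'"
    by (rule Neg.IH; rule Neg.prems; simp)
  then show ?case by simp
qed simp

lemma denot_cong:
  "(\<And>x. x \<in> fv e \<Longrightarrow> \<rho> x = \<rho>' x) \<Longrightarrow> denot e \<rho> = denot e \<rho>'"
  and builder_vals_cong:
  "(\<And>x. x \<in> fv_builder b \<Longrightarrow> \<rho> x = \<rho>' x) \<Longrightarrow> builder_vals b \<rho> = builder_vals b \<rho>'"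
proof (induction e and b arbitrary: \<rho> \<rho>' and \<rho> \<rho>' rule: expr.induct builder.induct)
  case (UnionOf bs)
  have "builder_vals b \<rho> = builder_vals b \<rho>'" if "b \<in> set bs" for b
    by (rule UnionOf(1)[OF that]) (use that UnionOf(2) in auto)
  then show ?case by simp
next
  case (Builder e xs \<phi>)
  have sub: "builder_vals (Builder e xs \<phi>) \<sigma> \<subseteq> builder_vals (Builder e xs \<phi>) \<sigma>'"
    if eq: "\<And>x. x \<in> fv_builder (Builder e xs \<phi>) \<Longrightarrow> \<sigma> x = \<sigma>' x" for \<sigma> \<sigma>'
  proof
    fix v assume "v \<in> builder_vals (Builder e xs \<phi>) \<sigma>"
    then obtain \<tau> where \<tau>: "v = denot e \<tau>" "\<forall>y. y \<notin> set xs \<longrightarrow> \<tau> y = \<sigma> y" "sat \<phi> \<tau>"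
      by auto
    let ?\<tau>' = "\<lambda>y. if y \<in> set xs then \<tau> y else \<sigma>' y"
    have agree: "\<tau> x = ?\<tau>' x" if "x \<in> fv e \<union> fv_fm \<phi>" for x
      using that eq \<tau>(2) by auto
    have "denot e \<tau> = denot e ?\<tau>'"
      by (rule Builder(1)) (rule agree, rule UnI1)
    moreover have "sat \<phi> ?\<tau>'"
      using \<tau>(3) sat_cong[of \<phi> \<tau> ?\<tau>', OF agree[OF UnI2]] by blast
    ultimately show "v \<in> builder_vals (Builder e xs \<phi>) \<sigma>'"
      using \<tau>(1) by (simp only: builder_vals.simps mem_Collect_eq) (intro exI[of _ ?\<tau>'], simp)
  qed
  show ?case
    by (intro subset_antisym sub) (simp_all only: Builder(2))
next
  case (AVar x)
  then show ?case by (simp only: fv.simps denot.simps singletonI)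
qed

lemma countable_builder_vals: "countable (builder_vals b \<rho>)"
proof (cases b)
  case (Builder e xs \<phi>)
  have "{\<rho>'. \<forall>y. y \<notin> set xs \<longrightarrow> \<rho>' y = \<rho> y}
      \<subseteq> (\<lambda>as y. case map_of (zip xs as) y of None \<Rightarrow> \<rho> y | Some a \<Rightarrow> a) ` UNIV"
  proof
    fix \<rho>' assume *: "\<rho>' \<in> {\<rho>'. \<forall>y. y \<notin> set xs \<longrightarrow> \<rho>' y = \<rho> y}"
    have "\<rho>' = (\<lambda>y. case map_of (zip xs (map \<rho>' xs)) y of None \<Rightarrow> \<rho> y | Some a \<Rightarrow> a)"
      using * by (auto simp: map_of_zip_map)
    then show "\<rho>' \<in> (\<lambda>as y. case map_of (zip xs as) y of None \<Rightarrow> \<rho> y | Some a \<Rightarrow> a) ` UNIV"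
      by blast
  qed
  then have "countable {\<rho>'. \<forall>y. y \<notin> set xs \<longrightarrow> \<rho>' y = \<rho> y}"
    by (rule countable_subset) simp
  moreover have "builder_vals b \<rho>
      \<subseteq> denot e ` {\<rho>'. \<forall>y. y \<notin> set xs \<longrightarrow> \<rho>' y = \<rho> y}"
    using Builder by auto
  ultimately show ?thesis
    by (meson countable_image countable_subset)
qed

lemma members_denot_UnionOf:
  "members (denot (UnionOf bs) \<rho>) = (\<Union>b\<in>set bs. builder_vals b \<rho>)"
  by (simp add: acset_inverse countable_UN countable_finite countable_builder_vals)


section \<open>Definable graphs\<close>

definition vupair :: "val \<Rightarrow> val \<Rightarrow> val" where
  "vupair x y = VSet (cinsert x (cinsert y cempty))"

text \<open>The pair \<open>(x, y) = {x, {x, y}}\<close>.\<close>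

definition vpair :: "val \<Rightarrow> val \<Rightarrow> val" where
  "vpair x y = vupair x (vupair x y)"

lemma vupair_eq_iff:
  "vupair a b = vupair c d \<longleftrightarrow> a = c \<and> b = d \<or> a = d \<and> b = c"
proof -
  have "members (vupair x y) = {x, y}" for x y
    by (simp add: vupair_def cinsert.rep_eq bot_cset.rep_eq)
  moreover have "vupair a b = vupair c d" if "a = d" "b = c"
    using that by (simp add: vupair_def cinsert_commute)
  ultimately show ?thesis
    by (metis doubleton_eq_iff)
qed

lemma members_asym: "a \<in> members b \<Longrightarrow> b \<notin> members a"
proof (induction b arbitrary: a)
  case (VSet X)
  then show ?case by (metis members.simps(2))
qed simp

lemma vpair_eq_iff: "vpair a b = vpair c d \<longleftrightarrow> a = c \<and> b = d"
proof -
  have "x \<in> members (vupair x y)" for x y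
    by (simp add: vupair_def cinsert.rep_eq)
  then have "\<not> (a = vupair c d \<and> c = vupair a b)"
    by (metis members_asym)
  then show ?thesis
    unfolding vpair_def by (metis vupair_eq_iff)
qed

definition undirected_graph :: "val set \<Rightarrow> val set \<Rightarrow> bool" where
  "undirected_graph V E \<longleftrightarrow> (\<forall>e\<in>E. \<exists>u\<in>V. \<exists>v\<in>V. u \<noteq> v \<and> e = vupair u v)"

definition directed_graph :: "val set \<Rightarrow> val set \<Rightarrow> bool" where
  "directed_graph V E \<longleftrightarrow> (\<forall>e\<in>E. \<exists>u\<in>V. \<exists>v\<in>V. e = vpair u v)"

definition arcs :: "val set \<Rightarrow> (val \<times> val) set" where
  "arcs E = {(u, v). vpair u v \<in> E}"

definition VertexCover :: "val set \<Rightarrow> val set \<Rightarrow> bool" where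
  "VertexCover V E \<longleftrightarrow>
     (\<exists>C. finite C \<and> C \<subseteq> V \<and> (\<forall>e\<in>E. \<exists>v\<in>C. v \<in> members e))"

definition FeedbackVertexSet :: "val set \<Rightarrow> val set \<Rightarrow> bool" where
  "FeedbackVertexSet V E \<longleftrightarrow>
     (\<exists>S. finite S \<and> S \<subseteq> V \<and> acyclic (arcs E \<inter> (V - S) \<times> (V - S)))"

definition FeedbackArcSet :: "val set \<Rightarrow> val set \<Rightarrow> bool" where
  "FeedbackArcSet V E \<longleftrightarrow>
     (\<exists>F. finite F \<and> F \<subseteq> E \<and> acyclic (arcs (E - F)))"


section \<open>Algorithms on presentations\<close>

text \<open>Algorithms are the partial recursive functions over the natural numbers.\<close>

datatype recf =
    Zero
  | Succ
  | Proj nat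
  | Cn recf "recf list"
  | Pr recf recf
  | Mn recf

text \<open>\<open>rec_eval f xs y\<close>: the computation of \<open>f\<close> on arguments \<open>xs\<close> terminates with result \<open>y\<close>.\<close>

inductive rec_eval :: "recf \<Rightarrow> nat list \<Rightarrow> nat \<Rightarrow> bool" where
  "rec_eval Zero xs 0"
| "rec_eval Succ [x] (Suc x)"
| "i < length xs \<Longrightarrow> rec_eval (Proj i) xs (xs ! i)"
| "list_all2 (\<lambda>g y. rec_eval g xs y) gs ys \<Longrightarrow> rec_eval f ys z \<Longrightarrow> rec_eval (Cn f gs) xs z"
| "rec_eval f xs y \<Longrightarrow> rec_eval (Pr f g) (0 # xs) y"
| "rec_eval (Pr f g) (n # xs) y \<Longrightarrow> rec_eval g (n # y # xs) z \<Longrightarrow>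
     rec_eval (Pr f g) (Suc n # xs) z"
| "rec_eval f (n # xs) 0 \<Longrightarrow> \<forall>m<n. \<exists>y. rec_eval f (m # xs) (Suc y) \<Longrightarrow>
     rec_eval (Mn f) xs n"

lemma rec_eval_det: "rec_eval f xs y \<Longrightarrow> rec_eval f xs z \<Longrightarrow> y = z"
proof (induction f xs y arbitrary: z rule: rec_eval.induct)
  case (4 xs gs ys f y)
  from 4(4) obtain ys' where ys': "list_all2 (\<lambda>g y. rec_eval g xs y) gs ys'" "rec_eval f ys' z"
    by (cases rule: rec_eval.cases) auto
  have "ys = ys'"
    using 4(1) ys'(1) by (auto simp: list_all2_conv_all_nth intro!: nth_equalityI)
  then show ?case using 4 ys' by blast
next
  case (7 f n xs)
  from 7(4) have z: "rec_eval f (z # xs) 0" "\<forall>m<z. \<exists>y. rec_eval f (m # xs) (Suc y)"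
    by (cases rule: rec_eval.cases; auto)+
  have "\<not> z < n" using 7(3) z(1) by (metis nat.distinct(1))
  moreover have "\<not> n < z" using 7(2) z(2) by (metis nat.distinct(1))
  ultimately show ?case by simp
next
  case (6 f g n xs y w)
  from 6(5) obtain y' where "rec_eval (Pr f g) (n # xs) y'" "rec_eval g (n # y' # xs) z"
    by (cases rule: rec_eval.cases) auto
  then show ?case using 6(3,4) by metis
next
  case (5 f xs y g)
  from 5(3) have "rec_eval f xs z"
    by (cases rule: rec_eval.cases) auto
  then show ?case using 5(2) by metis
next
  case (1 xs)
  then show ?case by (cases rule: rec_eval.cases) auto
next
  case (2 x)
  then show ?case by (cases rule: rec_eval.cases) auto
next
  case (3 i xs)
  from 3(2) show ?case by (cases rule: rec_eval.cases) auto
qed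

primrec fm_encode :: "fm \<Rightarrow> nat" where
  "fm_encode (Eq x y) = list_encode [0, x, y]"
| "fm_encode (Neg \<phi>) = list_encode [1, fm_encode \<phi>]"
| "fm_encode (Conj \<phi> \<psi>) = list_encode [2, fm_encode \<phi>, fm_encode \<psi>]"
| "fm_encode (Disj \<phi> \<psi>) = list_encode [3, fm_encode \<phi>, fm_encode \<psi>]"
| "fm_encode (Ex x \<phi>) = list_encode [4, x, fm_encode \<phi>]"
| "fm_encode (All x \<phi>) = list_encode [5, x, fm_encode \<phi>]"

fun expr_encode :: "expr \<Rightarrow> nat"
  and builder_encode :: "builder \<Rightarrow> nat" where
  "expr_encode (AVar x) = list_encode [0, x]"
| "expr_encode (UnionOf bs) = list_encode [1, list_encode (map builder_encode bs)]"
| "builder_encode (Builder e xs \<phi>) =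
     list_encode [expr_encode e, list_encode xs, fm_encode \<phi>]"

text \<open>A valuation of finitely many variables is given by the list of its graph.\<close>

definition valuation_on :: "var set \<Rightarrow> (var \<times> atom) list \<Rightarrow> bool" where
  "valuation_on X s \<longleftrightarrow> distinct (map fst s) \<and> fst ` set s = X"

definition pres_value :: "expr \<Rightarrow> (var \<times> atom) list \<Rightarrow> val" where
  "pres_value e s = denot e (\<lambda>x. the (map_of s x))"

definition pres_encode :: "expr \<Rightarrow> (var \<times> atom) list \<Rightarrow> nat" where
  "pres_encode e s = prod_encode (expr_encode e, list_encode (map prod_encode s))"

text \<open>
  \<open>graph_problem_decidable \<G> Q\<close>: one algorithm halts with the correct answer to \<open>Q V E\<close>
  (1 for yes, 0 for no) on every presentation of every definable graph \<open>(V, E)\<close> of the kind \<open>\<G>\<close>.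
\<close>

definition graph_problem_decidable ::
    "(val set \<Rightarrow> val set \<Rightarrow> bool) \<Rightarrow> (val set \<Rightarrow> val set \<Rightarrow> bool) \<Rightarrow> bool" where
  "graph_problem_decidable \<G> Q \<longleftrightarrow>
     (\<exists>f. \<forall>e s V E.
        valuation_on (fv e) s \<longrightarrow>
        pres_value e s = vpair (VSet V) (VSet E) \<longrightarrow>
        \<G> (rcset V) (rcset E) \<longrightarrow>
        rec_eval f [pres_encode e s] (if Q (rcset V) (rcset E) then 1 else 0))"

end

theory Submission
  imports Defs "HOL-Library.FuncSet"
begin

text \<open>
  Let \<open>A\<close> be the finite set of atoms of the valuation. All permutations of the atoms that fix \<open>A\<close>
  pointwise are automorphisms of the graph. A vertex or an edge that is not fixed by all of them
  can be moved off any given finite set, and so can finitely many of them at once; hence the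
  vertices (edges) fixed by all of them, of which there are finitely many, form a solution as soon
  as there is one. To decide whether they do, the graph is evaluated over finitely many atoms: if
  all expressions use at most \<open>M\<close> variables, then \<open>4 * M\<close> atoms suffice, because the atoms of an
  environment can be permuted into the gaps left by those of three others. A cycle is recognised
  there as a nonempty set in which every vertex has a successor. All this is arithmetic on codes
  with bounded quantifiers.
\<close>

section \<open>Closure properties of the recursive functions\<close>

text \<open>The obstacle is that a whole cycle, not just one vertex, has to be moved off a finite
  set. This works because two finite supports of a value intersect in a support
  (\<open>supports_Int\<close>), a property of atoms that carry no structure but equality: moving
  all atoms outside the parameters to fresh places then moves every unfixed element of a finite set
  away at once. The factor 4 comes from shifting a vertex of a cycle below the bound: the
  parameters, the start of the cycle and the next vertex have to stay, each with at most
  \<open>M\<close> atoms, and up to \<open>M\<close> new atoms are needed. Restricting set builders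
  to these atoms must also neither identify different values nor change membership; this is an
  induction in which each witness is permuted below the bound. On the computational side no
  evaluator is programmed. Truth values and codes of values are kept in tables, each a single
  number, that are characterised by local conditions with bounded quantifiers. A table is found by
  unbounded search, which halts because the true values satisfy the conditions, and any table found
  is correct by induction on codes.\<close>

lemma rec_eval_Cn1:
  "rec_eval g xs y \<Longrightarrow> rec_eval f [y] z \<Longrightarrow> rec_eval (Cn f [g]) xs z"
  by (rule rec_eval.intros(4)[where ys = "[y]"]) auto

lemma rec_eval_Cn2:
  "rec_eval g xs y \<Longrightarrow> rec_eval h xs y' \<Longrightarrow> rec_eval f [y, y'] z \<Longrightarrow> rec_eval (Cn f [g, h]) xs z"
  by (rule rec_eval.intros(4)[where ys = "[y, y']"]) auto

lemma rec_eval_Proj: "i < length xs \<Longrightarrow> xs ! i = y \<Longrightarrow> rec_eval (Proj i) xs y"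
  using rec_eval.intros(3) by blast

section \<open>Arithmetic and the pairing function\<close>

definition "r_add = Pr (Proj 0) (Cn Succ [Proj 1])"
definition "r_pred = Pr Zero (Proj 0)"
text \<open>\<open>Pr\<close> recurses on the first argument, so this is subtraction with exchanged
  arguments: the first is taken from the second.\<close>

definition "r_diff = Pr (Proj 0) (Cn r_pred [Proj 1])"
definition "r_triangle = Pr Zero (Cn r_add [Cn Succ [Proj 0], Proj 1])"
definition "r_pair = Cn r_add [Cn r_triangle [r_add], Proj 0]"
text \<open>The search stops at the first \<open>s\<close> for which \<open>triangle (Suc s)\<close>
  exceeds the input. Since \<open>prod_encode (m, n)\<close> is \<open>triangle (m + n) + m\<close>,
  it finds the diagonal \<open>m + n\<close> of the pair.\<close>

definition "r_root = Mn (Cn r_diff [Cn r_triangle [Cn Succ [Proj 0]], Cn Succ [Proj 1]])"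
definition "r_fst = Cn r_diff [Cn r_triangle [r_root], Proj 0]"
definition "r_snd = Cn r_diff [r_fst, r_root]"

lemma rec_eval_add: "rec_eval r_add [n, y] (n + y)"
  unfolding r_add_def
  by (induction n) (auto intro!: rec_eval.intros(5,6) rec_eval_Cn1 rec_eval_Proj rec_eval.intros(2))

lemma rec_eval_pred: "rec_eval r_pred [n] (n - 1)"
  unfolding r_pred_def
proof (induction n)
  case 0
  then show ?case by (auto intro!: rec_eval.intros(5) rec_eval.intros(1))
next
  case (Suc n)
  then show ?case by (rule rec_eval.intros(6)) (auto intro!: rec_eval_Proj)
qed

lemma rec_eval_diff: "rec_eval r_diff [n, y] (y - n)"
proof (induction n)
  case 0
  then show ?case unfolding r_diff_def by (auto intro!: rec_eval.intros(5) rec_eval_Proj)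
next
  case (Suc n)
  have "rec_eval r_pred [y - n] (y - Suc n)" using rec_eval_pred[of "y - n"] by simp
  with Suc show ?case
    unfolding r_diff_def by (auto intro!: rec_eval.intros(6) rec_eval_Cn1 rec_eval_Proj)
qed

lemma rec_eval_triangle: "rec_eval r_triangle [n] (triangle n)"
proof (induction n)
  case 0
  then show ?case unfolding r_triangle_def by (auto intro!: rec_eval.intros(5) rec_eval.intros(1))
next
  case (Suc n)
  have "rec_eval r_add [Suc n, triangle n] (triangle (Suc n))"
    using rec_eval_add[of "Suc n" "triangle n"] by (simp add: add.commute)
  with Suc show ?case
    unfolding r_triangle_def
    by (auto intro!: rec_eval.intros(6) rec_eval_Cn2 rec_eval_Cn1 rec_eval_Proj rec_eval.intros(2))
qed

lemma rec_eval_pair: "rec_eval r_pair [m, n] (prod_encode (m, n))"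
  unfolding r_pair_def prod_encode_def
  by (auto intro!: rec_eval_Cn2 rec_eval_Cn1 rec_eval_Proj rec_eval_add rec_eval_triangle)

lemma triangle_mono: "m \<le> n \<Longrightarrow> triangle m \<le> triangle n"
  by (induction rule: dec_induct) auto

lemma rec_eval_root: "rec_eval r_root [prod_encode (m, n)] (m + n)"
proof -
  let ?z = "prod_encode (m, n)"
  let ?F = "Cn r_diff [Cn r_triangle [Cn Succ [Proj 0]], Cn Succ [Proj 1]]"
  have F: "rec_eval ?F [s, ?z] (Suc ?z - triangle (Suc s))" for s
    by (auto intro!: rec_eval_Cn2 rec_eval_Cn1 rec_eval_Proj rec_eval_diff rec_eval_triangle
        rec_eval.intros(2) simp del: triangle_Suc)
  have z: "?z = triangle (m + n) + m" by (simp add: prod_encode_def)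
  show ?thesis unfolding r_root_def
  proof (rule rec_eval.intros(7))
    show "rec_eval ?F [m + n, ?z] 0" using F[of "m + n"] z by simp
    show "\<forall>s<m + n. \<exists>y. rec_eval ?F [s, ?z] (Suc y)"
    proof (intro allI impI)
      fix s assume "s < m + n"
      then have "triangle (Suc s) \<le> ?z" using triangle_mono[of "Suc s" "m + n"] z by simp
      then show "\<exists>y. rec_eval ?F [s, ?z] (Suc y)" using F[of s] by (metis Suc_diff_le)
    qed
  qed
qed

definition pfst :: "nat \<Rightarrow> nat" where "pfst z = fst (prod_decode z)"
definition psnd :: "nat \<Rightarrow> nat" where "psnd z = snd (prod_decode z)"

lemma pfst_encode [simp]: "pfst (prod_encode (a, b)) = a"
  and psnd_encode [simp]: "psnd (prod_encode (a, b)) = b"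
  and prod_encode_pfst_psnd [simp]: "prod_encode (pfst z, psnd z) = z"
  by (simp_all add: pfst_def psnd_def)

lemma rec_eval_fst: "rec_eval r_fst [z] (pfst z)"
proof -
  obtain m n where z: "z = prod_encode (m, n)" by (metis prod_encode_pfst_psnd)
  have "rec_eval r_diff [triangle (m + n), z] m"
    using rec_eval_diff[of "triangle (m + n)" z] by (simp add: z prod_encode_def)
  then show ?thesis unfolding r_fst_def z pfst_encode
    by (auto intro!: rec_eval_Cn2 rec_eval_Cn1 rec_eval_Proj rec_eval_triangle rec_eval_root)
qed

lemma rec_eval_snd: "rec_eval r_snd [z] (psnd z)"
proof -
  obtain m n where z: "z = prod_encode (m, n)" by (metis prod_encode_pfst_psnd)
  have "rec_eval r_diff [m, m + n] n" using rec_eval_diff[of m "m + n"] by simp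
  then show ?thesis unfolding r_snd_def z psnd_encode
    using rec_eval_fst[of z] z by (auto intro!: rec_eval_Cn2 rec_eval_root)
qed

text \<open>
  Only unary functions are needed: several arguments are packed by \<^const>\<open>prod_encode\<close>, and a
  bound variable is the second component of the packed context.
\<close>

definition computable :: "(nat \<Rightarrow> nat) \<Rightarrow> bool" where
  "computable f \<longleftrightarrow> (\<exists>r. \<forall>x. rec_eval r [x] (f x))"

definition decidable :: "(nat \<Rightarrow> bool) \<Rightarrow> bool" where
  "decidable P \<longleftrightarrow> computable (\<lambda>z. if P z then 1 else 0)"

lemma computable_id: "computable (\<lambda>z. z)"
  unfolding computable_def by (rule exI[of _ "Proj 0"]) (auto intro: rec_eval_Proj)

lemma computable_compose: "computable f \<Longrightarrow> computable g \<Longrightarrow> computable (\<lambda>z. f (g z))"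
  unfolding computable_def by (meson rec_eval_Cn1)

lemma computable_Suc: "computable f \<Longrightarrow> computable (\<lambda>z. Suc (f z))"
  unfolding computable_def by (meson rec_eval_Cn1 rec_eval.intros(2))

lemma computable_const: "computable (\<lambda>z. c)"
proof (induction c)
  case 0
  show ?case unfolding computable_def by (rule exI[of _ Zero]) (auto intro: rec_eval.intros(1))
qed (rule computable_Suc)

lemma computable_pair:
  "computable f \<Longrightarrow> computable g \<Longrightarrow> computable (\<lambda>z. prod_encode (f z, g z))"
  unfolding computable_def by (meson rec_eval_Cn2 rec_eval_pair)

lemma computable_pfst: "computable f \<Longrightarrow> computable (\<lambda>z. pfst (f z))"
  unfolding computable_def by (meson rec_eval_Cn1 rec_eval_fst)

lemma computable_psnd: "computable f \<Longrightarrow> computable (\<lambda>z. psnd (f z))"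
  unfolding computable_def by (meson rec_eval_Cn1 rec_eval_snd)

lemma computable_rec_nat:
  assumes "computable a" "computable n"
    and "computable (\<lambda>w. g (pfst w) (pfst (psnd w)) (psnd (psnd w)))"
  shows "computable (\<lambda>z. rec_nat (a z) (\<lambda>i r. g z i r) (n z))"
proof -
  obtain A B G where A: "\<And>z. rec_eval A [z] (a z)" and B: "\<And>z. rec_eval B [z] (n z)"
    and G: "\<And>w. rec_eval G [w] (g (pfst w) (pfst (psnd w)) (psnd (psnd w)))"
    using assms unfolding computable_def by metis
  \<comment> \<open>\<open>Pr\<close> supplies the index, the previous value and the parameter in
    this order, whereas the packed context of \<open>g\<close> starts with the parameter.\<close>
  let ?G = "Cn G [Cn r_pair [Proj 2, Cn r_pair [Proj 0, Proj 1]]]"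
  have G': "rec_eval ?G [i, r, z] (g z i r)" for i r z
    using G[of "prod_encode (z, prod_encode (i, r))"]
    by (auto intro!: rec_eval_Cn1 rec_eval_Cn2 rec_eval_pair rec_eval_Proj)
  have "rec_eval (Pr A ?G) [k, z] (rec_nat (a z) (\<lambda>i r. g z i r) k)" for k z
  proof (induction k)
    case 0
    show ?case using A by (simp add: rec_eval.intros(5))
  next
    case (Suc k)
    show ?case using rec_eval.intros(6)[OF Suc.IH G'] by simp
  qed
  then have "rec_eval (Cn (Pr A ?G) [B, Proj 0]) [z] (rec_nat (a z) (\<lambda>i r. g z i r) (n z))" for z
    by (auto intro!: rec_eval_Cn2 rec_eval_Proj B)
  then show ?thesis unfolding computable_def by blast
qed

lemma computable_add: "computable f \<Longrightarrow> computable g \<Longrightarrow> computable (\<lambda>z. f z + g z)"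
  unfolding computable_def by (meson rec_eval_Cn2 rec_eval_add)

lemma computable_diff: "computable f \<Longrightarrow> computable g \<Longrightarrow> computable (\<lambda>z. f z - g z)"
  unfolding computable_def by (meson rec_eval_Cn2 rec_eval_diff)

lemma computable_mult:
  assumes "computable f" "computable g"
  shows "computable (\<lambda>z. f z * g z)"
proof -
  have "rec_nat 0 (\<lambda>i r. r + m) n = n * m" for m n :: nat by (induction n) auto
  then have "(\<lambda>z. f z * g z) = (\<lambda>z. rec_nat 0 (\<lambda>i r. r + g z) (f z))" by simp
  moreover have "computable (\<lambda>z. rec_nat 0 (\<lambda>i r. r + g z) (f z))"
    by (intro computable_rec_nat computable_const assms computable_add computable_psnd
        computable_id computable_compose[OF assms(2)] computable_pfst)
  ultimately show ?thesis by simp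
qed

lemma computable_power:
  assumes "computable f" "computable g"
  shows "computable (\<lambda>z. f z ^ g z)"
proof -
  have "rec_nat 1 (\<lambda>i r. r * m) n = m ^ n" for m n :: nat by (induction n) auto
  then have "(\<lambda>z. f z ^ g z) = (\<lambda>z. rec_nat 1 (\<lambda>i r. r * f z) (g z))" by simp
  moreover have "computable (\<lambda>z. rec_nat 1 (\<lambda>i r. r * f z) (g z))"
    by (intro computable_rec_nat computable_const assms computable_mult computable_psnd
        computable_id computable_compose[OF assms(1)] computable_pfst)
  ultimately show ?thesis by simp
qed

lemma decidable_le:
  assumes "computable f" "computable g"
  shows "decidable (\<lambda>z. f z \<le> g z)"
proof -
  have "(\<lambda>z. if f z \<le> g z then 1 else 0) = (\<lambda>z. 1 - (f z - g z))" by auto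
  then show ?thesis
    unfolding decidable_def using assms by (auto intro!: computable_diff computable_const)
qed

lemma decidable_not:
  assumes "decidable P"
  shows "decidable (\<lambda>z. \<not> P z)"
proof -
  have "(\<lambda>z. if \<not> P z then 1 else 0) = (\<lambda>z. 1 - (if P z then 1 else 0 :: nat))" by auto
  then show ?thesis
    using computable_diff[OF computable_const assms[unfolded decidable_def], of 1]
    unfolding decidable_def by (simp only:)
qed

lemma decidable_conj:
  assumes "decidable P" "decidable Q"
  shows "decidable (\<lambda>z. P z \<and> Q z)"
proof -
  have "(\<lambda>z. if P z \<and> Q z then 1 else 0) =
      (\<lambda>z. (if P z then 1 else 0) * (if Q z then 1 else 0 :: nat))" by auto
  then show ?thesis
    using computable_mult[OF assms[unfolded decidable_def]] unfolding decidable_def by (simp only:)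
qed

lemma decidable_disj:
  assumes "decidable P" "decidable Q"
  shows "decidable (\<lambda>z. P z \<or> Q z)"
  using decidable_not[OF decidable_conj[OF decidable_not[OF assms(1)] decidable_not[OF assms(2)]]]
  by (simp only: de_Morgan_conj not_not)

lemma decidable_imp:
  assumes "decidable P" "decidable Q"
  shows "decidable (\<lambda>z. P z \<longrightarrow> Q z)"
  using decidable_disj[OF decidable_not[OF assms(1)] assms(2)] by (simp only: imp_conv_disj)

lemma decidable_iff:
  assumes "decidable P" "decidable Q"
  shows "decidable (\<lambda>z. P z \<longleftrightarrow> Q z)"
  using decidable_conj[OF decidable_imp[OF assms] decidable_imp[OF assms(2,1)]]
  by (simp only: iff_conv_conj_imp)

lemma decidable_eq:
  assumes "computable f" "computable g"
  shows "decidable (\<lambda>z. f z = g z)"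
  using decidable_conj[OF decidable_le[OF assms] decidable_le[OF assms(2,1)]]
  by (simp only: order_eq_iff[symmetric])

lemma computable_If:
  assumes "decidable P" "computable f" "computable g"
  shows "computable (\<lambda>z. if P z then f z else g z)"
proof -
  have "(\<lambda>z. if P z then f z else g z) =
      (\<lambda>z. (if P z then 1 else 0) * f z + (1 - (if P z then 1 else 0)) * g z)" by auto
  moreover have "computable \<dots>"
    using assms(1) unfolding decidable_def
    by (intro computable_add computable_mult computable_diff computable_const assms)
  ultimately show ?thesis by simp
qed

lemma decidable_If:
  assumes "decidable P" "decidable Q" "decidable R"
  shows "decidable (\<lambda>z. if P z then Q z else R z)"
  using decidable_conj[OF decidable_imp[OF assms(1,2)]
      decidable_imp[OF decidable_not[OF assms(1)] assms(3)]]
  by (simp only: if_bool_eq_conj)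

lemma decidable_compose: "decidable P \<Longrightarrow> computable f \<Longrightarrow> decidable (\<lambda>z. P (f z))"
  unfolding decidable_def by (rule computable_compose)

lemma decidable_bex:
  assumes "computable b" and P: "decidable (\<lambda>w. P (pfst w) (psnd w))"
  shows "decidable (\<lambda>z. \<exists>i<b z. P z i)"
proof -
  have "rec_nat 0 (\<lambda>i r. if Q i then 1 else r) n = (if \<exists>i<n. Q i then 1 else 0 :: nat)" for Q n
    by (induction n) (auto simp: less_Suc_eq)
  then have "(\<lambda>z. if \<exists>i<b z. P z i then 1 else 0) =
      (\<lambda>z. rec_nat 0 (\<lambda>i r. if P z i then 1 else r) (b z) :: nat)" by simp
  moreover have "decidable (\<lambda>w. P (pfst w) (pfst (psnd w)))"
    using decidable_compose[OF P, of "\<lambda>w. prod_encode (pfst w, pfst (psnd w))"]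
    by (simp add: computable_pair computable_pfst computable_psnd computable_id)
  then have "computable (\<lambda>z. rec_nat 0 (\<lambda>i r. if P z i then 1 else r) (b z))"
    by (intro computable_rec_nat computable_const assms computable_If computable_psnd computable_id)
  ultimately show ?thesis unfolding decidable_def by (simp only:)
qed

lemma decidable_ball:
  assumes "computable b" "decidable (\<lambda>w. P (pfst w) (psnd w))"
  shows "decidable (\<lambda>z. \<forall>i<b z. P z i)"
  using decidable_not[OF decidable_bex[OF assms(1) decidable_not[OF assms(2)]]]
  by (simp only: not_ex not_imp de_Morgan_conj imp_conv_disj not_not simp_thms)

text \<open>Unbounded search, total because every input has a witness. The evaluation tables are
  obtained this way instead of by course-of-values recursion.\<close>

lemma computable_Least:
  assumes "decidable (\<lambda>w. P (pfst w) (psnd w))" and ex: "\<And>z. \<exists>i. P z i"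
  shows "computable (\<lambda>z. LEAST i. P z i)"
proof -
  obtain F where F: "\<And>w. rec_eval F [w] (if \<not> P (pfst w) (psnd w) then 1 else 0)"
    using decidable_not[OF assms(1)] unfolding decidable_def computable_def by blast
  let ?F = "Cn F [Cn r_pair [Proj 1, Proj 0]]"
  have F': "rec_eval ?F [i, z] (if \<not> P z i then 1 else 0)" for i z
    using F[of "prod_encode (z, i)"]
    by (auto intro!: rec_eval_Cn1 rec_eval_Cn2 rec_eval_pair rec_eval_Proj)
  have "rec_eval (Mn ?F) [z] (LEAST i. P z i)" for z
  proof (rule rec_eval.intros(7))
    show "rec_eval ?F [LEAST i. P z i, z] 0"
      using F'[of "LEAST i. P z i" z] LeastI_ex[OF ex[of z]] by simp
    show "\<forall>m<LEAST i. P z i. \<exists>y. rec_eval ?F [m, z] (Suc y)"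
    proof (intro allI impI)
      fix m assume "m < (LEAST i. P z i)"
      then show "\<exists>y. rec_eval ?F [m, z] (Suc y)"
        using F'[of m z] not_less_Least[of m "P z"] by (intro exI[of _ 0]) simp
    qed
  qed
  then show ?thesis unfolding computable_def by blast
qed

lemma decidable_less: "computable f \<Longrightarrow> computable g \<Longrightarrow> decidable (\<lambda>z. f z < g z)"
  unfolding Suc_le_eq[symmetric] by (intro decidable_le computable_Suc)

lemma computable_div:
  assumes "computable f" "computable g"
  shows "computable (\<lambda>z. f z div g z)"
proof -
  \<comment> \<open>The disjunct \<open>n = 0\<close> stops the search at \<open>0\<close>, which is
    the value of division by zero.\<close>
  have "(LEAST q. n = 0 \<or> m < Suc q * n) = m div n" for m n :: nat
  proof (rule Least_equality)
    show "n = 0 \<or> m < Suc (m div n) * n"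
      using dividend_less_div_times[of n m] by (cases "n = 0") (simp_all add: add.commute)
    fix q assume "n = 0 \<or> m < Suc q * n"
    then show "m div n \<le> q"
      using less_mult_imp_div_less[of m "Suc q" n] by (cases "n = 0") auto
  qed
  then have eq: "(\<lambda>z. f z div g z) = (\<lambda>z. LEAST q. g z = 0 \<or> f z < Suc q * g z)" by simp
  have c: "computable (\<lambda>w. f (pfst w))" "computable (\<lambda>w. g (pfst w))"
    by (intro computable_compose[OF assms(1)] computable_compose[OF assms(2)] computable_pfst
        computable_id)+
  show ?thesis unfolding eq
  proof (rule computable_Least)
    show "decidable (\<lambda>w. g (pfst w) = 0 \<or> f (pfst w) < Suc (psnd w) * g (pfst w))"
      by (intro decidable_disj decidable_eq decidable_less computable_mult computable_Suc
          computable_psnd computable_id computable_const c)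
    show "\<exists>q. g z = 0 \<or> f z < Suc q * g z" for z
      by (cases "g z") (auto intro!: exI[of _ "f z"])
  qed
qed

lemma computable_mod:
  "computable f \<Longrightarrow> computable g \<Longrightarrow> computable (\<lambda>z. f z mod g z)"
  unfolding modulo_nat_def by (intro computable_diff computable_mult computable_div)

lemma decidable_odd: "computable f \<Longrightarrow> decidable (\<lambda>z. odd (f z))"
  unfolding odd_iff_mod_2_eq_one by (intro decidable_eq computable_mod computable_const)

text \<open>With these rules decidability is read off the shape of a formula: computable terms,
  connectives and bounded quantifiers.\<close>

lemmas computable_intros =
  computable_id computable_const computable_Suc computable_pair computable_pfst computable_psnd
  computable_rec_nat computable_add computable_diff computable_mult computable_power computable_div
  computable_mod computable_If decidable_le decidable_less decidable_eq decidable_odd decidable_not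
  decidable_conj decidable_disj decidable_imp decidable_iff decidable_If decidable_bex decidable_ball

section \<open>Permutations of atoms\<close>

primrec pact :: "(atom \<Rightarrow> atom) \<Rightarrow> val \<Rightarrow> val" where
  "pact \<pi> (VAtom a) = VAtom (\<pi> a)"
| "pact \<pi> (VSet X) = VSet (cimage (pact \<pi>) X)"

lemma members_pact: "members (pact \<pi> v) = pact \<pi> ` members v"
  by (cases v) (simp_all add: cimage.rep_eq)

lemma VSet_eq_iff: "VSet X = VSet Y \<longleftrightarrow> rcset X = rcset Y"
  by (simp add: rcset_inject)

lemma pact_comp: "pact \<pi> (pact \<tau> v) = pact (\<pi> \<circ> \<tau>) v"
  by (induction v) (auto simp: VSet_eq_iff cimage.rep_eq image_image simp del: val.inject)

lemma pact_id: "pact id v = v"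
  by (induction v) (auto simp: VSet_eq_iff cimage.rep_eq simp del: val.inject(2))

lemma pact_inv [simp]:
  assumes "bij \<pi>"
  shows "pact (inv \<pi>) (pact \<pi> v) = v" "pact \<pi> (pact (inv \<pi>) v) = v"
proof -
  have "inv \<pi> \<circ> \<pi> = id" "\<pi> \<circ> inv \<pi> = id"
    using assms by (auto simp: bij_is_inj bij_is_surj surj_f_inv_f)
  then show "pact (inv \<pi>) (pact \<pi> v) = v" "pact \<pi> (pact (inv \<pi>) v) = v"
    by (simp_all only: pact_comp pact_id)
qed

lemma pact_eq_iff: "bij \<pi> \<Longrightarrow> pact \<pi> u = pact \<pi> v \<longleftrightarrow> u = v"
  by (metis pact_inv(1))

lemma members_pact_iff: "bij \<pi> \<Longrightarrow> pact \<pi> u \<in> members (pact \<pi> v) \<longleftrightarrow> u \<in> members v"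
  by (auto simp: members_pact pact_eq_iff)

lemma pact_vupair: "pact \<pi> (vupair a b) = vupair (pact \<pi> a) (pact \<pi> b)"
  by (simp add: vupair_def)

lemma pact_vpair: "pact \<pi> (vpair a b) = vpair (pact \<pi> a) (pact \<pi> b)"
  by (simp add: vpair_def pact_vupair)

lemma members_vupair [simp]: "members (vupair a b) = {a, b}"
  by (simp add: vupair_def cinsert.rep_eq bot_cset.rep_eq)

lemma members_vpair [simp]: "members (vpair a b) = {a, vupair a b}"
  by (simp add: vpair_def)

text \<open>Atomic formulas only compare atoms, so injectivity preserves them; surjectivity lets a
  quantifier range over the renamed atoms.\<close>

lemma sat_bij:
  assumes "bij \<pi>"
  shows "sat \<phi> (\<pi> \<circ> \<rho>) \<longleftrightarrow> sat \<phi> \<rho>"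
proof -
  have ex: "(\<exists>b. P b) \<longleftrightarrow> (\<exists>a. P (\<pi> a))" for P using assms by (metis bij_pointE)
  have all: "(\<forall>b. P b) \<longleftrightarrow> (\<forall>a. P (\<pi> a))" for P using assms by (metis bij_pointE)
  show ?thesis
  proof (induction \<phi> arbitrary: \<rho>)
    case (Eq x y)
    then show ?case using assms by (auto simp: bij_def inj_eq)
  next
    case (Ex x \<phi>)
    have "(\<pi> \<circ> \<rho>)(x := \<pi> a) = \<pi> \<circ> \<rho>(x := a)" for a by auto
    then have "sat \<phi> ((\<pi> \<circ> \<rho>)(x := \<pi> a)) \<longleftrightarrow> sat \<phi> (\<rho>(x := a))" for a using Ex.IH by metis
    then show ?case by (simp only: sat.simps ex[of "\<lambda>b. sat \<phi> ((\<pi> \<circ> \<rho>)(x := b))"])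
  next
    case (All x \<phi>)
    have "(\<pi> \<circ> \<rho>)(x := \<pi> a) = \<pi> \<circ> \<rho>(x := a)" for a by auto
    then have "sat \<phi> ((\<pi> \<circ> \<rho>)(x := \<pi> a)) \<longleftrightarrow> sat \<phi> (\<rho>(x := a))" for a using All.IH by metis
    then show ?case by (simp only: sat.simps all[of "\<lambda>b. sat \<phi> ((\<pi> \<circ> \<rho>)(x := b))"])
  qed auto
qed

text \<open>Expressions name no particular atom, so evaluation commutes with renaming. All
  symmetries of a definable graph come from here.\<close>

lemma denot_bij: "bij \<pi> \<Longrightarrow> denot e (\<pi> \<circ> \<rho>) = pact \<pi> (denot e \<rho>)"
  and builder_vals_bij: "bij \<pi> \<Longrightarrow> builder_vals b (\<pi> \<circ> \<rho>) = pact \<pi> ` builder_vals b \<rho>"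
proof (induction e and b arbitrary: \<rho> and \<rho> rule: expr.induct builder.induct)
  case (UnionOf bs)
  have "members (denot (UnionOf bs) (\<pi> \<circ> \<rho>)) = pact \<pi> ` members (denot (UnionOf bs) \<rho>)"
    unfolding members_denot_UnionOf image_UN by (intro SUP_cong refl UnionOf)
  then show ?case by (simp add: VSet_eq_iff cimage.rep_eq comp_def del: val.inject)
next
  case (Builder e xs \<phi>)
  show ?case
  proof (intro subset_antisym subsetI)
    fix v assume "v \<in> builder_vals (Builder e xs \<phi>) (\<pi> \<circ> \<rho>)"
    then obtain \<tau> where \<tau>: "v = denot e \<tau>" "\<forall>y. y \<notin> set xs \<longrightarrow> \<tau> y = \<pi> (\<rho> y)" "sat \<phi> \<tau>"
      by auto
    have eq: "\<pi> \<circ> (inv \<pi> \<circ> \<tau>) = \<tau>"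
      using Builder.prems by (auto simp: bij_is_surj surj_f_inv_f)
    have "inv \<pi> \<circ> \<tau> \<in> {\<tau>. (\<forall>y. y \<notin> set xs \<longrightarrow> \<tau> y = \<rho> y) \<and> sat \<phi> \<tau>}"
      using \<tau> Builder.prems sat_bij[OF Builder.prems, of \<phi> "inv \<pi> \<circ> \<tau>"] eq
      by (simp add: bij_is_inj)
    moreover have "v = pact \<pi> (denot e (inv \<pi> \<circ> \<tau>))"
      using Builder.IH[OF Builder.prems, of "inv \<pi> \<circ> \<tau>"] unfolding eq \<tau>(1) .
    ultimately show "v \<in> pact \<pi> ` builder_vals (Builder e xs \<phi>) \<rho>"
      by (simp only: builder_vals.simps) blast
  next
    fix v assume "v \<in> pact \<pi> ` builder_vals (Builder e xs \<phi>) \<rho>"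
    then obtain \<tau> where \<tau>: "v = pact \<pi> (denot e \<tau>)" "\<forall>y. y \<notin> set xs \<longrightarrow> \<tau> y = \<rho> y" "sat \<phi> \<tau>"
      by auto
    have "v = denot e (\<pi> \<circ> \<tau>)"
      unfolding \<tau>(1) by (rule Builder.IH[OF Builder.prems, symmetric])
    moreover have "\<forall>y. y \<notin> set xs \<longrightarrow> (\<pi> \<circ> \<tau>) y = (\<pi> \<circ> \<rho>) y" "sat \<phi> (\<pi> \<circ> \<tau>)"
      using \<tau> Builder.prems sat_bij by auto
    ultimately show "v \<in> builder_vals (Builder e xs \<phi>) (\<pi> \<circ> \<rho>)"
      by (simp only: builder_vals.simps mem_Collect_eq) blast
  qed
qed simp

text \<open>\<open>F\<close> and its image have the same size, so equally many points of their union
  lie outside each. Matching these leftovers completes \<open>f\<close> to a permutation of the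
  union, and the identity extends it to the whole type.\<close>

lemma bij_extending_inj_on:
  fixes f :: "'a \<Rightarrow> 'a"
  assumes "finite F" "inj_on f F"
  shows "\<exists>\<pi>. bij \<pi> \<and> (\<forall>a\<in>F. \<pi> a = f a)"
proof -
  let ?U = "F \<union> f ` F"
  have "card (?U - F) = card (?U - f ` F)"
    using assms by (simp add: card_Diff_subset card_image)
  then obtain g where g: "bij_betw g (?U - F) (?U - f ` F)"
    using finite_same_card_bij[of "?U - F" "?U - f ` F"] assms(1) by auto
  let ?h = "\<lambda>a. if a \<in> F then f a else if a \<in> ?U then g a else a"
  have "bij_betw ?h F (f ` F)" using assms(2) by (simp add: bij_betw_def inj_on_def)
  moreover have "bij_betw ?h (?U - F) (?U - f ` F)"
    using g by (subst bij_betw_cong[of _ _ g]) auto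
  ultimately have "bij_betw ?h (F \<union> (?U - F)) (f ` F \<union> (?U - f ` F))"
    by (rule bij_betw_combine) auto
  moreover have "bij_betw ?h (- ?U) (- ?U)"
    by (subst bij_betw_cong[of _ _ id]) auto
  ultimately have "bij_betw ?h ((F \<union> (?U - F)) \<union> - ?U) ((f ` F \<union> (?U - f ` F)) \<union> - ?U)"
    by (rule bij_betw_combine) auto
  moreover have "(F \<union> (?U - F)) \<union> - ?U = UNIV" "(f ` F \<union> (?U - f ` F)) \<union> - ?U = UNIV"
    by auto
  ultimately have "bij ?h" by simp
  then show ?thesis by (intro exI[of _ ?h]) auto
qed

text \<open>As \<open>B\<close> avoids \<open>K\<close>, the identity on \<open>K\<close> and an
  injection of the remaining points of \<open>T\<close> into \<open>B\<close> are jointly injective,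
  hence extend to a permutation.\<close>

lemma bij_moving_into:
  fixes K T B :: "'a set"
  assumes "finite K" "finite T" "finite B" "B \<inter> K = {}" "card (T - K) \<le> card B"
  shows "\<exists>\<pi>. bij \<pi> \<and> (\<forall>a\<in>K. \<pi> a = a) \<and> \<pi> ` (T - K) \<subseteq> B"
proof -
  obtain g where g: "inj_on g (T - K)" "g ` (T - K) \<subseteq> B"
    using inj_on_iff_card_le[of "T - K" B] assms by auto
  let ?f = "\<lambda>a. if a \<in> K then a else g a"
  have "inj_on ?f (K \<union> (T - K))"
    using g assms(4) by (auto simp: inj_on_def)
  then obtain \<pi> where "bij \<pi>" "\<forall>a\<in>K \<union> (T - K). \<pi> a = ?f a"
    using bij_extending_inj_on[of "K \<union> (T - K)" ?f] assms by auto
  then show ?thesis using g by (intro exI[of _ \<pi>]) auto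
qed

lemma bij_moving_off:
  fixes K T S :: "nat set"
  assumes "finite K" "finite T" "finite S"
  shows "\<exists>\<pi>. bij \<pi> \<and> (\<forall>a\<in>K. \<pi> a = a) \<and> \<pi> ` (T - K) \<inter> S = {}"
proof -
  have "infinite (- (K \<union> S))" using assms by (simp add: Compl_eq_Diff_UNIV)
  then obtain B where B: "finite B" "card B = card (T - K)" "B \<subseteq> - (K \<union> S)"
    using infinite_arbitrarily_large by blast
  then show ?thesis using bij_moving_into[of K T B] assms by auto blast
qed

section \<open>Supports, in the sense of nominal sets\<close>

definition supports :: "atom set \<Rightarrow> val \<Rightarrow> bool" where
  "supports K v \<longleftrightarrow> (\<forall>\<pi>. bij \<pi> \<longrightarrow> (\<forall>a\<in>K. \<pi> a = a) \<longrightarrow> pact \<pi> v = v)"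

lemma supportsD: "supports K v \<Longrightarrow> bij \<pi> \<Longrightarrow> (\<And>a. a \<in> K \<Longrightarrow> \<pi> a = a) \<Longrightarrow> pact \<pi> v = v"
  by (simp add: supports_def)

lemma supports_mono: "supports K v \<Longrightarrow> K \<subseteq> L \<Longrightarrow> supports L v"
  unfolding supports_def by blast

text \<open>Two permutations that agree on \<open>K\<close> differ by one that fixes
  \<open>K\<close> pointwise.\<close>

lemma pact_eq_if_agree:
  assumes "supports K v" "bij \<pi>" "bij \<tau>" "\<And>a. a \<in> K \<Longrightarrow> \<pi> a = \<tau> a"
  shows "pact \<pi> v = pact \<tau> v"
proof -
  have "pact (inv \<tau> \<circ> \<pi>) v = v"
    using assms by (intro supportsD[of K]) (auto intro: bij_comp bij_imp_bij_inv simp: bij_is_inj)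
  then show ?thesis using assms(3) by (metis pact_comp pact_inv(2))
qed

lemma supports_pact:
  assumes "supports K v" "bij \<pi>"
  shows "supports (\<pi> ` K) (pact \<pi> v)"
  unfolding supports_def
proof (intro allI impI)
  fix \<tau> assume \<tau>: "bij \<tau>" "\<forall>a\<in>\<pi> ` K. \<tau> a = a"
  then have "pact (\<tau> \<circ> \<pi>) v = pact \<pi> v"
    using assms by (intro pact_eq_if_agree[of K]) (auto intro: bij_comp)
  then show "pact \<tau> (pact \<pi> v) = pact \<pi> v" by (simp add: pact_comp)
qed

lemma supports_denot:
  assumes "\<And>x. x \<in> fv e \<Longrightarrow> \<rho> x \<in> K"
  shows "supports K (denot e \<rho>)"
  unfolding supports_def
proof (intro allI impI)
  fix \<pi> assume "bij \<pi>" "\<forall>a\<in>K. \<pi> a = a"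
  then have "denot e (\<pi> \<circ> \<rho>) = denot e \<rho>" using assms by (intro denot_cong) auto
  with \<open>bij \<pi>\<close> show "pact \<pi> (denot e \<rho>) = denot e \<rho>" by (simp add: denot_bij)
qed

text \<open>
  A permutation \<open>\<theta>\<close> fixing \<open>P \<inter> Q\<close> acts on \<open>v\<close> like a permutation fixing a copy \<open>\<tau> ` P\<close> of
  \<open>P\<close> that is fresh outside \<open>P \<inter> Q\<close> and supports \<open>v\<close> because \<open>Q\<close> does.
\<close>

lemma supports_Int:
  assumes "finite P" "finite Q" "supports P v" "supports Q v"
  shows "supports (P \<inter> Q) v"
  unfolding supports_def
proof (intro allI impI)
  fix \<theta> assume \<theta>: "bij \<theta>" "\<forall>a\<in>P \<inter> Q. \<theta> a = a"
  \<comment> \<open>The copy of \<open>P\<close> also has to avoid the image of \<open>P\<close>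
    under \<open>\<theta>\<close>: otherwise \<open>\<theta>\<close> on \<open>P\<close> and the
    identity on the copy might not join to an injection.\<close>
  obtain \<tau> where \<tau>: "bij \<tau>" "\<forall>a\<in>Q. \<tau> a = a" "\<tau> ` (P - Q) \<inter> (P \<union> Q \<union> \<theta> ` P) = {}"
    using bij_moving_off[of Q P "P \<union> Q \<union> \<theta> ` P"] assms by auto
  have \<tau>v: "pact \<tau> v = v" using assms(4) \<tau> by (auto intro: supportsD)
  have \<tau>P: "supports (\<tau> ` P) v" using supports_pact[OF assms(3) \<tau>(1)] \<tau>v by simp
  let ?f = "\<lambda>a. if a \<in> P then \<theta> a else a"
  have fresh: "a \<notin> P \<and> a \<notin> \<theta> ` P" if a: "a \<in> \<tau> ` P" "a \<notin> P \<inter> Q" for a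
  proof -
    obtain b where "b \<in> P" "a = \<tau> b" using a(1) by blast
    moreover have "b \<notin> Q" using \<tau>(2) a(2) calculation by auto
    ultimately show ?thesis using \<tau>(3) by blast
  qed
  have unmoved: "?f a = a" if "a \<in> \<tau> ` P" for a
    using that fresh[of a] \<theta>(2) by auto
  have "inj_on ?f (P \<union> \<tau> ` P)"
  proof (rule inj_onI)
    fix a b assume ab: "a \<in> P \<union> \<tau> ` P" "b \<in> P \<union> \<tau> ` P" "?f a = ?f b"
    have inj: "\<theta> a = \<theta> b \<longleftrightarrow> a = b" for a b using \<theta>(1) by (simp add: bij_is_inj inj_eq)
    have "\<theta> x \<noteq> y" if "x \<in> P" "y \<in> \<tau> ` P" "y \<notin> P" for x y
      using fresh[OF that(2)] that(1,3) by (metis IntD1 imageI)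
    with ab inj show "a = b" by (auto split: if_splits)
  qed
  then obtain \<eta> where \<eta>: "bij \<eta>" "\<forall>a\<in>P \<union> \<tau> ` P. \<eta> a = ?f a"
    using bij_extending_inj_on[of "P \<union> \<tau> ` P" ?f] assms by auto
  have "pact \<theta> v = pact \<eta> v"
    using \<theta>(1) \<eta> by (intro pact_eq_if_agree[OF assms(3)]) auto
  also have "\<dots> = v"
    using \<eta> unmoved by (intro supportsD[OF \<tau>P]) auto
  finally show "pact \<theta> v = v" .
qed

lemma common_support:
  assumes "finite S" "finite A" "\<And>v. v \<in> S \<Longrightarrow> \<exists>K. finite K \<and> supports K v"
  shows "\<exists>K. finite K \<and> A \<subseteq> K \<and> (\<forall>v\<in>S. supports K v)"
proof -
  obtain k where k: "\<And>v. v \<in> S \<Longrightarrow> finite (k v) \<and> supports (k v) v" using assms(3) by metis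
  then have "\<forall>v\<in>S. supports (A \<union> (\<Union>v\<in>S. k v)) v"
    by (blast intro: supports_mono)
  then show ?thesis using assms k by (intro exI[of _ "A \<union> (\<Union>v\<in>S. k v)"]) auto
qed

text \<open>
  If all atoms of \<open>X\<close> outside \<open>A\<close> are moved to fresh ones, then an element of \<open>X\<close> that is moved
  into \<open>S\<close> is supported both by atoms of \<open>S\<close> and by atoms that are fresh outside \<open>A\<close>.
\<close>

lemma ex_bij_moving_vals_off:
  assumes "finite A" "finite S" "finite X"
    and "\<And>v. v \<in> S \<union> X \<Longrightarrow> \<exists>K. finite K \<and> supports K v"
  shows "\<exists>\<pi>. bij \<pi> \<and> (\<forall>a\<in>A. \<pi> a = a) \<and> (\<forall>v\<in>X. pact \<pi> v \<in> S \<longrightarrow> supports A v)"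
proof -
  obtain K where K: "finite K" "A \<subseteq> K" "\<And>v. v \<in> S \<Longrightarrow> supports K v"
    using common_support[of S A] assms by auto
  obtain L where L: "finite L" "A \<subseteq> L" "\<And>v. v \<in> X \<Longrightarrow> supports L v"
    using common_support[of X A] assms by auto
  obtain \<pi> where \<pi>: "bij \<pi>" "\<forall>a\<in>A. \<pi> a = a" "\<pi> ` (L - A) \<inter> K = {}"
    using bij_moving_off[of A L K] assms K L by auto
  have "supports A v" if v: "v \<in> X" "pact \<pi> v \<in> S" for v
  proof -
    have "supports (\<pi> ` L \<inter> K) (pact \<pi> v)"
      using K L v \<pi> by (intro supports_Int supports_pact) auto
    moreover have "\<pi> ` L \<inter> K \<subseteq> A" using \<pi> by force
    ultimately have "supports A (pact \<pi> v)" by (rule supports_mono)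
    then have "supports (inv \<pi> ` A) (pact (inv \<pi>) (pact \<pi> v))"
      using \<pi>(1) by (intro supports_pact bij_imp_bij_inv)
    moreover have "inv \<pi> ` A \<subseteq> A"
      using \<pi> by (auto simp: bij_is_inj inv_f_eq)
    ultimately show ?thesis using \<pi>(1) by (auto intro: supports_mono)
  qed
  with \<pi> show ?thesis by blast
qed

text \<open>The components of an ordered pair cannot be exchanged, so a pair is fixed only
  componentwise. Hence an arc is fixed exactly when both its ends are, and no separate test for arcs
  will be needed.\<close>

lemma supports_vpair:
  "supports K (vpair a b) \<longleftrightarrow> supports K a \<and> supports K b"
  by (auto simp: supports_def pact_vpair vpair_eq_iff)

lemma supports_vupair:
  "supports K a \<Longrightarrow> supports K b \<Longrightarrow> supports K (vupair a b)"
  by (auto simp: supports_def pact_vupair)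

section \<open>Approximation by finitely many atoms\<close>

text \<open>
  Hereditarily finite sets over the atoms below \<open>N\<close> are coded by numbers: an atom by an even
  number, a set by an odd one. Environments range over the atoms below \<open>N\<close> and only matter on
  the variables below \<open>M\<close>.
\<close>

definition envs :: "nat \<Rightarrow> nat \<Rightarrow> (var \<Rightarrow> atom) set" where
  "envs M N = {\<rho>. (\<forall>x<M. \<rho> x < N) \<and> (\<forall>x\<ge>M. \<rho> x = 0)}"

text \<open>Only the variables bound by set builders are confined to \<open>envs M N\<close>;
  conditions are still evaluated by \<open>sat\<close>, with quantifiers over all atoms. Confining
  those quantifiers is a separate matter, settled where truth tables are built.\<close>

fun hval :: "nat \<Rightarrow> nat \<Rightarrow> expr \<Rightarrow> (var \<Rightarrow> atom) \<Rightarrow> nat"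
  and hvals :: "nat \<Rightarrow> nat \<Rightarrow> builder \<Rightarrow> (var \<Rightarrow> atom) \<Rightarrow> nat set" where
  "hval M N (AVar x) \<rho> = 2 * \<rho> x"
| "hval M N (UnionOf bs) \<rho> = Suc (2 * set_encode (\<Union>b\<in>set bs. hvals M N b \<rho>))"
| "hvals M N (Builder e xs \<phi>) \<rho> =
     {hval M N e \<rho>' | \<rho>'. \<rho>' \<in> envs M N \<and> (\<forall>y. y \<notin> set xs \<longrightarrow> \<rho>' y = \<rho> y) \<and> sat \<phi> \<rho>'}"

definition hmem :: "nat \<Rightarrow> nat set" where
  "hmem h = (if odd h then set_decode (h div 2) else {})"

text \<open>The odd code of \<open>{a, b}\<close>, written as arithmetic so that it is visibly
  computable. The case distinction keeps a bit from being added twice, which would carry.\<close>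

definition hupair :: "nat \<Rightarrow> nat \<Rightarrow> nat" where
  "hupair a b = Suc (2 * (2 ^ a + (if a = b then 0 else 2 ^ b)))"

definition hpair :: "nat \<Rightarrow> nat \<Rightarrow> nat" where
  "hpair a b = hupair a (hupair a b)"

lemma finite_envs: "finite (envs M N)"
proof -
  have "(\<lambda>\<rho>. restrict \<rho> {..<M}) ` envs M N \<subseteq> {..<M} \<rightarrow>\<^sub>E {..<N}"
    by (auto simp: envs_def split: if_splits)
  moreover have "inj_on (\<lambda>\<rho>. restrict \<rho> {..<M}) (envs M N)"
  proof (rule inj_onI, rule ext)
    fix \<rho> \<rho>' x assume *: "\<rho> \<in> envs M N" "\<rho>' \<in> envs M N" "restrict \<rho> {..<M} = restrict \<rho>' {..<M}"
    show "\<rho> x = \<rho>' x"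
      using fun_cong[OF *(3), of x] *(1,2) by (cases "x < M") (auto simp: envs_def)
  qed
  ultimately show ?thesis
    by (meson finite_PiE finite_imageD finite_lessThan finite_subset)
qed

lemma finite_hvals: "finite (hvals M N b \<rho>)"
proof (cases b)
  case (Builder e xs \<phi>)
  then have "hvals M N b \<rho> \<subseteq> hval M N e ` envs M N" by auto
  then show ?thesis using finite_envs finite_surj by blast
qed

lemma hmem_hval: "hmem (hval M N (UnionOf bs) \<rho>) = (\<Union>b\<in>set bs. hvals M N b \<rho>)"
  by (simp add: hmem_def set_encode_inverse finite_hvals)

text \<open>A set bit \<open>x\<close> forces the number to be at least \<open>2 ^ x\<close>. This
  is what bounds every quantifier over the elements of a coded set.\<close>

lemma hmem_less: "x \<in> hmem h \<Longrightarrow> x < h"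
proof -
  assume "x \<in> hmem h"
  then have odd: "odd ((h div 2) div 2 ^ x)" by (auto simp: hmem_def set_decode_def split: if_splits)
  have "2 ^ x \<le> h div 2"
  proof (rule ccontr)
    assume "\<not> 2 ^ x \<le> h div 2"
    then have "(h div 2) div 2 ^ x = 0" by (simp add: div_less)
    with odd show False by simp
  qed
  moreover have "x < 2 ^ x" by (rule less_exp)
  ultimately show "x < h" by linarith
qed

lemma hmem_hupair: "hmem (hupair a b) = {a, b}"
proof -
  have "set_encode {a, b} = 2 ^ a + (if a = b then 0 else 2 ^ b)" by (simp add: set_encode_def)
  then have "set_decode (2 ^ a + (if a = b then 0 else 2 ^ b)) = {a, b}"
    by (metis set_encode_inverse finite.emptyI finite.insertI)
  then show ?thesis by (simp add: hmem_def hupair_def)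
qed

text \<open>Oddness restricts extensionality to sets; atoms have even codes and no elements.\<close>

lemma hmem_inj: "odd h \<Longrightarrow> odd h' \<Longrightarrow> hmem h = hmem h' \<Longrightarrow> h = h'"
  by (metis (full_types) hmem_def set_decode_inverse odd_two_times_div_two_succ)

lemma odd_hupair: "odd (hupair a b)"
  by (simp add: hupair_def)

lemma hpair_eq_iff: "hpair a b = hpair c d \<longleftrightarrow> a = c \<and> b = d"
proof
  assume "hpair a b = hpair c d"
  then have "{a, hupair a b} = {c, hupair c d}" by (metis hmem_hupair hpair_def)
  moreover have "a < hupair a b" "c < hupair c d" using hmem_hupair hmem_less by blast+
  ultimately have "a = c" "hupair a b = hupair c d" by (auto simp: doubleton_eq_iff)
  then show "a = c \<and> b = d" by (metis hmem_hupair doubleton_eq_iff)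
qed simp

text \<open>Lets the components of a coded pair be found by bounded search.\<close>

lemma hpair_less: "a < hpair a b" "b < hpair a b"
proof -
  have "a < hupair a c" "c < hupair a c" for a c using hmem_hupair hmem_less by blast+
  then show "a < hpair a b" "b < hpair a b" unfolding hpair_def by (meson less_trans)+
qed

lemma members_denotI:
  "\<lbrakk>Builder e xs \<phi> \<in> set bs; \<And>y. y \<notin> set xs \<Longrightarrow> \<tau> y = \<rho> y; sat \<phi> \<tau>\<rbrakk>
    \<Longrightarrow> denot e \<tau> \<in> members (denot (UnionOf bs) \<rho>)"
  unfolding members_denot_UnionOf
  by (rule UN_I, assumption, unfold builder_vals.simps mem_Collect_eq, intro exI[of _ \<tau>]) blast

lemma members_denotE:
  assumes "v \<in> members (denot (UnionOf bs) \<rho>)"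
  obtains e xs \<phi> \<tau> where "Builder e xs \<phi> \<in> set bs" "\<And>y. y \<notin> set xs \<Longrightarrow> \<tau> y = \<rho> y"
    "sat \<phi> \<tau>" "v = denot e \<tau>"
proof -
  obtain b where b: "b \<in> set bs" "v \<in> builder_vals b \<rho>"
    using assms unfolding members_denot_UnionOf by blast
  obtain e xs \<phi> where "b = Builder e xs \<phi>" by (cases b)
  with b show ?thesis using that by auto
qed

lemma hmem_hvalI:
  "\<lbrakk>Builder e xs \<phi> \<in> set bs; \<tau> \<in> envs M N; \<And>y. y \<notin> set xs \<Longrightarrow> \<tau> y = \<rho> y; sat \<phi> \<tau>\<rbrakk>
    \<Longrightarrow> hval M N e \<tau> \<in> hmem (hval M N (UnionOf bs) \<rho>)"
  unfolding hmem_hval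
  by (rule UN_I, assumption, unfold hvals.simps mem_Collect_eq, intro exI[of _ \<tau>]) blast

lemma hmem_hvalE:
  assumes "h \<in> hmem (hval M N (UnionOf bs) \<rho>)"
  obtains e xs \<phi> \<tau> where "Builder e xs \<phi> \<in> set bs" "\<tau> \<in> envs M N"
    "\<And>y. y \<notin> set xs \<Longrightarrow> \<tau> y = \<rho> y" "sat \<phi> \<tau>" "h = hval M N e \<tau>"
proof -
  obtain b where b: "b \<in> set bs" "h \<in> hvals M N b \<rho>"
    using assms unfolding hmem_hval by blast
  obtain e xs \<phi> where "b = Builder e xs \<phi>" by (cases b)
  with b show ?thesis using that by auto
qed

text \<open>
  \<open>4 * M\<close> atoms leave room for one environment beside the atoms of three others: this lets
  witnesses that use arbitrary atoms be moved below \<open>N\<close>.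
\<close>

locale finite_approximation =
  fixes X :: "expr set" and M N :: nat
  assumes finite_X: "finite X"
    and AVar_X: "AVar x \<in> X \<Longrightarrow> x < M"
    and Builder_X: "UnionOf bs \<in> X \<Longrightarrow> Builder e xs \<phi> \<in> set bs \<Longrightarrow> e \<in> X \<and> fv_fm \<phi> \<subseteq> {..<M}"
    and N_ge: "4 * M \<le> N"
    and M_pos: "0 < M"
begin

abbreviation "hv \<equiv> hval M N"
abbreviation "Env \<equiv> envs M N"

section \<open>Moving environments below \<open>N\<close> and comparing values by their
  codes\<close>

lemma fv_X: "e \<in> X \<Longrightarrow> fv e \<subseteq> {..<M}"
  and "(\<And>e xs \<phi>. b = Builder e xs \<phi> \<Longrightarrow> e \<in> X \<and> fv_fm \<phi> \<subseteq> {..<M}) \<Longrightarrow> fv_builder b \<subseteq> {..<M}"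
proof (induction e and b rule: expr.induct builder.induct)
  case (AVar x)
  then show ?case using AVar_X by simp
next
  case (UnionOf bs)
  have "fv_builder b \<subseteq> {..<M}" if "b \<in> set bs" for b
    using that UnionOf.prems Builder_X by (intro UnionOf.IH) auto
  then show ?case by auto
next
  case (Builder e xs \<phi>)
  then show ?case by fastforce
qed

text \<open>The renaming has to match below \<open>M\<close> only: environments in
  \<open>Env\<close> are \<open>0\<close> from \<open>M\<close> on and therefore in general not
  literally of the form \<open>\<pi> \<circ> \<rho>\<close>.\<close>

lemma denot_bij_X:
  assumes "e \<in> X" "bij \<pi>" "\<And>x. x < M \<Longrightarrow> \<rho>' x = \<pi> (\<rho> x)"
  shows "denot e \<rho>' = pact \<pi> (denot e \<rho>)"
proof -
  have "denot e \<rho>' = denot e (\<pi> \<circ> \<rho>)" using assms fv_X by (intro denot_cong) auto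
  then show ?thesis using denot_bij[OF assms(2)] by simp
qed

lemma sat_bij_below:
  assumes "fv_fm \<phi> \<subseteq> {..<M}" "bij \<pi>" "\<And>x. x < M \<Longrightarrow> \<rho>' x = \<pi> (\<rho> x)"
  shows "sat \<phi> \<rho>' \<longleftrightarrow> sat \<phi> \<rho>"
proof -
  have "sat \<phi> \<rho>' \<longleftrightarrow> sat \<phi> (\<pi> \<circ> \<rho>)" using assms by (intro sat_cong) auto
  then show ?thesis using sat_bij[OF assms(2)] by simp
qed

lemma Env_range:
  assumes "\<rho> \<in> Env"
  shows "finite (\<rho> ` {..<M})" "\<rho> ` {..<M} \<subseteq> {..<N}" "card (\<rho> ` {..<M}) \<le> M"
  using assms card_image_le[of "{..<M}" \<rho>] by (auto simp: envs_def)

lemma bij_moving_env: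
  assumes "K \<subseteq> {..<N}" "card K \<le> 3 * M"
  shows "\<exists>\<pi>. bij \<pi> \<and> (\<forall>a\<in>K. \<pi> a = a) \<and> (\<lambda>x. if x < M then \<pi> (\<tau> x) else 0) \<in> Env"
proof -
  have fin: "finite K" using assms(1) finite_subset by blast
  have "card (\<tau> ` {..<M} - K) \<le> card (\<tau> ` {..<M})" by (intro card_mono) auto
  also have "\<dots> \<le> M" using card_image_le[of "{..<M}" \<tau>] by simp
  also have "\<dots> \<le> card ({..<N} - K)"
    using assms N_ge fin by (simp add: card_Diff_subset)
  finally obtain \<pi> where \<pi>: "bij \<pi>" "\<forall>a\<in>K. \<pi> a = a" "\<pi> ` (\<tau> ` {..<M} - K) \<subseteq> {..<N} - K"
    using bij_moving_into[of K "\<tau> ` {..<M}" "{..<N} - K", OF fin] by blast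
  have "\<pi> (\<tau> x) < N" if "x < M" for x
    using \<pi>(2,3) that assms(1) by (cases "\<tau> x \<in> K") auto
  then show ?thesis using \<pi> by (auto simp: envs_def)
qed

text \<open>Stated for builder lists whose union need not belong to \<open>X\<close>, with
  faithfulness of the codes of elements as a hypothesis. It thus serves as the induction step for
  equality of values and again for membership, where a singleton is compared with a set.\<close>

lemma subset_iff_hmem_subset:
  assumes \<rho>: "\<rho> \<in> Env" "\<rho>' \<in> Env"
    and bs: "\<And>e xs \<phi>. Builder e xs \<phi> \<in> set bs \<Longrightarrow> e \<in> X \<and> fv_fm \<phi> \<subseteq> {..<M}"
    and bs': "\<And>e xs \<phi>. Builder e xs \<phi> \<in> set bs' \<Longrightarrow> e \<in> X \<and> fv_fm \<phi> \<subseteq> {..<M}"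
    and eq_iff: "\<And>e xs \<phi> e' xs' \<phi>' \<tau> \<tau>'. \<lbrakk>Builder e xs \<phi> \<in> set bs; Builder e' xs' \<phi>' \<in> set bs';
      \<tau> \<in> Env; \<tau>' \<in> Env\<rbrakk> \<Longrightarrow> denot e \<tau> = denot e' \<tau>' \<longleftrightarrow> hv e \<tau> = hv e' \<tau>'"
  shows "members (denot (UnionOf bs) \<rho>) \<subseteq> members (denot (UnionOf bs') \<rho>') \<longleftrightarrow>
    hmem (hv (UnionOf bs) \<rho>) \<subseteq> hmem (hv (UnionOf bs') \<rho>')"
proof (intro iffI subsetI)
  fix h
  assume sub: "members (denot (UnionOf bs) \<rho>) \<subseteq> members (denot (UnionOf bs') \<rho>')"
    and "h \<in> hmem (hv (UnionOf bs) \<rho>)"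
  then obtain e xs \<phi> \<tau> where e: "Builder e xs \<phi> \<in> set bs" "\<tau> \<in> Env"
    "\<And>y. y \<notin> set xs \<Longrightarrow> \<tau> y = \<rho> y" "sat \<phi> \<tau>" "h = hv e \<tau>" by (blast elim: hmem_hvalE)
  have "denot e \<tau> \<in> members (denot (UnionOf bs) \<rho>)"
    using e(1,3,4) by (rule members_denotI)
  from subsetD[OF sub this] obtain e' xs' \<phi>' \<tau>' where e': "Builder e' xs' \<phi>' \<in> set bs'"
    "\<And>y. y \<notin> set xs' \<Longrightarrow> \<tau>' y = \<rho>' y" "sat \<phi>' \<tau>'" "denot e \<tau> = denot e' \<tau>'"
    by (rule members_denotE) (rule that)
  \<comment> \<open>Fixing the atoms of \<open>\<tau>\<close> keeps the element in place, and fixing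
    those of \<open>\<rho>'\<close> keeps the set in which it has to lie.\<close>
  let ?K = "\<tau> ` {..<M} \<union> \<rho>' ` {..<M}"
  have "card ?K \<le> 3 * M"
    using card_Un_le[of "\<tau> ` {..<M}" "\<rho>' ` {..<M}"] Env_range[OF e(2)] Env_range[OF \<rho>(2)] by linarith
  then obtain \<pi> where \<pi>: "bij \<pi>" "\<forall>a\<in>?K. \<pi> a = a"
    "(\<lambda>x. if x < M then \<pi> (\<tau>' x) else 0) \<in> Env" (is "?\<tau> \<in> _")
    using bij_moving_env[of ?K \<tau>'] Env_range[OF e(2)] Env_range[OF \<rho>(2)] by blast
  have "denot e' ?\<tau> = pact \<pi> (denot e' \<tau>')"
    using bs'[OF e'(1)] \<pi>(1) by (intro denot_bij_X) auto
  also have "\<dots> = pact \<pi> (denot e \<tau>)" using e'(4) by simp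
  also have "\<dots> = denot e \<tau>"
    using bs[OF e(1)] \<pi>(1,2) by (intro denot_bij_X[symmetric]) auto
  finally have "hv e \<tau> = hv e' ?\<tau>"
    using eq_iff[OF e(1) e'(1) e(2) \<pi>(3)] by simp
  moreover have "hv e' ?\<tau> \<in> hmem (hv (UnionOf bs') \<rho>')"
  proof (rule hmem_hvalI[OF e'(1) \<pi>(3)])
    show "?\<tau> y = \<rho>' y" if "y \<notin> set xs'" for y
      using that e'(2)[OF that] \<pi>(2) \<rho>(2) by (auto simp: envs_def)
    show "sat \<phi>' ?\<tau>"
      using sat_bij_below[of \<phi>' \<pi> ?\<tau> \<tau>'] bs'[OF e'(1)] \<pi>(1) e'(3) by simp
  qed
  ultimately show "h \<in> hmem (hv (UnionOf bs') \<rho>')" using e(5) by simp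
next
  fix v
  assume sub: "hmem (hv (UnionOf bs) \<rho>) \<subseteq> hmem (hv (UnionOf bs') \<rho>')"
    and "v \<in> members (denot (UnionOf bs) \<rho>)"
  then obtain e xs \<phi> \<tau> where e: "Builder e xs \<phi> \<in> set bs"
    "\<And>y. y \<notin> set xs \<Longrightarrow> \<tau> y = \<rho> y" "sat \<phi> \<tau>" "v = denot e \<tau>" by (blast elim: members_denotE)
  \<comment> \<open>Here the element uses arbitrary atoms and may move. Only the atoms of the two
    sets stay, and the inverse permutation brings the element back in the end.\<close>
  let ?K = "\<rho> ` {..<M} \<union> \<rho>' ` {..<M}"
  have "card ?K \<le> 3 * M"
    using card_Un_le[of "\<rho> ` {..<M}" "\<rho>' ` {..<M}"] Env_range[OF \<rho>(1)] Env_range[OF \<rho>(2)] by linarith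
  then obtain \<pi> where \<pi>: "bij \<pi>" "\<forall>a\<in>?K. \<pi> a = a"
    "(\<lambda>x. if x < M then \<pi> (\<tau> x) else 0) \<in> Env" (is "?\<tau> \<in> _")
    using bij_moving_env[of ?K \<tau>] Env_range[OF \<rho>(1)] Env_range[OF \<rho>(2)] by blast
  have inv: "inv \<pi> a = a" if "a \<in> ?K" for a
    using that \<pi>(1,2) by (metis bij_is_inj inv_f_f)
  have "hv e ?\<tau> \<in> hmem (hv (UnionOf bs) \<rho>)"
  proof (rule hmem_hvalI[OF e(1) \<pi>(3)])
    show "?\<tau> y = \<rho> y" if "y \<notin> set xs" for y
      using that e(2)[OF that] \<pi>(2) \<rho>(1) by (auto simp: envs_def)
    show "sat \<phi> ?\<tau>"
      using sat_bij_below[of \<phi> \<pi> ?\<tau> \<tau>] bs[OF e(1)] \<pi>(1) e(3) by simp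
  qed
  from subsetD[OF sub this] obtain e' xs' \<phi>' \<tau>' where e': "Builder e' xs' \<phi>' \<in> set bs'" "\<tau>' \<in> Env"
    "\<And>y. y \<notin> set xs' \<Longrightarrow> \<tau>' y = \<rho>' y" "sat \<phi>' \<tau>'" "hv e ?\<tau> = hv e' \<tau>'"
    by (rule hmem_hvalE) (rule that)
  \<comment> \<open>From \<open>M\<close> on the values are those of \<open>\<rho>'\<close>, because
    agreement outside \<open>xs'\<close> is required at all variables and not only at those below
    \<open>M\<close>.\<close>
  let ?\<tau>' = "\<lambda>y. if y < M then inv \<pi> (\<tau>' y) else \<rho>' y"
  have "denot e ?\<tau> = denot e' \<tau>'" using eq_iff[OF e(1) e'(1) \<pi>(3) e'(2)] e'(5) by simp
  moreover have "denot e ?\<tau> = pact \<pi> v"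
    unfolding e(4) using bs[OF e(1)] \<pi>(1) by (intro denot_bij_X) auto
  ultimately have "v = pact (inv \<pi>) (denot e' \<tau>')" using \<pi>(1) by (metis pact_inv(1))
  also have "\<dots> = denot e' ?\<tau>'"
    using bs'[OF e'(1)] \<pi>(1) by (intro denot_bij_X[symmetric]) (auto intro: bij_imp_bij_inv)
  finally have v: "v = denot e' ?\<tau>'" .
  show "v \<in> members (denot (UnionOf bs') \<rho>')"
    unfolding v
  proof (rule members_denotI[OF e'(1)])
    show "?\<tau>' y = \<rho>' y" if "y \<notin> set xs'" for y
      using e'(3)[OF that] inv by auto
    show "sat \<phi>' ?\<tau>'"
      using sat_bij_below[of \<phi>' "inv \<pi>" ?\<tau>' \<tau>'] bs'[OF e'(1)] \<pi>(1) e'(4)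
      by (simp add: bij_imp_bij_inv)
  qed
qed

text \<open>Parity separates atoms from sets, and extensionality on both sides turns equality of
  sets into two inclusions. Induction on \<open>e\<close> alone is enough: for the second inclusion
  the induction hypothesis is read from right to left. The second claim only carries the hypothesis
  through a builder.\<close>

lemma denot_eq_iff_aux:
  "\<lbrakk>e \<in> X; e' \<in> X; \<rho> \<in> Env; \<rho>' \<in> Env\<rbrakk> \<Longrightarrow> denot e \<rho> = denot e' \<rho>' \<longleftrightarrow> hv e \<rho> = hv e' \<rho>'"
  and "\<lbrakk>b = Builder e xs \<phi>; e \<in> X; e' \<in> X; \<rho> \<in> Env; \<rho>' \<in> Env\<rbrakk>
    \<Longrightarrow> denot e \<rho> = denot e' \<rho>' \<longleftrightarrow> hv e \<rho> = hv e' \<rho>'"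
proof (induction e and b arbitrary: e' \<rho> \<rho>' and e e' xs \<phi> \<rho> \<rho>' rule: expr.induct builder.induct)
  case (AVar x)
  then show ?case by (cases e') (auto, presburger)
next
  case (UnionOf bs)
  show ?case
  proof (cases e')
    case (AVar x)
    then show ?thesis by (auto, presburger)
  next
    case e': (UnionOf bs')
    note b = Builder_X[OF UnionOf.prems(1)] and b' = Builder_X[OF UnionOf.prems(2)[unfolded e']]
    have eq: "denot e \<tau> = denot e' \<tau>' \<longleftrightarrow> hv e \<tau> = hv e' \<tau>'"
      if "Builder e xs \<phi> \<in> set bs" "Builder e' xs' \<phi>' \<in> set bs'" "\<tau> \<in> Env" "\<tau>' \<in> Env"
      for e xs \<phi> e' xs' \<phi>' \<tau> \<tau>'
      using UnionOf.IH[OF that(1) refl] b[OF that(1)] b'[OF that(2)] that(3,4) by blast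
    have eq': "denot e' \<tau>' = denot e \<tau> \<longleftrightarrow> hv e' \<tau>' = hv e \<tau>"
      if "Builder e' xs' \<phi>' \<in> set bs'" "Builder e xs \<phi> \<in> set bs" "\<tau>' \<in> Env" "\<tau> \<in> Env"
      for e xs \<phi> e' xs' \<phi>' \<tau> \<tau>'
      using eq[OF that(2,1,4,3)] by metis
    have "denot (UnionOf bs) \<rho> = denot e' \<rho>' \<longleftrightarrow>
        members (denot (UnionOf bs) \<rho>) = members (denot e' \<rho>')"
      by (simp add: e' VSet_eq_iff del: val.inject)
    also have "\<dots> \<longleftrightarrow> hmem (hv (UnionOf bs) \<rho>) = hmem (hv e' \<rho>')"
      unfolding set_eq_subset e'
      by (rule arg_cong2[where f = "(\<and>)"];
          rule subset_iff_hmem_subset; fact UnionOf.prems b b' eq eq')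
    also have "\<dots> \<longleftrightarrow> hv (UnionOf bs) \<rho> = hv e' \<rho>'"
      using hmem_inj[of "hv (UnionOf bs) \<rho>" "hv e' \<rho>'"] by (auto simp: e')
    finally show ?thesis .
  qed
qed blast

lemmas denot_eq_iff = denot_eq_iff_aux(1)

section \<open>Values within reach of \<open>N\<close> atoms and their codes\<close>

definition "all_vals = {denot e \<tau> | e \<tau>. e \<in> X}"
definition "fin_vals = {denot e \<rho> | e \<rho>. e \<in> X \<and> \<rho> \<in> Env}"

text \<open>On \<open>fin_vals\<close> the choice is immaterial, since equal values have equal
  codes; elsewhere nothing is claimed.\<close>

definition hc :: "val \<Rightarrow> nat" where
  "hc v = (SOME h. \<exists>e\<in>X. \<exists>\<rho>\<in>Env. v = denot e \<rho> \<and> h = hv e \<rho>)"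

lemma hc_denot:
  assumes "e \<in> X" "\<rho> \<in> Env"
  shows "hc (denot e \<rho>) = hv e \<rho>"
  unfolding hc_def
proof (rule some_equality)
  show "\<exists>e'\<in>X. \<exists>\<rho>'\<in>Env. denot e \<rho> = denot e' \<rho>' \<and> hv e \<rho> = hv e' \<rho>'"
    using assms by blast
next
  fix h assume "\<exists>e'\<in>X. \<exists>\<rho>'\<in>Env. denot e \<rho> = denot e' \<rho>' \<and> h = hv e' \<rho>'"
  then show "h = hv e \<rho>" using denot_eq_iff[OF assms(1) _ assms(2)] by auto
qed

lemma hc_eq_iff: "u \<in> fin_vals \<Longrightarrow> v \<in> fin_vals \<Longrightarrow> hc u = hc v \<longleftrightarrow> u = v"
  unfolding fin_vals_def using hc_denot denot_eq_iff by auto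

lemma finite_fin_vals: "finite fin_vals"
proof -
  have "fin_vals = (\<lambda>(e, \<rho>). denot e \<rho>) ` (X \<times> Env)" by (auto simp: fin_vals_def)
  then show ?thesis using finite_X finite_envs by simp
qed

lemma fin_vals_all: "v \<in> fin_vals \<Longrightarrow> v \<in> all_vals"
  unfolding fin_vals_def all_vals_def by auto

lemma all_vals_members: "v \<in> all_vals \<Longrightarrow> u \<in> members v \<Longrightarrow> u \<in> all_vals"
proof -
  assume "v \<in> all_vals" and u: "u \<in> members v"
  then obtain e \<tau> where e: "e \<in> X" "v = denot e \<tau>" unfolding all_vals_def by auto
  with u obtain bs where bs: "e = UnionOf bs" by (cases e) auto
  show "u \<in> all_vals"
    using u[unfolded e(2) bs] by (rule members_denotE) (use Builder_X e(1) bs in \<open>auto simp: all_vals_def\<close>)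
qed

lemma all_vals_supports: "v \<in> all_vals \<Longrightarrow> \<exists>K. finite K \<and> supports K v"
proof -
  assume "v \<in> all_vals"
  then obtain e \<tau> where e: "e \<in> X" "v = denot e \<tau>" unfolding all_vals_def by auto
  have "supports (\<tau> ` {..<M}) v" unfolding e(2) using fv_X[OF e(1)] by (intro supports_denot) auto
  then show ?thesis by blast
qed

lemma supports_Env: "e \<in> X \<Longrightarrow> supports (\<rho> ` {..<M}) (denot e \<rho>)"
  using fv_X by (intro supports_denot) auto

lemma fin_vals_supports:
  assumes "v \<in> fin_vals"
  obtains K where "K \<subseteq> {..<N}" "card K \<le> M" "supports K v"
proof -
  obtain e \<rho> where "e \<in> X" "\<rho> \<in> Env" "v = denot e \<rho>" using assms unfolding fin_vals_def by auto
  with Env_range[OF this(2)] supports_Env[of e \<rho>] that show ?thesis by blast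
qed

lemma bij_moving_val:
  assumes "v \<in> all_vals" "K \<subseteq> {..<N}" "card K \<le> 3 * M"
  shows "\<exists>\<pi>. bij \<pi> \<and> (\<forall>a\<in>K. \<pi> a = a) \<and> pact \<pi> v \<in> fin_vals"
proof -
  obtain e \<tau> where e: "e \<in> X" "v = denot e \<tau>" using assms(1) unfolding all_vals_def by auto
  obtain \<pi> where \<pi>: "bij \<pi>" "\<forall>a\<in>K. \<pi> a = a" "(\<lambda>x. if x < M then \<pi> (\<tau> x) else 0) \<in> Env"
    using bij_moving_env[OF assms(2,3)] by blast
  have "denot e (\<lambda>x. if x < M then \<pi> (\<tau> x) else 0) = pact \<pi> v"
    unfolding e(2) using e(1) \<pi>(1) by (intro denot_bij_X) auto
  then have "pact \<pi> v \<in> fin_vals" using e(1) \<pi>(3) unfolding fin_vals_def by force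
  with \<pi> show ?thesis by blast
qed

text \<open>The permutation that moves \<open>v\<close> below \<open>N\<close> can be chosen to fix
  a small support of \<open>v\<close>, hence \<open>v\<close> itself. So \<open>v\<close> was among
  the finitely many values from the start.\<close>

lemma fin_valsI:
  assumes "v \<in> all_vals" "supports K v" "K \<subseteq> {..<N}" "card K \<le> 3 * M"
  shows "v \<in> fin_vals"
  using bij_moving_val[OF assms(1,3,4)] supportsD[OF assms(2)] by metis

lemma mem_iff_hmem:
  assumes "u \<in> fin_vals" "v \<in> fin_vals"
  shows "u \<in> members v \<longleftrightarrow> hc u \<in> hmem (hc v)"
proof -
  obtain e \<rho> where e: "e \<in> X" "\<rho> \<in> Env" "v = denot e \<rho>"
    using assms unfolding fin_vals_def by auto
  obtain e' \<rho>' where e': "e' \<in> X" "\<rho>' \<in> Env" "u = denot e' \<rho>'"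
    using assms unfolding fin_vals_def by auto
  show ?thesis
  proof (cases e)
    case (AVar x)
    then show ?thesis using e hc_denot[OF e(1,2)] by (simp add: hmem_def)
  next
    case (UnionOf bs)
    note b = Builder_X[OF e(1)[unfolded UnionOf]]
    \<comment> \<open>Membership becomes inclusion of a singleton. Its trivially true condition
      mentions variable \<open>0\<close>, which is below \<open>M\<close> because \<open>M\<close>
      is positive.\<close>
    let ?bs = "[Builder e' [] (Eq 0 0)]"
    have ext: "(\<forall>y. \<tau> y = \<rho>' y) \<longleftrightarrow> \<tau> = \<rho>'" for \<tau> by auto
    have sing: "members (denot (UnionOf ?bs) \<rho>') = {u}" "hmem (hv (UnionOf ?bs) \<rho>') = {hc u}"
      unfolding members_denot_UnionOf hmem_hval using e' hc_denot by (auto simp: ext)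
    have bs: "f \<in> X \<and> fv_fm \<phi> \<subseteq> {..<M}" if "Builder f xs \<phi> \<in> set ?bs" for f xs \<phi>
      using that e'(1) M_pos by simp
    have eq: "denot f \<tau> = denot f' \<tau>' \<longleftrightarrow> hv f \<tau> = hv f' \<tau>'"
      if "Builder f xs \<phi> \<in> set ?bs" "Builder f' xs' \<phi>' \<in> set bs" "\<tau> \<in> Env" "\<tau>' \<in> Env"
      for f xs \<phi> f' xs' \<phi>' \<tau> \<tau>'
      using bs[OF that(1)] b[OF that(2)] that(3,4) denot_eq_iff by blast
    have "members (denot (UnionOf ?bs) \<rho>') \<subseteq> members (denot (UnionOf bs) \<rho>) \<longleftrightarrow>
      hmem (hv (UnionOf ?bs) \<rho>') \<subseteq> hmem (hv (UnionOf bs) \<rho>)"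
      by (rule subset_iff_hmem_subset; fact e'(2) e(2) bs b eq)
    moreover have "v = denot (UnionOf bs) \<rho>" "hc v = hv (UnionOf bs) \<rho>"
      using e hc_denot[OF e(1,2)] unfolding UnionOf by (simp_all only:)
    ultimately show ?thesis unfolding sing by (simp only:) blast
  qed
qed

lemma hmem_hcE:
  assumes "v \<in> fin_vals" "h \<in> hmem (hc v)"
  obtains u where "u \<in> fin_vals" "u \<in> members v" "h = hc u"
proof -
  obtain e \<rho> where e: "e \<in> X" "\<rho> \<in> Env" "v = denot e \<rho>"
    using assms unfolding fin_vals_def by auto
  have h: "h \<in> hmem (hv e \<rho>)" using assms e hc_denot by simp
  then obtain bs where bs: "e = UnionOf bs" by (cases e) (auto simp: hmem_def)
  obtain e' xs \<phi> \<tau> where e': "Builder e' xs \<phi> \<in> set bs" "\<tau> \<in> Env" "h = hv e' \<tau>"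
    using h unfolding bs by (rule hmem_hvalE)
  then have "e' \<in> X" using Builder_X e bs by blast
  then have "denot e' \<tau> \<in> fin_vals" "h = hc (denot e' \<tau>)"
    using e' hc_denot by (auto simp: fin_vals_def)
  then show ?thesis using that mem_iff_hmem assms by blast
qed

lemma odd_hc:
  assumes "VSet Y \<in> fin_vals"
  shows "odd (hc (VSet Y))"
proof -
  obtain e \<rho> where e: "e \<in> X" "\<rho> \<in> Env" "VSet Y = denot e \<rho>"
    using assms unfolding fin_vals_def by auto
  then show ?thesis using hc_denot[OF e(1,2)] by (cases e) auto
qed

lemma hc_vupair:
  assumes "a \<in> fin_vals" "b \<in> fin_vals" "vupair a b \<in> fin_vals"
  shows "hc (vupair a b) = hupair (hc a) (hc b)"
proof (rule hmem_inj)
  show "odd (hc (vupair a b))" using odd_hc assms(3) unfolding vupair_def by blast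
  show "odd (hupair (hc a) (hc b))" by (rule odd_hupair)
  show "hmem (hc (vupair a b)) = hmem (hupair (hc a) (hc b))"
    unfolding hmem_hupair
  proof (intro subset_antisym subsetI)
    fix h assume "h \<in> hmem (hc (vupair a b))"
    with assms(3) show "h \<in> {hc a, hc b}" by (rule hmem_hcE) auto
  next
    fix h assume "h \<in> {hc a, hc b}"
    then show "h \<in> hmem (hc (vupair a b))"
      using mem_iff_hmem[OF assms(1,3)] mem_iff_hmem[OF assms(2,3)] by auto
  qed
qed

text \<open>One set \<open>K\<close> supports the pair, its components and the inner unordered pair,
  so all of them have codes and \<open>hc\<close> can be pushed through the pairing.\<close>

lemma vpair_fin_vals:
  assumes "vpair a b \<in> all_vals" "supports K a" "supports K b" "K \<subseteq> {..<N}" "card K \<le> 3 * M"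
  shows "a \<in> fin_vals" "b \<in> fin_vals" "vpair a b \<in> fin_vals" "hc (vpair a b) = hpair (hc a) (hc b)"
proof -
  have "a \<in> all_vals" and p: "vupair a b \<in> all_vals"
    using all_vals_members[OF assms(1)] by auto
  moreover have "b \<in> all_vals" using all_vals_members[OF p] by auto
  ultimately show *: "a \<in> fin_vals" "b \<in> fin_vals" "vpair a b \<in> fin_vals"
    using assms supports_vpair by (auto intro: fin_valsI)
  have "vupair a b \<in> fin_vals"
    by (rule fin_valsI[OF p supports_vupair]) (fact assms)+
  then show "hc (vpair a b) = hpair (hc a) (hc b)"
    using * hc_vupair unfolding vpair_def hpair_def by simp
qed

text \<open>An arithmetical substitute for \<open>supports\<close>. Two environments differ by a
  permutation fixing the atoms of \<open>\<sigma>\<close> exactly when they have the same equality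
  type over \<open>\<sigma>\<close>; a value is unfixed when an environment of the same type yields
  another value.\<close>

definition hfixed :: "(var \<Rightarrow> atom) \<Rightarrow> nat \<Rightarrow> bool" where
  "hfixed \<sigma> h \<longleftrightarrow> \<not> (\<exists>e\<in>X. \<exists>\<rho>\<in>Env. \<exists>\<rho>'\<in>Env. hv e \<rho> = h \<and> hv e \<rho>' \<noteq> h \<and>
     (\<forall>x<M. \<forall>y<M. (\<rho> x = \<rho> y \<longleftrightarrow> \<rho>' x = \<rho>' y) \<and> (\<rho> x = \<sigma> y \<longleftrightarrow> \<rho>' x = \<sigma> y)))"

lemma hfixed_iff:
  assumes v: "v \<in> fin_vals" and \<sigma>: "\<sigma> \<in> Env"
  shows "hfixed \<sigma> (hc v) \<longleftrightarrow> supports (\<sigma> ` {..<M}) v"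
proof
  assume fixed: "hfixed \<sigma> (hc v)"
  show "supports (\<sigma> ` {..<M}) v"
    unfolding supports_def
  proof (intro allI impI, rule ccontr)
    fix \<pi> assume \<pi>: "bij \<pi>" "\<forall>a\<in>\<sigma> ` {..<M}. \<pi> a = a" "pact \<pi> v \<noteq> v"
    obtain e \<rho> where e: "e \<in> X" "\<rho> \<in> Env" "v = denot e \<rho>"
      using v unfolding fin_vals_def by auto
    \<comment> \<open>\<open>\<pi>\<close> may carry the atoms of \<open>\<rho>\<close> beyond
      \<open>N\<close>. The correction \<open>\<theta>\<close> fixes the atoms of
      \<open>\<sigma>\<close> and of \<open>\<rho>\<close>, hence \<open>v\<close>, so the corrected
      value still differs from \<open>v\<close>.\<close>
    let ?K = "\<sigma> ` {..<M} \<union> \<rho> ` {..<M}"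
    have "card ?K \<le> 3 * M"
      using card_Un_le[of "\<sigma> ` {..<M}" "\<rho> ` {..<M}"] Env_range[OF e(2)] Env_range[OF \<sigma>] by linarith
    then obtain \<theta> where \<theta>: "bij \<theta>" "\<forall>a\<in>?K. \<theta> a = a"
      "(\<lambda>x. if x < M then \<theta> (\<pi> (\<rho> x)) else 0) \<in> Env" (is "?\<rho> \<in> _")
      using bij_moving_env[of ?K "\<lambda>x. \<pi> (\<rho> x)"] Env_range[OF e(2)] Env_range[OF \<sigma>] by blast
    have bij: "bij (\<theta> \<circ> \<pi>)" using \<pi> \<theta> by (intro bij_comp)
    have "denot e ?\<rho> = pact (\<theta> \<circ> \<pi>) v"
      unfolding e(3) using e(1) bij by (intro denot_bij_X) auto
    also have "\<dots> = pact \<theta> (pact \<pi> v)" by (simp only: pact_comp)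
    also have "\<dots> \<noteq> pact \<theta> v" using \<pi>(3) \<theta>(1) by (simp add: pact_eq_iff)
    also have "pact \<theta> v = v"
      unfolding e(3) using supports_Env[OF e(1)] \<theta> by (intro supportsD) auto
    finally have ne: "hv e ?\<rho> \<noteq> hc v"
      using e denot_eq_iff hc_denot \<theta>(3) by metis
    have inj: "\<theta> (\<pi> a) = \<theta> (\<pi> b) \<longleftrightarrow> a = b" for a b
      using \<pi>(1) \<theta>(1) by (simp add: bij_is_inj inj_eq)
    have "\<theta> (\<pi> (\<sigma> y)) = \<sigma> y" if "y < M" for y using that \<pi>(2) \<theta>(2) by simp
    then have "\<theta> (\<pi> a) = \<sigma> y \<longleftrightarrow> a = \<sigma> y" if "y < M" for y a using that inj by metis
    then have "\<not> hfixed \<sigma> (hc v)"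
      unfolding hfixed_def not_not using e hc_denot ne \<theta>(3) inj
      by (intro bexI[of _ e] bexI[of _ \<rho>] bexI[of _ ?\<rho>]) auto
    with fixed show False by simp
  qed
next
  assume supp: "supports (\<sigma> ` {..<M}) v"
  show "hfixed \<sigma> (hc v)"
    unfolding hfixed_def
  proof (intro notI, elim bexE conjE)
    fix e \<rho> \<rho>' assume e: "e \<in> X" "\<rho> \<in> Env" "\<rho>' \<in> Env" "hv e \<rho> = hc v" "hv e \<rho>' \<noteq> hc v"
      and type: "\<forall>x<M. \<forall>y<M. (\<rho> x = \<rho> y \<longleftrightarrow> \<rho>' x = \<rho>' y) \<and> (\<rho> x = \<sigma> y \<longleftrightarrow> \<rho>' x = \<sigma> y)"
    have v_eq: "v = denot e \<rho>"
    proof -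
      have "denot e \<rho> \<in> fin_vals" using e unfolding fin_vals_def by blast
      then show ?thesis using hc_eq_iff v e hc_denot by metis
    qed
    \<comment> \<open>Each atom of \<open>\<rho>\<close> goes to its counterpart in
      \<open>\<rho>'\<close>. Equality of the types makes the choice of the variable immaterial and
      the map injective.\<close>
    let ?f = "\<lambda>a. if a \<in> \<sigma> ` {..<M} then a else \<rho>' (SOME x. x < M \<and> \<rho> x = a)"
    have f: "?f (\<rho> x) = \<rho>' x" if x: "x < M" for x
    proof (cases "\<rho> x \<in> \<sigma> ` {..<M}")
      case True
      then show ?thesis using type x by auto
    next
      case False
      have "(SOME y. y < M \<and> \<rho> y = \<rho> x) < M \<and> \<rho> (SOME y. y < M \<and> \<rho> y = \<rho> x) = \<rho> x"
        by (rule someI[of _ x]) (simp add: x)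
      then have "\<rho>' (SOME y. y < M \<and> \<rho> y = \<rho> x) = \<rho>' x" using type x by blast
      then show ?thesis using False by simp
    qed
    have f': "?f (\<sigma> y) = \<sigma> y" if "y < M" for y using that by simp
    have "inj_on ?f (\<sigma> ` {..<M} \<union> \<rho> ` {..<M})"
    proof (rule inj_onI)
      fix a b
      assume a: "a \<in> \<sigma> ` {..<M} \<union> \<rho> ` {..<M}" and b: "b \<in> \<sigma> ` {..<M} \<union> \<rho> ` {..<M}"
        and eq: "?f a = ?f b"
      from a b consider y z where "y < M" "z < M" "a = \<sigma> y" "b = \<sigma> z"
        | y x where "y < M" "x < M" "a = \<sigma> y" "b = \<rho> x" | y x where "y < M" "x < M" "a = \<rho> x" "b = \<sigma> y"
        | x x' where "x < M" "x' < M" "a = \<rho> x" "b = \<rho> x'" by blast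
      then show "a = b"
      proof cases
        case 1
        then show ?thesis using eq f' by metis
      next
        case 2
        then have "\<rho>' x = \<sigma> y" using eq f f' by metis
        then show ?thesis using 2 type by metis
      next
        case 3
        then have "\<rho>' x = \<sigma> y" using eq f f' by metis
        then show ?thesis using 3 type by metis
      next
        case 4
        then have "\<rho>' x = \<rho>' x'" using eq f by metis
        then show ?thesis using 4 type by metis
      qed
    qed
    then obtain \<pi> where \<pi>: "bij \<pi>" "\<And>a. a \<in> \<sigma> ` {..<M} \<union> \<rho> ` {..<M} \<Longrightarrow> \<pi> a = ?f a"
      using bij_extending_inj_on[of "\<sigma> ` {..<M} \<union> \<rho> ` {..<M}" ?f] by auto
    have "\<pi> (\<rho> x) = \<rho>' x" if "x < M" for x using that \<pi>(2) f[OF that] by simp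
    then have "denot e \<rho>' = pact \<pi> v"
      unfolding v_eq using e \<pi>(1) by (intro denot_bij_X) auto
    also have "\<dots> = v" using \<pi> by (intro supportsD[OF supp]) auto
    finally show False using e v_eq hc_denot by metis
  qed
qed

end

section \<open>Finite criteria for definable graphs\<close>

text \<open>A path has finitely many steps; this is what makes a cycle a finite object that one
  permutation can move off a finite set.\<close>

lemma trancl_finite_subset:
  assumes "(x, y) \<in> R\<^sup>+"
  shows "\<exists>T. finite T \<and> T \<subseteq> R \<and> (x, y) \<in> T\<^sup>+"
  using assms
proof induction
  case (base y)
  then show ?case by (intro exI[of _ "{(x, y)}"]) auto
next
  case (step y z)
  then obtain T where T: "finite T" "T \<subseteq> R" "(x, y) \<in> T\<^sup>+" by blast
  then have "(x, y) \<in> (insert (y, z) T)\<^sup>+" by (auto intro: trancl_mono)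
  then have "(x, z) \<in> (insert (y, z) T)\<^sup>+" by (rule trancl_into_trancl) simp
  with T step.hyps show ?case by (intro exI[of _ "insert (y, z) T"]) auto
qed

lemma trancl_map:
  assumes "(x, y) \<in> R\<^sup>+" "\<And>u v. (u, v) \<in> R \<Longrightarrow> (f u, f v) \<in> S"
  shows "(f x, f y) \<in> S\<^sup>+"
  using assms(1) by induction (auto intro: assms(2) trancl_into_trancl)

text \<open>A finite acyclic relation has a well-founded converse, and a minimal element of
  \<open>C\<close> for it would have no successor in \<open>C\<close>.\<close>

lemma finite_successors_imp_cycle:
  assumes "finite C" "C \<noteq> {}" "\<And>u. u \<in> C \<Longrightarrow> \<exists>v\<in>C. (u, v) \<in> R"
  shows "\<not> acyclic R"
proof
  assume "acyclic R"
  then have "acyclic (R \<inter> C \<times> C)" using acyclic_subset by blast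
  then have "wf ((R \<inter> C \<times> C)\<inverse>)"
    using finite_acyclic_wf_converse finite_subset[of "R \<inter> C \<times> C" "C \<times> C"] assms(1) by blast
  moreover obtain c where "c \<in> C" using assms(2) by blast
  ultimately show False
    by (rule wfE_min) (use assms(3) in blast)
qed

text \<open>
  The parameter \<open>\<sigma>\<close> need not be the valuation of the presentation: its atoms may be any set of at
  most \<open>M\<close> atoms that supports the graph.
\<close>

locale approximated_graph = finite_approximation X M N for X M N +
  fixes \<sigma> :: "var \<Rightarrow> atom" and e\<^sub>0 :: expr and V E :: "val cset"
  assumes \<sigma>: "\<sigma> \<in> Env" and e\<^sub>0: "e\<^sub>0 \<in> X" and graph: "denot e\<^sub>0 \<sigma> = vpair (VSet V) (VSet E)"
begin

abbreviation "A \<equiv> \<sigma> ` {..<M}"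

lemma A: "A \<subseteq> {..<N}" "card A \<le> M" "finite A"
  using Env_range[OF \<sigma>] by auto

lemma VE:
  shows "VSet V \<in> fin_vals" "VSet E \<in> fin_vals" "supports A (VSet V)" "supports A (VSet E)"
    and hc_graph: "hc (denot e\<^sub>0 \<sigma>) = hpair (hc (VSet V)) (hc (VSet E))"
proof -
  show *: "supports A (VSet V)" "supports A (VSet E)"
    using supports_Env[OF e\<^sub>0, of \<sigma>] by (auto simp: graph supports_vpair)
  have "denot e\<^sub>0 \<sigma> \<in> all_vals" using e\<^sub>0 unfolding all_vals_def by blast
  then have "vpair (VSet V) (VSet E) \<in> all_vals" unfolding graph .
  from vpair_fin_vals[OF this * A(1)] A(2)
  show "VSet V \<in> fin_vals" "VSet E \<in> fin_vals"
    "hc (denot e\<^sub>0 \<sigma>) = hpair (hc (VSet V)) (hc (VSet E))" by (auto simp: graph)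
qed

lemma V_all_vals: "v \<in> rcset V \<Longrightarrow> v \<in> all_vals"
  using all_vals_members[of "VSet V" v] VE(1) fin_vals_all by auto

lemma E_all_vals: "v \<in> rcset E \<Longrightarrow> v \<in> all_vals"
  using all_vals_members[of "VSet E" v] VE(2) fin_vals_all by auto

lemma V_iff: "v \<in> fin_vals \<Longrightarrow> v \<in> rcset V \<longleftrightarrow> hc v \<in> hmem (hc (VSet V))"
  using mem_iff_hmem[of v "VSet V"] VE(1) by simp

lemma E_iff: "v \<in> fin_vals \<Longrightarrow> v \<in> rcset E \<longleftrightarrow> hc v \<in> hmem (hc (VSet E))"
  using mem_iff_hmem[of v "VSet E"] VE(2) by simp

lemma pact_V_E:
  assumes "bij \<pi>" "\<And>a. a \<in> A \<Longrightarrow> \<pi> a = a"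
  shows "pact \<pi> v \<in> rcset V \<longleftrightarrow> v \<in> rcset V" "pact \<pi> v \<in> rcset E \<longleftrightarrow> v \<in> rcset E"
proof -
  have "pact \<pi> (VSet V) = VSet V" "pact \<pi> (VSet E) = VSet E"
    using assms VE(3,4) supportsD by blast+
  then show "pact \<pi> v \<in> rcset V \<longleftrightarrow> v \<in> rcset V" "pact \<pi> v \<in> rcset E \<longleftrightarrow> v \<in> rcset E"
    using members_pact_iff[OF assms(1), of v "VSet V"] members_pact_iff[OF assms(1), of v "VSet E"]
    by simp_all
qed

lemma supports_A_pact:
  assumes "bij \<pi>" "\<And>a. a \<in> A \<Longrightarrow> \<pi> a = a"
  shows "supports A (pact \<pi> v) \<longleftrightarrow> supports A v"
proof -
  have "supports A (pact \<theta> v)" if "supports A v" "bij \<theta>" "\<And>a. a \<in> A \<Longrightarrow> \<theta> a = a" for \<theta> v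
    using supports_pact[OF that(1,2)] that(3) by simp
  note this[of v \<pi>] this[of "pact \<pi> v" "inv \<pi>"]
  moreover have "inv \<pi> a = a" if "a \<in> A" for a
    using assms(1) assms(2)[OF that] by (metis bij_is_inj inv_f_f)
  ultimately show ?thesis using assms by (auto simp: bij_imp_bij_inv)
qed

text \<open>\<open>A\<close> has at most \<open>M\<close> atoms, all below \<open>N\<close>, so such
  values already lie in the finite set \<open>fin_vals\<close>.\<close>

lemma finite_supported: "finite {v \<in> all_vals. supports A v}"
  using finite_fin_vals by (rule finite_subset[rotated]) (use A fin_valsI in auto)

lemma hfixed_hc: "v \<in> fin_vals \<Longrightarrow> hfixed \<sigma> (hc v) \<longleftrightarrow> supports A v"
  using hfixed_iff \<sigma> by blast

section \<open>Vertex covers\<close>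

lemma VertexCover_iff:
  assumes "undirected_graph (rcset V) (rcset E)"
  shows "VertexCover (rcset V) (rcset E) \<longleftrightarrow>
    (\<forall>e\<in>rcset E. \<exists>v\<in>rcset V. v \<in> members e \<and> supports A v)"
proof
  assume "VertexCover (rcset V) (rcset E)"
  then obtain C where C: "finite C" "C \<subseteq> rcset V" "\<And>e. e \<in> rcset E \<Longrightarrow> \<exists>v\<in>C. v \<in> members e"
    unfolding VertexCover_def by blast
  show "\<forall>e\<in>rcset E. \<exists>v\<in>rcset V. v \<in> members e \<and> supports A v"
  proof
    fix e assume e: "e \<in> rcset E"
    then obtain u v where uv: "u \<in> rcset V" "v \<in> rcset V" "e = vupair u v"
      using assms unfolding undirected_graph_def by blast
    \<comment> \<open>The moved edge must still be covered by \<open>C\<close>; as its unfixed ends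
      have left \<open>C\<close>, the covering vertex comes from a fixed end.\<close>
    have "\<exists>\<pi>. bij \<pi> \<and> (\<forall>a\<in>A. \<pi> a = a) \<and> (\<forall>x\<in>{u, v}. pact \<pi> x \<in> C \<longrightarrow> supports A x)"
      using A(3) C(1,2) uv(1,2) V_all_vals all_vals_supports by (intro ex_bij_moving_vals_off) auto
    then obtain \<pi> where \<pi>: "bij \<pi>" "\<forall>a\<in>A. \<pi> a = a" "\<forall>x\<in>{u, v}. pact \<pi> x \<in> C \<longrightarrow> supports A x"
      by blast
    have "pact \<pi> e \<in> rcset E" using pact_V_E(2)[OF \<pi>(1)] \<pi>(2) e by blast
    then obtain c where "c \<in> C" "c \<in> members (pact \<pi> e)" using C(3) by blast
    then obtain x where "x \<in> {u, v}" "pact \<pi> x \<in> C" by (auto simp: uv(3) members_pact)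
    then show "\<exists>v\<in>rcset V. v \<in> members e \<and> supports A v" using \<pi>(3) uv by auto
  qed
next
  assume *: "\<forall>e\<in>rcset E. \<exists>v\<in>rcset V. v \<in> members e \<and> supports A v"
  let ?C = "{v \<in> rcset V. supports A v}"
  have "finite ?C" using V_all_vals by (intro finite_subset[OF _ finite_supported]) auto
  with * show "VertexCover (rcset V) (rcset E)"
    unfolding VertexCover_def by (intro exI[of _ ?C]) auto
qed

lemma VertexCover_iff_finite:
  assumes "undirected_graph (rcset V) (rcset E)"
  shows "VertexCover (rcset V) (rcset E) \<longleftrightarrow>
    (\<forall>e\<in>hmem (hc (VSet E)). \<exists>v\<in>hmem (hc (VSet V)). v \<in> hmem e \<and> hfixed \<sigma> v)"
  unfolding VertexCover_iff[OF assms]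
proof (intro iffI ballI)
  fix h assume *: "\<forall>e\<in>rcset E. \<exists>v\<in>rcset V. v \<in> members e \<and> supports A v"
    and "h \<in> hmem (hc (VSet E))"
  then obtain e where e: "e \<in> fin_vals" "e \<in> rcset E" "h = hc e"
    using VE(2) by (auto elim: hmem_hcE)
  then obtain v where v: "v \<in> rcset V" "v \<in> members e" "supports A v" using * by blast
  then have "v \<in> fin_vals" using V_all_vals A by (auto intro: fin_valsI)
  then show "\<exists>v\<in>hmem (hc (VSet V)). v \<in> hmem h \<and> hfixed \<sigma> v"
    using v e V_iff mem_iff_hmem hfixed_hc by blast
next
  fix e assume *: "\<forall>e\<in>hmem (hc (VSet E)). \<exists>v\<in>hmem (hc (VSet V)). v \<in> hmem e \<and> hfixed \<sigma> v"
    and e: "e \<in> rcset E"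
  \<comment> \<open>Having a fixed end in \<open>V\<close> is invariant under permutations fixing
    \<open>A\<close>, so an edge with arbitrary atoms may be tested after moving it below
    \<open>N\<close>.\<close>
  obtain \<pi> where \<pi>: "bij \<pi>" "\<forall>a\<in>A. \<pi> a = a" "pact \<pi> e \<in> fin_vals"
    using bij_moving_val[of e A] E_all_vals[OF e] A by auto
  have "pact \<pi> e \<in> rcset E" using pact_V_E(2)[OF \<pi>(1)] \<pi>(2) e by blast
  then obtain h where h: "h \<in> hmem (hc (VSet V))" "h \<in> hmem (hc (pact \<pi> e))" "hfixed \<sigma> h"
    using * E_iff[OF \<pi>(3)] by blast
  then obtain v where v: "v \<in> fin_vals" "v \<in> rcset V" "h = hc v"
    using VE(1) by (auto elim: hmem_hcE)
  then have "v \<in> members (pact \<pi> e)" "supports A v"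
    using h \<pi>(3) mem_iff_hmem hfixed_hc by blast+
  then obtain u where u: "u \<in> members e" "v = pact \<pi> u" by (auto simp: members_pact)
  moreover have "u \<in> rcset V" using pact_V_E(1)[OF \<pi>(1)] \<pi>(2) u v(2) by blast
  moreover have "supports A u"
    using supports_A_pact[OF \<pi>(1)] \<pi>(2) u(2) \<open>supports A v\<close> by blast
  ultimately show "\<exists>v\<in>rcset V. v \<in> members e \<and> supports A v" by blast
qed

text \<open>
  The vertices of a cycle can be moved below \<open>N\<close> one after the other, keeping only the atoms of
  the starting point and of the last vertex moved.
\<close>

lemma trancl_within_fin_vals:
  assumes R: "\<And>\<pi> u v. bij \<pi> \<Longrightarrow> (\<And>a. a \<in> A \<Longrightarrow> \<pi> a = a) \<Longrightarrow> (u, v) \<in> R \<Longrightarrow> (pact \<pi> u, pact \<pi> v) \<in> R"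
    and all: "R \<subseteq> all_vals \<times> all_vals"
    and xy: "(x, y) \<in> R\<^sup>+" "x \<in> fin_vals" "y \<in> fin_vals"
  shows "(x, y) \<in> (R \<inter> fin_vals \<times> fin_vals)\<^sup>+"
proof -
  have "(x, y) \<in> (R \<inter> fin_vals \<times> fin_vals)\<^sup>+" if "(x, y) \<in> R ^^ Suc n" "y \<in> fin_vals" for n y
    using that
  proof (induction n arbitrary: y)
    case 0
    then show ?case using xy(2) by auto
  next
    case (Suc n)
    then obtain u where u: "(x, u) \<in> R ^^ Suc n" "(u, y) \<in> R" by auto
    obtain K where K: "K \<subseteq> {..<N}" "card K \<le> M" "supports K x"
      using xy(2) by (rule fin_vals_supports)
    obtain L where L: "L \<subseteq> {..<N}" "card L \<le> M" "supports L y"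
      using Suc.prems(2) by (rule fin_vals_supports)
    \<comment> \<open>\<open>A\<close> stays because \<open>R\<close> is invariant only under
      permutations fixing it, \<open>K\<close> and \<open>L\<close> stay so that \<open>x\<close>
      and \<open>y\<close> do. Here the allowance of \<open>3 * M\<close> is used in full. The whole
      path is moved, and the induction hypothesis applies to its shortened part, which now ends in
      \<open>fin_vals\<close>.\<close>
    let ?K = "A \<union> K \<union> L"
    have "card ?K \<le> 3 * M"
      using card_Un_le[of "A \<union> K" L] card_Un_le[of A K] A(2) K(2) L(2) by linarith
    then obtain \<pi> where \<pi>: "bij \<pi>" "\<forall>a\<in>?K. \<pi> a = a" "pact \<pi> u \<in> fin_vals"
      using bij_moving_val[of u ?K] u(2) all A(1) K(1) L(1) by blast
    have step: "(pact \<pi> v, pact \<pi> w) \<in> R" if "(v, w) \<in> R" for v w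
      using R[OF \<pi>(1) _ that] \<pi>(2) by blast
    have xy': "pact \<pi> x = x" "pact \<pi> y = y"
      using supportsD[OF K(3) \<pi>(1)] supportsD[OF L(3) \<pi>(1)] \<pi>(2) by auto
    have "(pact \<pi> x, pact \<pi> v) \<in> R ^^ m" if "(x, v) \<in> R ^^ m" for m v
      using that by (induction m arbitrary: v) (auto intro: step)
    then have "(x, pact \<pi> u) \<in> R ^^ Suc n" using u(1) xy'(1) by metis
    then have "(x, pact \<pi> u) \<in> (R \<inter> fin_vals \<times> fin_vals)\<^sup>+" using \<pi>(3) by (rule Suc.IH)
    moreover have "(pact \<pi> u, y) \<in> R \<inter> fin_vals \<times> fin_vals"
      using step[OF u(2)] xy'(2) \<pi>(3) Suc.prems(2) by auto
    ultimately show ?case by (rule trancl_into_trancl)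
  qed
  then show ?thesis using xy(1,3) unfolding trancl_power by (metis Suc_pred)
qed

lemma acyclic_iff_finite:
  assumes R: "\<And>\<pi> u v. bij \<pi> \<Longrightarrow> (\<And>a. a \<in> A \<Longrightarrow> \<pi> a = a) \<Longrightarrow> (u, v) \<in> R \<Longrightarrow> (pact \<pi> u, pact \<pi> v) \<in> R"
    and all: "R \<subseteq> all_vals \<times> all_vals"
  shows "acyclic R \<longleftrightarrow> \<not> (\<exists>C\<subseteq>fin_vals. C \<noteq> {} \<and> (\<forall>u\<in>C. \<exists>v\<in>C. (u, v) \<in> R))"
proof
  assume "acyclic R"
  then show "\<not> (\<exists>C\<subseteq>fin_vals. C \<noteq> {} \<and> (\<forall>u\<in>C. \<exists>v\<in>C. (u, v) \<in> R))"
    using finite_successors_imp_cycle finite_fin_vals finite_subset by metis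
next
  assume *: "\<not> (\<exists>C\<subseteq>fin_vals. C \<noteq> {} \<and> (\<forall>u\<in>C. \<exists>v\<in>C. (u, v) \<in> R))"
  show "acyclic R"
    unfolding acyclic_def
  proof (intro allI notI)
    fix x assume x: "(x, x) \<in> R\<^sup>+"
    then obtain y where "(x, y) \<in> R" by (blast dest: tranclD)
    then have "x \<in> all_vals" using all by auto
    then obtain \<pi> where \<pi>: "bij \<pi>" "\<forall>a\<in>A. \<pi> a = a" "pact \<pi> x \<in> fin_vals"
      using bij_moving_val[of x A] A by auto
    let ?x = "pact \<pi> x" and ?R = "R \<inter> fin_vals \<times> fin_vals"
    have "(?x, ?x) \<in> R\<^sup>+" using x by (rule trancl_map) (use R \<pi>(1,2) in blast)
    then have cycle: "(?x, ?x) \<in> ?R\<^sup>+" using trancl_within_fin_vals[OF R all] \<pi>(3) by blast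
    \<comment> \<open>The cycle need not be extracted: all vertices that reach \<open>?x\<close>
      will do, since the cycle gives \<open>?x\<close> itself a successor that reaches
      \<open>?x\<close>.\<close>
    let ?C = "{u \<in> fin_vals. (u, ?x) \<in> ?R\<^sup>*}"
    have succ: "\<forall>u\<in>?C. \<exists>v\<in>?C. (u, v) \<in> R"
    proof
      fix u assume u: "u \<in> ?C"
      have "(u, ?x) \<in> ?R\<^sup>+" using u cycle by (auto dest: rtranclD)
      then obtain v where "(u, v) \<in> ?R" "(v, ?x) \<in> ?R\<^sup>*" by (blast dest: tranclD)
      then show "\<exists>v\<in>?C. (u, v) \<in> R" by blast
    qed
    have C: "?C \<subseteq> fin_vals" "?C \<noteq> {}" using \<pi>(3) by auto
    show False by (rule notE[OF *]) (intro exI[of _ ?C] conjI C succ)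
  qed
qed

text \<open>Each member of a candidate set has a successor and hence lies in \<open>V\<close>, so it
  suffices to search the subsets of the coded vertex set.\<close>

lemma acyclic_iff_codes:
  assumes R: "\<And>\<pi> u v. bij \<pi> \<Longrightarrow> (\<And>a. a \<in> A \<Longrightarrow> \<pi> a = a) \<Longrightarrow> (u, v) \<in> R \<Longrightarrow> (pact \<pi> u, pact \<pi> v) \<in> R"
    and V: "R \<subseteq> rcset V \<times> rcset V"
    and H: "\<And>u v. u \<in> fin_vals \<Longrightarrow> v \<in> fin_vals \<Longrightarrow> (u, v) \<in> R \<longleftrightarrow> H (hc u) (hc v)"
  shows "acyclic R \<longleftrightarrow> \<not> (\<exists>C\<subseteq>hmem (hc (VSet V)). C \<noteq> {} \<and> (\<forall>u\<in>C. \<exists>v\<in>C. H u v))"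
proof -
  have "R \<subseteq> all_vals \<times> all_vals" using V V_all_vals by blast
  note acyclic_iff_finite[OF R this]
  moreover have "(\<exists>C\<subseteq>fin_vals. C \<noteq> {} \<and> (\<forall>u\<in>C. \<exists>v\<in>C. (u, v) \<in> R)) \<longleftrightarrow>
    (\<exists>C\<subseteq>hmem (hc (VSet V)). C \<noteq> {} \<and> (\<forall>u\<in>C. \<exists>v\<in>C. H u v))" (is "?l \<longleftrightarrow> ?r")
  proof
    assume ?l
    then obtain C where C: "C \<subseteq> fin_vals" "C \<noteq> {}" "\<forall>u\<in>C. \<exists>v\<in>C. (u, v) \<in> R" by blast
    have "hc u \<in> hmem (hc (VSet V))" if "u \<in> C" for u using that C V V_iff by blast
    moreover have "\<exists>v\<in>hc ` C. H (hc u) v" if "u \<in> C" for u using that C H by blast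
    ultimately show ?r using C(2) by (intro exI[of _ "hc ` C"]) auto
  next
    assume ?r
    then obtain C where C: "C \<subseteq> hmem (hc (VSet V))" "C \<noteq> {}" "\<forall>u\<in>C. \<exists>v\<in>C. H u v" by blast
    have code: "\<exists>v\<in>fin_vals. h = hc v" if "h \<in> C" for h
      using VE(1) that C(1) by (blast elim: hmem_hcE)
    let ?C = "{u \<in> fin_vals. hc u \<in> C}"
    have ne: "?C \<noteq> {}" using C(2) code by blast
    have succ: "\<forall>u\<in>?C. \<exists>v\<in>?C. (u, v) \<in> R"
    proof
      fix u assume u: "u \<in> ?C"
      then obtain h where h: "h \<in> C" "H (hc u) h" using C(3) by blast
      then obtain v where v: "v \<in> fin_vals" "h = hc v" using code by blast
      then have "(u, v) \<in> R" using u h H by simp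
      with v h show "\<exists>v\<in>?C. (u, v) \<in> R" by blast
    qed
    show ?l by (intro exI[of _ ?C] conjI ne succ Collect_subset)
  qed
  ultimately show ?thesis by simp
qed

text \<open>The ends together may use \<open>2 * M\<close> atoms, more than one environment
  provides, but still within the allowance of \<open>3 * M\<close>; so an arc between vertices of
  \<open>fin_vals\<close> belongs to \<open>fin_vals\<close> as well.\<close>

lemma arc_iff:
  assumes "directed_graph (rcset V) (rcset E)" "u \<in> fin_vals" "v \<in> fin_vals"
  shows "vpair u v \<in> rcset E \<longleftrightarrow> hpair (hc u) (hc v) \<in> hmem (hc (VSet E))"
proof
  assume uv: "vpair u v \<in> rcset E"
  obtain K where K: "K \<subseteq> {..<N}" "card K \<le> M" "supports K u"
    using assms(2) by (rule fin_vals_supports)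
  obtain L where L: "L \<subseteq> {..<N}" "card L \<le> M" "supports L v"
    using assms(3) by (rule fin_vals_supports)
  have "card (K \<union> L) \<le> 3 * M" using card_Un_le[of K L] K L by linarith
  then show "hpair (hc u) (hc v) \<in> hmem (hc (VSet E))"
    using vpair_fin_vals[of u v "K \<union> L"] E_all_vals[OF uv] K L uv E_iff
    by (metis Un_least Un_upper1 Un_upper2 supports_mono)
next
  assume "hpair (hc u) (hc v) \<in> hmem (hc (VSet E))"
  with VE(2) obtain x where x: "x \<in> fin_vals" "x \<in> rcset E" "hpair (hc u) (hc v) = hc x"
    by (auto elim: hmem_hcE)
  then obtain a b where ab: "x = vpair a b" using assms(1) unfolding directed_graph_def by blast
  obtain K where K: "K \<subseteq> {..<N}" "card K \<le> M" "supports K x"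
    using x(1) by (rule fin_vals_supports)
  have "a \<in> fin_vals" "b \<in> fin_vals" "hc x = hpair (hc a) (hc b)"
    using vpair_fin_vals[of a b K] fin_vals_all[OF x(1)] K by (auto simp: ab supports_vpair)
  then have "u = a" "v = b" using x(3) hpair_eq_iff hc_eq_iff assms(2,3) by auto
  then show "vpair u v \<in> rcset E" using x ab by simp
qed

section \<open>Feedback vertex sets and feedback arc sets\<close>

lemma arc_ends:
  assumes "directed_graph V' E'" "vpair u v \<in> E'"
  shows "u \<in> V' \<and> v \<in> V'"
  using bspec[OF assms(1)[unfolded directed_graph_def] assms(2)] by (auto simp: vpair_eq_iff)

lemma FeedbackVertexSet_iff:
  assumes "directed_graph (rcset V) (rcset E)"
  shows "FeedbackVertexSet (rcset V) (rcset E) \<longleftrightarrow>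
    acyclic {(u, v). vpair u v \<in> rcset E \<and> \<not> supports A u \<and> \<not> supports A v}"
    (is "_ \<longleftrightarrow> acyclic ?R")
proof
  have V: "u \<in> rcset V \<and> v \<in> rcset V" if "vpair u v \<in> rcset E" for u v
    using that arc_ends assms by blast
  {
    assume "FeedbackVertexSet (rcset V) (rcset E)"
    then obtain S where S: "finite S" "S \<subseteq> rcset V"
      "acyclic (arcs (rcset E) \<inter> (rcset V - S) \<times> (rcset V - S))"
      unfolding FeedbackVertexSet_def by blast
    show "acyclic ?R"
      unfolding acyclic_def
    proof (intro allI notI)
      fix x assume "(x, x) \<in> ?R\<^sup>+"
      then obtain T where T: "finite T" "T \<subseteq> ?R" "(x, x) \<in> T\<^sup>+"
        using trancl_finite_subset by meson
      let ?X = "fst ` T \<union> snd ` T"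
      have X: "?X \<subseteq> rcset V" using T(2) V by force
      have "\<exists>K. finite K \<and> supports K v" if "v \<in> S \<union> ?X" for v
        using subsetD[OF Un_least[OF S(2) X] that] V_all_vals by (intro all_vals_supports)
      then obtain \<pi> where \<pi>: "bij \<pi>" "\<forall>a\<in>A. \<pi> a = a" "\<forall>v\<in>?X. pact \<pi> v \<in> S \<longrightarrow> supports A v"
        using ex_bij_moving_vals_off[of A S ?X] A(3) S(1) T(1) by auto
      have "(pact \<pi> u, pact \<pi> v) \<in> arcs (rcset E) \<inter> (rcset V - S) \<times> (rcset V - S)"
        if uv: "(u, v) \<in> T" for u v
      proof -
        have *: "vpair u v \<in> rcset E" "\<not> supports A u" "\<not> supports A v" using T(2) uv by auto
        have "u \<in> ?X" "v \<in> ?X" using uv by force+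
        then have "pact \<pi> u \<notin> S" "pact \<pi> v \<notin> S" using \<pi>(3) * by blast+
        moreover have "pact \<pi> (vpair u v) \<in> rcset E" using pact_V_E(2)[OF \<pi>(1)] \<pi>(2) * by blast
        ultimately show ?thesis using V unfolding pact_vpair arcs_def by blast
      qed
      with T(3) have "(pact \<pi> x, pact \<pi> x) \<in> (arcs (rcset E) \<inter> (rcset V - S) \<times> (rcset V - S))\<^sup>+"
        by (rule trancl_map)
      with S(3) show False unfolding acyclic_def by blast
    qed
  }
  assume R: "acyclic ?R"
  let ?S = "{v \<in> rcset V. supports A v}"
  have "finite ?S" using V_all_vals by (intro finite_subset[OF _ finite_supported]) auto
  moreover have "acyclic (arcs (rcset E) \<inter> (rcset V - ?S) \<times> (rcset V - ?S))"
    using R by (rule acyclic_subset) (auto simp: arcs_def)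
  ultimately show "FeedbackVertexSet (rcset V) (rcset E)"
    unfolding FeedbackVertexSet_def by blast
qed

text \<open>Here the permutation is chosen for the arcs of the cycle. Vertices on it may be fixed,
  as long as every arc has an end that is not.\<close>

lemma FeedbackArcSet_iff:
  assumes "directed_graph (rcset V) (rcset E)"
  shows "FeedbackArcSet (rcset V) (rcset E) \<longleftrightarrow>
    acyclic {(u, v). vpair u v \<in> rcset E \<and> \<not> supports A (vpair u v)}"
    (is "_ \<longleftrightarrow> acyclic ?R")
proof
  assume "FeedbackArcSet (rcset V) (rcset E)"
  then obtain F where F: "finite F" "F \<subseteq> rcset E" "acyclic (arcs (rcset E - F))"
    unfolding FeedbackArcSet_def by blast
  show "acyclic ?R"
    unfolding acyclic_def
  proof (intro allI notI)
    fix x assume "(x, x) \<in> ?R\<^sup>+"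
    then obtain T where T: "finite T" "T \<subseteq> ?R" "(x, x) \<in> T\<^sup>+"
      using trancl_finite_subset by meson
    let ?X = "(\<lambda>(u, v). vpair u v) ` T"
    have X: "?X \<subseteq> rcset E" using T(2) by auto
    have "\<exists>K. finite K \<and> supports K v" if "v \<in> F \<union> ?X" for v
      using subsetD[OF Un_least[OF F(2) X] that] E_all_vals by (intro all_vals_supports)
    then obtain \<pi> where \<pi>: "bij \<pi>" "\<forall>a\<in>A. \<pi> a = a" "\<forall>v\<in>?X. pact \<pi> v \<in> F \<longrightarrow> supports A v"
      using ex_bij_moving_vals_off[of A F ?X] A(3) F(1) T(1) by auto
    have "(pact \<pi> u, pact \<pi> v) \<in> arcs (rcset E - F)" if uv: "(u, v) \<in> T" for u v
    proof -
      have *: "vpair u v \<in> rcset E" "\<not> supports A (vpair u v)" using T(2) uv by auto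
      have "vpair u v \<in> ?X" using uv by force
      then have "pact \<pi> (vpair u v) \<notin> F" using \<pi>(3) * by blast
      moreover have "pact \<pi> (vpair u v) \<in> rcset E" using pact_V_E(2)[OF \<pi>(1)] \<pi>(2) * by blast
      ultimately show ?thesis unfolding pact_vpair arcs_def by blast
    qed
    with T(3) have "(pact \<pi> x, pact \<pi> x) \<in> (arcs (rcset E - F))\<^sup>+"
      by (rule trancl_map)
    with F(3) show False unfolding acyclic_def by blast
  qed
next
  assume R: "acyclic ?R"
  let ?F = "{e \<in> rcset E. supports A e}"
  have "finite ?F" using E_all_vals by (intro finite_subset[OF _ finite_supported]) auto
  moreover have "acyclic (arcs (rcset E - ?F))"
    using R by (rule acyclic_subset) (auto simp: arcs_def)
  ultimately show "FeedbackArcSet (rcset V) (rcset E)"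
    unfolding FeedbackArcSet_def by blast
qed

lemma FeedbackVertexSet_iff_finite:
  assumes "directed_graph (rcset V) (rcset E)"
  shows "FeedbackVertexSet (rcset V) (rcset E) \<longleftrightarrow>
    \<not> (\<exists>C\<subseteq>hmem (hc (VSet V)). C \<noteq> {} \<and> (\<forall>u\<in>C. \<exists>v\<in>C.
        hpair u v \<in> hmem (hc (VSet E)) \<and> \<not> hfixed \<sigma> u \<and> \<not> hfixed \<sigma> v))"
  unfolding FeedbackVertexSet_iff[OF assms]
proof (rule acyclic_iff_codes)
  fix \<pi> u v assume \<pi>: "bij \<pi>" "\<And>a. a \<in> A \<Longrightarrow> \<pi> a = a"
    and "(u, v) \<in> {(u, v). vpair u v \<in> rcset E \<and> \<not> supports A u \<and> \<not> supports A v}"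
  then show "(pact \<pi> u, pact \<pi> v)
      \<in> {(u, v). vpair u v \<in> rcset E \<and> \<not> supports A u \<and> \<not> supports A v}"
    using pact_V_E(2)[OF \<pi>, of "vpair u v"] supports_A_pact[OF \<pi>] by (simp add: pact_vpair)
next
  show "{(u, v). vpair u v \<in> rcset E \<and> \<not> supports A u \<and> \<not> supports A v} \<subseteq> rcset V \<times> rcset V"
    using arc_ends[OF assms] by blast
next
  fix u v assume "u \<in> fin_vals" "v \<in> fin_vals"
  then show "(u, v) \<in> {(u, v). vpair u v \<in> rcset E \<and> \<not> supports A u \<and> \<not> supports A v} \<longleftrightarrow>
      hpair (hc u) (hc v) \<in> hmem (hc (VSet E)) \<and> \<not> hfixed \<sigma> (hc u) \<and> \<not> hfixed \<sigma> (hc v)"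
    using arc_iff[OF assms] hfixed_hc by simp
qed

text \<open>An arc is fixed exactly when both ends are, so \<open>hfixed\<close> is asked about
  vertices only.\<close>

lemma FeedbackArcSet_iff_finite:
  assumes "directed_graph (rcset V) (rcset E)"
  shows "FeedbackArcSet (rcset V) (rcset E) \<longleftrightarrow>
    \<not> (\<exists>C\<subseteq>hmem (hc (VSet V)). C \<noteq> {} \<and> (\<forall>u\<in>C. \<exists>v\<in>C.
        hpair u v \<in> hmem (hc (VSet E)) \<and> \<not> (hfixed \<sigma> u \<and> hfixed \<sigma> v)))"
  unfolding FeedbackArcSet_iff[OF assms] supports_vpair
proof (rule acyclic_iff_codes)
  fix \<pi> u v assume \<pi>: "bij \<pi>" "\<And>a. a \<in> A \<Longrightarrow> \<pi> a = a"
    and "(u, v) \<in> {(u, v). vpair u v \<in> rcset E \<and> \<not> (supports A u \<and> supports A v)}"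
  then show "(pact \<pi> u, pact \<pi> v)
      \<in> {(u, v). vpair u v \<in> rcset E \<and> \<not> (supports A u \<and> supports A v)}"
    using pact_V_E(2)[OF \<pi>, of "vpair u v"] supports_A_pact[OF \<pi>] by (simp add: pact_vpair)
next
  show "{(u, v). vpair u v \<in> rcset E \<and> \<not> (supports A u \<and> supports A v)} \<subseteq> rcset V \<times> rcset V"
    using arc_ends[OF assms] by blast
next
  fix u v assume "u \<in> fin_vals" "v \<in> fin_vals"
  then show "(u, v) \<in> {(u, v). vpair u v \<in> rcset E \<and> \<not> (supports A u \<and> supports A v)} \<longleftrightarrow>
      hpair (hc u) (hc v) \<in> hmem (hc (VSet E)) \<and> \<not> (hfixed \<sigma> (hc u) \<and> hfixed \<sigma> (hc v))"
    using arc_iff[OF assms] hfixed_hc by simp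
qed

end

section \<open>Evaluation of presentations by a recursive function\<close>

definition hdc :: "nat \<Rightarrow> nat" where "hdc n = pfst (n - 1)"
definition tlc :: "nat \<Rightarrow> nat" where "tlc n = psnd (n - 1)"
text \<open>The code of a formula or an expression is a list headed by its constructor tag, followed
  by these arguments. A builder has no tag: there \<open>hdc\<close> is the expression,
  \<open>arg1\<close> the variable list and \<open>arg2\<close> the condition.\<close>

definition arg1 :: "nat \<Rightarrow> nat" where "arg1 n = hdc (tlc n)"
definition arg2 :: "nat \<Rightarrow> nat" where "arg2 n = hdc (tlc (tlc n))"
definition drp :: "nat \<Rightarrow> nat \<Rightarrow> nat" where "drp i l = rec_nat l (\<lambda>_ r. tlc r) i"
definition entry :: "nat \<Rightarrow> nat \<Rightarrow> nat" where "entry l i = hdc (drp i l)"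

text \<open>The nonempty rest says that \<open>i\<close> is a valid index, and the length of a list
  is at most its code.\<close>

definition in_list :: "nat \<Rightarrow> nat \<Rightarrow> bool" where
  "in_list b l \<longleftrightarrow> (\<exists>i<l. drp i l \<noteq> 0 \<and> entry l i = b)"

lemma pfst_0 [simp]: "pfst 0 = 0" and psnd_0 [simp]: "psnd 0 = 0"
proof -
  have "prod_encode (0, 0) = 0" by (simp add: prod_encode_def)
  then show "pfst 0 = 0" "psnd 0 = 0" by (metis pfst_encode, metis psnd_encode)
qed

lemma hdc_0 [simp]: "hdc 0 = 0" and tlc_0 [simp]: "tlc 0 = 0"
  by (simp_all add: hdc_def tlc_def)

lemma hdc_Cons [simp]: "hdc (list_encode (x # xs)) = x"
  and tlc_Cons [simp]: "tlc (list_encode (x # xs)) = list_encode xs"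
  by (simp_all add: hdc_def tlc_def)

lemma pfst_le: "pfst n \<le> n" and psnd_le: "psnd n \<le> n"
  by (metis le_prod_encode_1 prod_encode_pfst_psnd, metis le_prod_encode_2 prod_encode_pfst_psnd)

lemma hdc_le: "hdc n \<le> n" and tlc_le: "tlc n \<le> n"
  using pfst_le[of "n - 1"] psnd_le[of "n - 1"] by (simp_all add: hdc_def tlc_def)

lemma tlc_less: "0 < n \<Longrightarrow> tlc n < n"
  using psnd_le[of "n - 1"] by (simp add: tlc_def)

lemma arg_le: "arg1 n \<le> n" "arg2 n \<le> n"
  unfolding arg1_def arg2_def by (meson hdc_le tlc_le le_trans)+

text \<open>A nonzero tag excludes the empty list, the one code whose tail is not smaller; this is
  why the decoders terminate on junk too.\<close>

lemma arg_less: "hdc n \<noteq> 0 \<Longrightarrow> arg1 n < n" "hdc n \<noteq> 0 \<Longrightarrow> arg2 n < n"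
proof -
  assume "hdc n \<noteq> 0"
  then have "tlc n < n" using tlc_less by (cases "n = 0") auto
  then show "arg1 n < n" "arg2 n < n"
    unfolding arg1_def arg2_def by (meson hdc_le tlc_le le_trans le_less_trans)+
qed

lemma tlc_list_encode: "tlc (list_encode xs) = list_encode (tl xs)"
  by (cases xs) (auto simp del: list_encode.simps(2))

lemma drp_eq: "drp i (list_encode xs) = list_encode (drop i xs)"
  by (induction i) (auto simp: drp_def tlc_list_encode tl_drop drop_Suc)

lemma entry_list_encode: "i < length xs \<Longrightarrow> entry (list_encode xs) i = xs ! i"
  unfolding entry_def drp_eq by (metis Cons_nth_drop_Suc hdc_Cons)

lemma length_le_list_encode: "length xs \<le> list_encode xs"
proof (induction xs)
  case (Cons x xs)
  then show ?case using le_prod_encode_2[of "list_encode xs" x] by simp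
qed simp

lemma less_list_encode: "x \<in> set xs \<Longrightarrow> x < list_encode xs"
proof (induction xs)
  case (Cons y ys)
  then show ?case
    using le_prod_encode_1[of y "list_encode ys"] le_prod_encode_2[of "list_encode ys" y]
    by (auto simp: less_Suc_eq_le)
qed simp

lemma in_list_iff: "in_list b l \<longleftrightarrow> b \<in> set (list_decode l)"
proof -
  define xs where "xs = list_decode l"
  have l: "l = list_encode xs" by (simp add: xs_def)
  have "drp i l \<noteq> 0 \<longleftrightarrow> i < length xs" for i
  proof -
    have "list_encode ys \<noteq> 0 \<longleftrightarrow> ys \<noteq> []" for ys by (cases ys) auto
    then show ?thesis unfolding l drp_eq by (simp add: not_le)
  qed
  then have "in_list b l \<longleftrightarrow> (\<exists>i<l. i < length xs \<and> xs ! i = b)"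
    unfolding in_list_def using entry_list_encode[of _ xs] l by auto
  also have "\<dots> \<longleftrightarrow> b \<in> set xs"
    using length_le_list_encode[of xs] l by (auto simp: in_set_conv_nth intro: less_le_trans)
  finally show ?thesis unfolding xs_def .
qed

lemma in_list_less: "in_list b l \<Longrightarrow> b < l"
  using less_list_encode[of b "list_decode l"] by (simp add: in_list_iff)

text \<open>Junk codes are decoded as well, so that every number below \<open>M\<close> stands for an expression.\<close>

function dec_fm :: "nat \<Rightarrow> fm" where
  "dec_fm n =
    (if hdc n = 0 then Eq (arg1 n) (arg2 n)
     else if hdc n = 1 then Neg (dec_fm (arg1 n))
     else if hdc n = 2 then Conj (dec_fm (arg1 n)) (dec_fm (arg2 n))
     else if hdc n = 3 then Disj (dec_fm (arg1 n)) (dec_fm (arg2 n))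
     else if hdc n = 4 then Ex (arg1 n) (dec_fm (arg2 n))
     else All (arg1 n) (dec_fm (arg2 n)))"
  by auto
termination by (relation "measure id") (auto simp: arg_less)

lemma builder_code_less:
  assumes "hdc n \<noteq> 0" "b \<in> set (list_decode (arg1 n))"
  shows "b < n" "hdc b < n"
  using in_list_less[of b "arg1 n"] assms arg_less(1)[of n] hdc_le[of b]
  by (auto simp: in_list_iff)

function dec :: "nat \<Rightarrow> expr" where
  "dec n =
    (if hdc n = 0 then AVar (arg1 n)
     else UnionOf (map (\<lambda>b. Builder (dec (hdc b)) (list_decode (arg1 b)) (dec_fm (arg2 b)))
       (list_decode (arg1 n))))"
  by auto
termination by (relation "measure id") (auto simp: builder_code_less)

declare dec_fm.simps [simp del] dec.simps [simp del]

lemma arg_list_encode [simp]: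
  "arg1 (list_encode (x # y # xs)) = y" "arg2 (list_encode (x # y # z # xs)) = z"
  by (simp_all add: arg1_def arg2_def del: list_encode.simps)

lemma dec_fm_encode: "dec_fm (fm_encode \<phi>) = \<phi>"
  by (induction \<phi>; subst dec_fm.simps) (simp_all del: list_encode.simps)

lemma dec_encode: "dec (expr_encode e) = e"
  and "Builder (dec (hdc (builder_encode b))) (list_decode (arg1 (builder_encode b)))
      (dec_fm (arg2 (builder_encode b))) = b"
proof (induction e and b rule: expr.induct builder.induct)
  case (AVar x)
  then show ?case by (subst dec.simps) (simp del: list_encode.simps)
next
  case (UnionOf bs)
  then show ?case
    by (subst dec.simps) (simp add: map_idI comp_def del: list_encode.simps)
next
  case (Builder e xs \<phi>)
  then show ?case by (simp add: dec_fm_encode del: list_encode.simps)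
qed

text \<open>Together with the decrease of codes this lets a single \<open>M\<close> bound both the
  codes of expressions and their variables.\<close>

lemma fv_dec_fm: "fv_fm (dec_fm n) \<subseteq> {..n}"
proof (induction n rule: less_induct)
  case (less n)
  show ?case
  proof (cases "hdc n = 0")
    case True
    then show ?thesis using arg_le[of n] by (subst dec_fm.simps) simp
  next
    case False
    then have "fv_fm (dec_fm (arg1 n)) \<subseteq> {..n}" "fv_fm (dec_fm (arg2 n)) \<subseteq> {..n}"
      using less[OF arg_less(1)] less[OF arg_less(2)] arg_le[of n] by fastforce+
    then show ?thesis using False by (subst dec_fm.simps) auto
  qed
qed

text \<open>Parts have smaller codes than the whole, so the expressions with codes below
  \<open>M\<close> are closed under taking parts.\<close>

lemma finite_approximation_dec:
  assumes "0 < M" "4 * M \<le> N"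
  shows "finite_approximation (dec ` {..<M}) M N"
proof
  show "x < M" if x: "AVar x \<in> dec ` {..<M}" for x
  proof -
    obtain c where "c < M" "dec c = AVar x" using x by auto
    then show ?thesis using arg_le(1)[of c] by (subst (asm) dec.simps) (auto split: if_splits)
  qed
  show "e \<in> dec ` {..<M} \<and> fv_fm \<phi> \<subseteq> {..<M}"
    if bs: "UnionOf bs \<in> dec ` {..<M}" "Builder e xs \<phi> \<in> set bs" for bs e xs \<phi>
  proof -
    obtain c where c: "c < M" "dec c = UnionOf bs" using bs(1) by auto
    have "hdc c \<noteq> 0" using c(2) by (subst (asm) dec.simps) (auto split: if_splits)
    moreover from this obtain b where b: "b \<in> set (list_decode (arg1 c))" "e = dec (hdc b)"
      "\<phi> = dec_fm (arg2 b)"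
      using c(2) bs(2) by (subst (asm) dec.simps) auto
    ultimately have "hdc b < M" "arg2 b < M"
      using builder_code_less[of c b] c(1) arg_le(2)[of b] by auto
    then show ?thesis using b fv_dec_fm[of "arg2 b"] by auto
  qed
qed (use assms in auto)

section \<open>Environments as numbers in base \<open>N\<close>, one digit per variable\<close>

definition dig :: "nat \<Rightarrow> nat \<Rightarrow> nat \<Rightarrow> nat" where
  "dig N k x = k div N ^ x mod N"

definition env :: "nat \<Rightarrow> nat \<Rightarrow> nat \<Rightarrow> var \<Rightarrow> atom" where
  "env M N k x = (if x < M then dig N k x else 0)"

lemma env_in_envs: "0 < N \<Longrightarrow> env M N k \<in> envs M N"
  by (auto simp: env_def dig_def envs_def)

lemma div_pack: "k < B \<Longrightarrow> (c * B + k) div B = c" for k B c :: nat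
proof -
  assume k: "k < B"
  then have "(c * B + k) div B = c + k div B" by (intro div_mult_self3) simp
  with k show ?thesis by simp
qed

lemma ex_dig:
  assumes "\<And>x. x < M \<Longrightarrow> \<rho> x < N"
  shows "\<exists>k<N ^ M. \<forall>x<M. dig N k x = \<rho> x"
  using assms
proof (induction M)
  case (Suc M)
  then obtain k where k: "k < N ^ M" "\<forall>x<M. dig N k x = \<rho> x" by auto
  let ?k = "k + \<rho> M * N ^ M"
  have "\<rho> M + 1 \<le> N" using Suc.prems[of M] by simp
  then have "(\<rho> M + 1) * N ^ M \<le> N * N ^ M" by (rule mult_le_mono1)
  then have "?k < N ^ Suc M" using k(1) by simp
  moreover have "dig N ?k x = \<rho> x" if x: "x < Suc M" for x
  proof (cases "x = M")
    case True
    have "?k div N ^ M = \<rho> M" using div_pack[OF k(1), of "\<rho> M"] by (simp only: add.commute)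
    then show ?thesis using True Suc.prems[of M] by (simp add: dig_def)
  next
    case False
    then obtain d where d: "M = x + Suc d" using x less_imp_Suc_add[of x M] by auto
    have N: "0 < N" using Suc.prems[of 0] by simp
    have "?k = k + (\<rho> M * N ^ d * N) * N ^ x" by (simp add: d power_add)
    then have "?k div N ^ x = k div N ^ x + \<rho> M * N ^ d * N"
      using N by (metis div_mult_self1 power_not_zero not_gr_zero add.commute)
    then have "dig N ?k x = dig N k x" by (simp add: dig_def)
    then show ?thesis using k(2) x False by simp
  qed
  ultimately show ?case by blast
qed auto

lemma ex_env:
  assumes "\<rho> \<in> envs M N"
  shows "\<exists>k<N ^ M. env M N k = \<rho>"
proof -
  obtain k where "k < N ^ M" "\<forall>x<M. dig N k x = \<rho> x"
    using ex_dig[of M \<rho> N] assms by (auto simp: envs_def)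
  then show ?thesis using assms by (intro exI[of _ k]) (auto simp: env_def envs_def)
qed

text \<open>From \<open>M\<close> on both environments are \<open>0\<close>, so agreement outside
  \<open>Y\<close> is a bounded condition.\<close>

lemma env_agree_iff:
  "(\<forall>y<M. y \<in> Y \<or> dig N k y = dig N k' y) \<longleftrightarrow> (\<forall>y. y \<notin> Y \<longrightarrow> env M N k' y = env M N k y)"
  by (auto simp: env_def)

lemma ex_env_iff:
  assumes "0 < N"
  shows "(\<exists>k<N ^ M. P (env M N k)) \<longleftrightarrow> (\<exists>\<rho>\<in>envs M N. P \<rho>)"
  using ex_env[of _ M N] env_in_envs[OF assms] by metis

text \<open>Tables are indexed by a code \<open>c < M\<close> and an environment code \<open>k < N ^ M\<close>.\<close>

definition tab :: "nat \<Rightarrow> nat \<Rightarrow> nat \<Rightarrow> nat \<Rightarrow> nat \<Rightarrow> nat" where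
  "tab M N t c k = entry t (c * N ^ M + k)"

lemma ex_tab: "\<exists>t. \<forall>c<M. \<forall>k<N ^ M. tab M N t c k = f c k"
proof (intro exI allI impI)
  fix c k assume "c < M" "k < N ^ M"
  moreover from this have "Suc c * N ^ M \<le> M * N ^ M" by (intro mult_le_mono1) simp
  moreover from \<open>k < N ^ M\<close> have "(c * N ^ M + k) div N ^ M = c" by (rule div_pack)
  moreover from \<open>k < N ^ M\<close> have "(c * N ^ M + k) mod N ^ M = k" by simp
  ultimately show "tab M N (list_encode (map (\<lambda>i. f (i div N ^ M) (i mod N ^ M)) [0..<M * N ^ M])) c k = f c k"
    by (simp add: tab_def entry_list_encode)
qed

section \<open>Tables of truth values: Tarski's clauses with subformulas looked up in the
  table\<close>

definition fm_step :: "nat \<Rightarrow> nat \<Rightarrow> nat \<Rightarrow> nat \<Rightarrow> nat \<Rightarrow> bool" where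
  "fm_step M N t c k =
    (if hdc c = 0 then dig N k (arg1 c) = dig N k (arg2 c)
     else if hdc c = 1 then tab M N t (arg1 c) k \<noteq> 1
     else if hdc c = 2 then tab M N t (arg1 c) k = 1 \<and> tab M N t (arg2 c) k = 1
     else if hdc c = 3 then tab M N t (arg1 c) k = 1 \<or> tab M N t (arg2 c) k = 1
     else if hdc c = 4 then \<exists>k'<N ^ M. (\<forall>y<M. y = arg1 c \<or> dig N k y = dig N k' y) \<and> tab M N t (arg2 c) k' = 1
     else \<forall>k'<N ^ M. (\<forall>y<M. y = arg1 c \<or> dig N k y = dig N k' y) \<longrightarrow> tab M N t (arg2 c) k' = 1)"

text \<open>Each entry is tied to entries at smaller codes, which pins down the entries equal to
  \<open>1\<close>; any other entry stands for false. All quantifiers are bounded, so the condition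
  can be decided.\<close>

definition fm_ok :: "nat \<Rightarrow> nat \<Rightarrow> nat \<Rightarrow> bool" where
  "fm_ok M N t \<longleftrightarrow> (\<forall>c<M. \<forall>k<N ^ M. tab M N t c k = 1 \<longleftrightarrow> fm_step M N t c k)"

text \<open>The at most \<open>M\<close> atoms of \<open>\<rho>\<close> leave a spare one below
  \<open>N\<close>. A witness outside them is traded for a spare atom by a permutation fixing them,
  which formulas do not notice.\<close>

lemma sat_Ex_envs:
  assumes "x < M" "fv_fm \<phi> \<subseteq> {..<M}" "M < N" "\<rho> \<in> envs M N"
  shows "sat (Ex x \<phi>) \<rho> \<longleftrightarrow> (\<exists>\<rho>'\<in>envs M N. (\<forall>y. y \<noteq> x \<longrightarrow> \<rho>' y = \<rho> y) \<and> sat \<phi> \<rho>')"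
proof
  assume "sat (Ex x \<phi>) \<rho>"
  then obtain a where a: "sat \<phi> (\<rho>(x := a))" by auto
  have rng: "finite (\<rho> ` {..<M})" "\<rho> ` {..<M} \<subseteq> {..<N}" "card (\<rho> ` {..<M}) \<le> M"
    using assms(4) card_image_le[of "{..<M}" \<rho>] by (auto simp: envs_def)
  have "card ({a} - \<rho> ` {..<M}) \<le> 1" using card_mono[of "{a}" "{a} - \<rho> ` {..<M}"] by auto
  also have "1 \<le> card ({..<N} - \<rho> ` {..<M})"
    using rng assms(3) by (simp add: card_Diff_subset)
  finally obtain \<pi> where \<pi>: "bij \<pi>" "\<forall>b\<in>\<rho> ` {..<M}. \<pi> b = b" "\<pi> ` ({a} - \<rho> ` {..<M}) \<subseteq> {..<N} - \<rho> ` {..<M}"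
    using bij_moving_into[of "\<rho> ` {..<M}" "{a}" "{..<N} - \<rho> ` {..<M}"] rng by blast
  have "\<pi> a < N" using \<pi>(2,3) rng(2) by (cases "a \<in> \<rho> ` {..<M}") auto
  then have "\<rho>(x := \<pi> a) \<in> envs M N" using assms(1,4) by (auto simp: envs_def)
  moreover have "sat \<phi> (\<rho>(x := \<pi> a)) \<longleftrightarrow> sat \<phi> (\<pi> \<circ> \<rho>(x := a))"
    using assms(2) \<pi>(2) by (intro sat_cong) auto
  then have "sat \<phi> (\<rho>(x := \<pi> a))" using a sat_bij[OF \<pi>(1)] by blast
  ultimately show "\<exists>\<rho>'\<in>envs M N. (\<forall>y. y \<noteq> x \<longrightarrow> \<rho>' y = \<rho> y) \<and> sat \<phi> \<rho>'"
    by (intro bexI[of _ "\<rho>(x := \<pi> a)"]) auto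
next
  assume "\<exists>\<rho>'\<in>envs M N. (\<forall>y. y \<noteq> x \<longrightarrow> \<rho>' y = \<rho> y) \<and> sat \<phi> \<rho>'"
  then obtain \<rho>' where \<rho>': "\<forall>y. y \<noteq> x \<longrightarrow> \<rho>' y = \<rho> y" "sat \<phi> \<rho>'" by blast
  then have "\<rho>(x := \<rho>' x) = \<rho>'" by auto
  with \<rho>'(2) show "sat (Ex x \<phi>) \<rho>" by (auto intro: exI[of _ "\<rho>' x"])
qed

lemma sat_All_envs:
  assumes "x < M" "fv_fm \<phi> \<subseteq> {..<M}" "M < N" "\<rho> \<in> envs M N"
  shows "sat (All x \<phi>) \<rho> \<longleftrightarrow> (\<forall>\<rho>'\<in>envs M N. (\<forall>y. y \<noteq> x \<longrightarrow> \<rho>' y = \<rho> y) \<longrightarrow> sat \<phi> \<rho>')"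
proof -
  have "fv_fm (Neg \<phi>) \<subseteq> {..<M}" using assms(2) by simp
  note sat_Ex_envs[OF assms(1) this assms(3,4)]
  moreover have "sat (All x \<phi>) \<rho> \<longleftrightarrow> \<not> sat (Ex x (Neg \<phi>)) \<rho>" by simp
  ultimately show ?thesis by (simp only: sat.simps(2)) blast
qed

text \<open>The table is assumed right only at smaller codes. So the lemma shows both that a
  consistent table is correct, by induction on \<open>c\<close>, and that the table of actual truth
  values is consistent.\<close>

lemma fm_step_correct:
  assumes t: "\<And>c' k'. c' < M \<Longrightarrow> k' < N ^ M \<Longrightarrow> hdc c \<noteq> 0 \<Longrightarrow> c' < c \<Longrightarrow>
      tab M N t c' k' = 1 \<longleftrightarrow> sat (dec_fm c') (env M N k')"
    and MN: "M < N" and c: "c < M" and k: "k < N ^ M"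
  shows "fm_step M N t c k \<longleftrightarrow> sat (dec_fm c) (env M N k)"
proof (cases "hdc c = 0")
  case True
  then show ?thesis using arg_le[of c] c by (subst dec_fm.simps) (simp add: fm_step_def env_def)
next
  case False
  have a: "arg1 c < M" "arg2 c < M" using arg_le[of c] c by auto
  have tab: "tab M N t (arg1 c) k' = 1 \<longleftrightarrow> sat (dec_fm (arg1 c)) (env M N k')"
    "tab M N t (arg2 c) k' = 1 \<longleftrightarrow> sat (dec_fm (arg2 c)) (env M N k')" if "k' < N ^ M" for k'
    using t that a False arg_less[of c] by blast+
  have fv: "fv_fm (dec_fm (arg2 c)) \<subseteq> {..<M}" using fv_dec_fm[of "arg2 c"] a by auto
  have N: "0 < N" using MN by simp
  have agree: "(\<forall>y<M. y = x \<or> dig N k y = dig N k' y) \<longleftrightarrow> (\<forall>y. y \<noteq> x \<longrightarrow> env M N k' y = env M N k y)" for x k'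
    using env_agree_iff[of M "{x}" N k k'] by simp
  have ex: "(\<exists>k'<N ^ M. (\<forall>y<M. y = arg1 c \<or> dig N k y = dig N k' y) \<and> tab M N t (arg2 c) k' = 1) \<longleftrightarrow>
      sat (Ex (arg1 c) (dec_fm (arg2 c))) (env M N k)"
  proof -
    have "(\<exists>k'<N ^ M. (\<forall>y<M. y = arg1 c \<or> dig N k y = dig N k' y) \<and> tab M N t (arg2 c) k' = 1) \<longleftrightarrow>
      (\<exists>k'<N ^ M. (\<forall>y. y \<noteq> arg1 c \<longrightarrow> env M N k' y = env M N k y) \<and> sat (dec_fm (arg2 c)) (env M N k'))"
      using tab(2) unfolding agree by blast
    then show ?thesis
      unfolding sat_Ex_envs[OF a(1) fv MN env_in_envs[OF N]]
        ex_env_iff[OF N, where P = "\<lambda>\<rho>. (\<forall>y. y \<noteq> arg1 c \<longrightarrow> \<rho> y = env M N k y) \<and> sat (dec_fm (arg2 c)) \<rho>"] .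
  qed
  have all: "(\<forall>k'<N ^ M. (\<forall>y<M. y = arg1 c \<or> dig N k y = dig N k' y) \<longrightarrow> tab M N t (arg2 c) k' = 1) \<longleftrightarrow>
      sat (All (arg1 c) (dec_fm (arg2 c))) (env M N k)"
  proof -
    have "(\<forall>k'<N ^ M. (\<forall>y<M. y = arg1 c \<or> dig N k y = dig N k' y) \<longrightarrow> tab M N t (arg2 c) k' = 1) \<longleftrightarrow>
      \<not> (\<exists>k'<N ^ M. (\<forall>y. y \<noteq> arg1 c \<longrightarrow> env M N k' y = env M N k y) \<and> \<not> sat (dec_fm (arg2 c)) (env M N k'))"
      using tab(2) unfolding agree by blast
    then show ?thesis
      unfolding sat_All_envs[OF a(1) fv MN env_in_envs[OF N]]
        ex_env_iff[OF N, where P = "\<lambda>\<rho>. (\<forall>y. y \<noteq> arg1 c \<longrightarrow> \<rho> y = env M N k y) \<and> \<not> sat (dec_fm (arg2 c)) \<rho>"]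
      by blast
  qed
  show ?thesis
    unfolding fm_step_def ex all using False tab[OF k] by (subst dec_fm.simps) (simp del: sat.simps(5,6))
qed

lemma fm_ok_correct:
  assumes "fm_ok M N t" "M < N" "c < M" "k < N ^ M"
  shows "tab M N t c k = 1 \<longleftrightarrow> sat (dec_fm c) (env M N k)"
  using assms(3,4)
proof (induction c arbitrary: k rule: less_induct)
  case (less c)
  have "tab M N t c k = 1 \<longleftrightarrow> fm_step M N t c k"
    using assms(1) less.prems unfolding fm_ok_def by blast
  also have "\<dots> \<longleftrightarrow> sat (dec_fm c) (env M N k)"
    using less.IH assms(2) less.prems by (intro fm_step_correct) blast+
  finally show ?case .
qed

lemma ex_fm_ok:
  assumes "M < N"
  shows "\<exists>t. fm_ok M N t"
proof -
  obtain t where t: "\<forall>c<M. \<forall>k<N ^ M. tab M N t c k = (if sat (dec_fm c) (env M N k) then 1 else 0)"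
    using ex_tab[of M N "\<lambda>c k. if sat (dec_fm c) (env M N k) then 1 else 0"] by auto
  then have t: "tab M N t c k = 1 \<longleftrightarrow> sat (dec_fm c) (env M N k)" if "c < M" "k < N ^ M" for c k
    using that by auto
  then have "fm_ok M N t"
    unfolding fm_ok_def using fm_step_correct[of M N _ t] assms by blast
  then show ?thesis ..
qed

section \<open>Tables of values of expressions\<close>

definition builder_mem :: "nat \<Rightarrow> nat \<Rightarrow> nat \<Rightarrow> nat \<Rightarrow> nat \<Rightarrow> nat \<Rightarrow> nat \<Rightarrow> bool" where
  "builder_mem M N t c k b k' \<longleftrightarrow> in_list b (arg1 c) \<and>
     (\<forall>y<M. in_list y (arg1 b) \<or> dig N k y = dig N k' y) \<and> tab M N t (arg2 b) k' = 1"

text \<open>The entry for a set is not computed but pinned down by two inclusions: its elements come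
  from builders, and builders contribute their values. Oddness excludes atoms, so the elements
  determine the entry.\<close>

definition val_ok :: "nat \<Rightarrow> nat \<Rightarrow> nat \<Rightarrow> nat \<Rightarrow> bool" where
  "val_ok M N t s \<longleftrightarrow> (\<forall>c<M. \<forall>k<N ^ M.
     if hdc c = 0 then tab M N s c k = 2 * dig N k (arg1 c)
     else odd (tab M N s c k) \<and>
       (\<forall>w<tab M N s c k. w \<in> hmem (tab M N s c k) \<longrightarrow>
         (\<exists>b<M. \<exists>k'<N ^ M. builder_mem M N t c k b k' \<and> tab M N s (hdc b) k' = w)) \<and>
       (\<forall>b<M. \<forall>k'<N ^ M. builder_mem M N t c k b k' \<longrightarrow>
         tab M N s (hdc b) k' \<in> hmem (tab M N s c k)))"

text \<open>The bridge from tables to \<open>hval\<close>: the builders in \<open>c\<close> and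
  their environments have codes within the table, so membership in a union becomes a bounded
  search.\<close>

lemma hmem_dec:
  assumes t: "fm_ok M N t" and MN: "M < N" and c: "c < M" "hdc c \<noteq> 0"
  shows "odd (hval M N (dec c) (env M N k))"
    and "w \<in> hmem (hval M N (dec c) (env M N k)) \<longleftrightarrow>
      (\<exists>b<M. \<exists>k'<N ^ M. builder_mem M N t c k b k' \<and> hval M N (dec (hdc b)) (env M N k') = w)"
proof -
  let ?B = "\<lambda>b. Builder (dec (hdc b)) (list_decode (arg1 b)) (dec_fm (arg2 b))"
  have dec: "dec c = UnionOf (map ?B (list_decode (arg1 c)))"
    using c(2) by (subst dec.simps) simp
  show "odd (hval M N (dec c) (env M N k))" unfolding dec by simp
  have N: "0 < N" using MN by simp
  have "w \<in> hvals M N (?B b) (env M N k) \<longleftrightarrow>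
      (\<exists>k'<N ^ M. builder_mem M N t c k b k' \<and> hval M N (dec (hdc b)) (env M N k') = w)"
    if b: "b \<in> set (list_decode (arg1 c))" for b
  proof -
    have "arg2 b < M" using builder_code_less[OF c(2) b] c(1) arg_le(2)[of b] by simp
    then have "builder_mem M N t c k b k' \<longleftrightarrow>
        (\<forall>y. y \<notin> set (list_decode (arg1 b)) \<longrightarrow> env M N k' y = env M N k y) \<and>
        sat (dec_fm (arg2 b)) (env M N k')" if "k' < N ^ M" for k'
      using that b fm_ok_correct[OF t MN] env_agree_iff[of M "set (list_decode (arg1 b))" N k k']
      unfolding builder_mem_def in_list_iff by simp
    then have "(\<exists>k'<N ^ M. builder_mem M N t c k b k' \<and> hval M N (dec (hdc b)) (env M N k') = w) \<longleftrightarrow>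
      (\<exists>k'<N ^ M. ((\<forall>y. y \<notin> set (list_decode (arg1 b)) \<longrightarrow> env M N k' y = env M N k y) \<and>
        sat (dec_fm (arg2 b)) (env M N k')) \<and> hval M N (dec (hdc b)) (env M N k') = w)"
      by blast
    also have "\<dots> \<longleftrightarrow> w \<in> hvals M N (?B b) (env M N k)"
      unfolding ex_env_iff[OF N, where P = "\<lambda>\<rho>. ((\<forall>y. y \<notin> set (list_decode (arg1 b)) \<longrightarrow>
        \<rho> y = env M N k y) \<and> sat (dec_fm (arg2 b)) \<rho>) \<and> hval M N (dec (hdc b)) \<rho> = w"]
      by auto
    finally show ?thesis by simp
  qed
  moreover have "b < M" if "b \<in> set (list_decode (arg1 c))" for b
    using builder_code_less[OF c(2) that] c(1) by simp
  moreover have "b \<in> set (list_decode (arg1 c))" if "builder_mem M N t c k b k'" for b k'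
    using that by (simp add: builder_mem_def in_list_iff)
  ultimately show "w \<in> hmem (hval M N (dec c) (env M N k)) \<longleftrightarrow>
      (\<exists>b<M. \<exists>k'<N ^ M. builder_mem M N t c k b k' \<and> hval M N (dec (hdc b)) (env M N k') = w)"
    unfolding dec hmem_hval set_map by (simp del: hvals.simps) blast
qed

lemma hval_dec_AVar:
  assumes "hdc c = 0" "c < M"
  shows "hval M N (dec c) (env M N k) = 2 * dig N k (arg1 c)"
  using assms arg_le(1)[of c] by (subst dec.simps) (simp add: env_def)

lemma val_ok_correct:
  assumes t: "fm_ok M N t" and s: "val_ok M N t s" and MN: "M < N" and "c < M" "k < N ^ M"
  shows "tab M N s c k = hval M N (dec c) (env M N k)"
  using assms(4,5)
proof (induction c arbitrary: k rule: less_induct)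
  case (less c)
  show ?case
  proof (cases "hdc c = 0")
    case True
    then show ?thesis using s less.prems hval_dec_AVar unfolding val_ok_def by simp
  next
    case False
    have IH: "tab M N s (hdc b) k' = hval M N (dec (hdc b)) (env M N k')"
      if "builder_mem M N t c k b k'" "k' < N ^ M" for b k'
      using that less.IH[of "hdc b" k'] builder_code_less(2)[OF False, of b] less.prems(1)
      by (simp add: builder_mem_def in_list_iff)
    from s less.prems False have "odd (tab M N s c k)"
      and 1: "\<forall>w<tab M N s c k. w \<in> hmem (tab M N s c k) \<longrightarrow>
         (\<exists>b<M. \<exists>k'<N ^ M. builder_mem M N t c k b k' \<and> tab M N s (hdc b) k' = w)"
      and 2: "\<forall>b<M. \<forall>k'<N ^ M. builder_mem M N t c k b k' \<longrightarrow>
         tab M N s (hdc b) k' \<in> hmem (tab M N s c k)"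
      unfolding val_ok_def by auto
    moreover have "w \<in> hmem (tab M N s c k) \<longleftrightarrow> w \<in> hmem (hval M N (dec c) (env M N k))" for w
      unfolding hmem_dec(2)[OF t MN less.prems(1) False]
    proof
      assume "w \<in> hmem (tab M N s c k)"
      then obtain b k' where "b < M" "k' < N ^ M" "builder_mem M N t c k b k'" "tab M N s (hdc b) k' = w"
        using 1 hmem_less by blast
      with IH show "\<exists>b<M. \<exists>k'<N ^ M. builder_mem M N t c k b k' \<and> hval M N (dec (hdc b)) (env M N k') = w"
        by metis
    next
      assume "\<exists>b<M. \<exists>k'<N ^ M. builder_mem M N t c k b k' \<and> hval M N (dec (hdc b)) (env M N k') = w"
      with IH 2 show "w \<in> hmem (tab M N s c k)" by metis
    qed
    ultimately show ?thesis
      using hmem_dec(1)[OF t MN less.prems(1) False] by (intro hmem_inj) auto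
  qed
qed

lemma ex_val_ok:
  assumes t: "fm_ok M N t" and MN: "M < N"
  shows "\<exists>s. val_ok M N t s"
proof -
  obtain s where s: "\<forall>c<M. \<forall>k<N ^ M. tab M N s c k = hval M N (dec c) (env M N k)"
    using ex_tab[of M N "\<lambda>c k. hval M N (dec c) (env M N k)"] by auto
  have b: "hdc b < M" if "b < M" for b using that hdc_le[of b] by simp
  have "val_ok M N t s"
    unfolding val_ok_def
  proof (intro allI impI)
    fix c k assume c: "c < M" and k: "k < N ^ M"
    have *: "tab M N s (hdc b) k' = hval M N (dec (hdc b)) (env M N k')" if "b < M" "k' < N ^ M" for b k'
      using s b that by simp
    show "if hdc c = 0 then tab M N s c k = 2 * dig N k (arg1 c)
     else odd (tab M N s c k) \<and>
       (\<forall>w<tab M N s c k. w \<in> hmem (tab M N s c k) \<longrightarrow>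
         (\<exists>b<M. \<exists>k'<N ^ M. builder_mem M N t c k b k' \<and> tab M N s (hdc b) k' = w)) \<and>
       (\<forall>b<M. \<forall>k'<N ^ M. builder_mem M N t c k b k' \<longrightarrow>
         tab M N s (hdc b) k' \<in> hmem (tab M N s c k))"
    proof (cases "hdc c = 0")
      case True
      then show ?thesis using s c k hval_dec_AVar by simp
    next
      case False
      note h = hmem_dec[OF t MN c False, where k = k]
      have T: "tab M N s c k = hval M N (dec c) (env M N k)" using s c k by blast
      have "\<exists>b<M. \<exists>k'<N ^ M. builder_mem M N t c k b k' \<and> tab M N s (hdc b) k' = w"
        if w: "w \<in> hmem (tab M N s c k)" for w
      proof -
        obtain b k' where "b < M" "k' < N ^ M" "builder_mem M N t c k b k'"
          "hval M N (dec (hdc b)) (env M N k') = w"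
          using w[unfolded T] unfolding h(2) by blast
        with * show ?thesis by blast
      qed
      moreover have "tab M N s (hdc b) k' \<in> hmem (tab M N s c k)"
        if "b < M" "k' < N ^ M" "builder_mem M N t c k b k'" for b k'
        unfolding T *[OF that(1,2)] h(2) using that by blast
      ultimately show ?thesis using False h(1) s c k by simp
    qed
  qed
  then show ?thesis ..
qed

text \<open>A named predicate is proved decidable once, at the projections of a packed argument;
  computable terms are then substituted for them.\<close>

lemma decidable_apply2:
  assumes "decidable (\<lambda>z. P (pfst z) (psnd z))" "computable f" "computable g"
  shows "decidable (\<lambda>z. P (f z) (g z))"
  using decidable_compose[OF assms(1) computable_pair[OF assms(2,3)]] by simp

lemma decidable_apply3:
  assumes "decidable (\<lambda>z. P (pfst z) (pfst (psnd z)) (psnd (psnd z)))"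
    "computable f" "computable g" "computable h"
  shows "decidable (\<lambda>z. P (f z) (g z) (h z))"
  using decidable_compose[OF assms(1) computable_pair[OF assms(2) computable_pair[OF assms(3,4)]]]
  by simp

lemma decidable_apply4:
  assumes "decidable (\<lambda>z. P (pfst z) (pfst (psnd z)) (pfst (psnd (psnd z))) (psnd (psnd (psnd z))))"
    "computable f" "computable g" "computable h" "computable i"
  shows "decidable (\<lambda>z. P (f z) (g z) (h z) (i z))"
  using decidable_compose[OF assms(1)
      computable_pair[OF assms(2) computable_pair[OF assms(3) computable_pair[OF assms(4,5)]]]]
  by simp

section \<open>Computability of the decoding functions and decidability of the table
  conditions\<close>

lemma computable_hdc: "computable f \<Longrightarrow> computable (\<lambda>z. hdc (f z))"
  unfolding hdc_def by (intro computable_intros)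

lemma computable_tlc: "computable f \<Longrightarrow> computable (\<lambda>z. tlc (f z))"
  unfolding tlc_def by (intro computable_intros)

lemma computable_arg1: "computable f \<Longrightarrow> computable (\<lambda>z. arg1 (f z))"
  unfolding arg1_def by (intro computable_hdc computable_tlc)

lemma computable_arg2: "computable f \<Longrightarrow> computable (\<lambda>z. arg2 (f z))"
  unfolding arg2_def by (intro computable_hdc computable_tlc)

lemma computable_drp:
  "computable f \<Longrightarrow> computable g \<Longrightarrow> computable (\<lambda>z. drp (f z) (g z))"
  unfolding drp_def by (intro computable_intros computable_tlc)

lemma computable_entry:
  "computable f \<Longrightarrow> computable g \<Longrightarrow> computable (\<lambda>z. entry (f z) (g z))"
  unfolding entry_def by (intro computable_hdc computable_drp)

lemma decidable_in_list:
  "computable f \<Longrightarrow> computable g \<Longrightarrow> decidable (\<lambda>z. in_list (f z) (g z))"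
  by (rule decidable_apply2)
    (unfold in_list_def, intro computable_intros computable_drp computable_entry)

lemma computable_dig:
  "computable f \<Longrightarrow> computable g \<Longrightarrow> computable h \<Longrightarrow> computable (\<lambda>z. dig (f z) (g z) (h z))"
  unfolding dig_def by (intro computable_intros)

lemma computable_tab:
  "computable f \<Longrightarrow> computable g \<Longrightarrow> computable h \<Longrightarrow> computable i \<Longrightarrow> computable j \<Longrightarrow>
    computable (\<lambda>z. tab (f z) (g z) (h z) (i z) (j z))"
  unfolding tab_def by (intro computable_intros computable_entry)

lemma decidable_hmem:
  assumes "computable f" "computable g"
  shows "decidable (\<lambda>z. f z \<in> hmem (g z))"
proof -
  have "x \<in> hmem h \<longleftrightarrow> odd h \<and> odd (h div 2 div 2 ^ x)" for x h
    by (simp add: hmem_def set_decode_def)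
  then show ?thesis using assms by (simp only:) (intro computable_intros)
qed

lemma computable_hpair:
  "computable f \<Longrightarrow> computable g \<Longrightarrow> computable (\<lambda>z. hpair (f z) (g z))"
  unfolding hpair_def hupair_def by (intro computable_intros)

lemmas computable_code_intros = computable_intros computable_hdc computable_arg1 computable_arg2
  computable_dig computable_tab computable_hpair decidable_in_list decidable_hmem

lemma decidable_fm_ok:
  "computable f \<Longrightarrow> computable g \<Longrightarrow> computable h \<Longrightarrow> decidable (\<lambda>z. fm_ok (f z) (g z) (h z))"
  by (rule decidable_apply3)
    (unfold fm_ok_def fm_step_def, intro computable_code_intros)

lemma decidable_val_ok:
  "computable f \<Longrightarrow> computable g \<Longrightarrow> computable h \<Longrightarrow> computable i \<Longrightarrow>
    decidable (\<lambda>z. val_ok (f z) (g z) (h z) (i z))"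
  by (rule decidable_apply4)
    (unfold val_ok_def builder_mem_def, intro computable_code_intros)

text \<open>On input \<open>n\<close>, variables, atoms of the valuation and codes of expressions are below \<open>Suc n\<close>.\<close>

abbreviation (input) "vars_bound n \<equiv> Suc n"
abbreviation (input) "atoms_bound n \<equiv> 4 * Suc n"
abbreviation (input) "envs_bound n \<equiv> atoms_bound n ^ vars_bound n"

text \<open>Which consistent table the search finds is immaterial: they all mark the same entries
  with \<open>1\<close>.\<close>

definition fm_table :: "nat \<Rightarrow> nat" where
  "fm_table n = (LEAST t. fm_ok (vars_bound n) (atoms_bound n) t)"

definition val_table :: "nat \<Rightarrow> nat" where
  "val_table n = (LEAST s. val_ok (vars_bound n) (atoms_bound n) (fm_table n) s)"

definition val_code :: "nat \<Rightarrow> nat \<Rightarrow> nat \<Rightarrow> nat" where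
  "val_code n c k = tab (vars_bound n) (atoms_bound n) (val_table n) c k"

lemma fm_table_ok: "fm_ok (vars_bound n) (atoms_bound n) (fm_table n)"
  unfolding fm_table_def by (rule LeastI_ex, rule ex_fm_ok) simp

lemma val_table_ok: "val_ok (vars_bound n) (atoms_bound n) (fm_table n) (val_table n)"
  unfolding val_table_def by (rule LeastI_ex, rule ex_val_ok[OF fm_table_ok]) simp

lemma val_code_eq:
  assumes "c < vars_bound n" "k < envs_bound n"
  shows "val_code n c k =
    hval (vars_bound n) (atoms_bound n) (dec c) (env (vars_bound n) (atoms_bound n) k)"
  unfolding val_code_def by (rule val_ok_correct[OF fm_table_ok val_table_ok]) (use assms in simp_all)

lemma computable_fm_table: "computable fm_table"
  unfolding fm_table_def
proof (rule computable_Least)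
  show "decidable (\<lambda>w. fm_ok (vars_bound (pfst w)) (atoms_bound (pfst w)) (psnd w))"
    by (intro decidable_fm_ok computable_intros)
  show "\<exists>t. fm_ok (vars_bound n) (atoms_bound n) t" for n
    by (rule ex_fm_ok) simp
qed

lemma computable_val_table: "computable val_table"
  unfolding val_table_def
proof (rule computable_Least)
  show "decidable (\<lambda>w. val_ok (vars_bound (pfst w)) (atoms_bound (pfst w)) (fm_table (pfst w)) (psnd w))"
    by (intro decidable_val_ok computable_intros computable_compose[OF computable_fm_table])
  show "\<exists>s. val_ok (vars_bound n) (atoms_bound n) (fm_table n) s" for n
    by (rule ex_val_ok[OF fm_table_ok]) simp
qed

lemma computable_val_code:
  "computable f \<Longrightarrow> computable g \<Longrightarrow> computable h \<Longrightarrow> computable (\<lambda>z. val_code (f z) (g z) (h z))"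
  unfolding val_code_def
  by (intro computable_tab computable_intros computable_compose[OF computable_val_table])

section \<open>The decision procedures on codes\<close>

definition matches :: "nat \<Rightarrow> nat \<Rightarrow> bool" where
  "matches n k \<longleftrightarrow> (\<forall>p<n. in_list p (psnd n) \<longrightarrow> dig (atoms_bound n) k (pfst p) = psnd p)"

definition fixed_code :: "nat \<Rightarrow> nat \<Rightarrow> nat \<Rightarrow> bool" where
  "fixed_code n k w \<longleftrightarrow> \<not> (\<exists>c<vars_bound n. \<exists>i<envs_bound n. \<exists>j<envs_bound n.
     val_code n c i = w \<and> val_code n c j \<noteq> w \<and>
     (\<forall>x<vars_bound n. \<forall>y<vars_bound n.
       (dig (atoms_bound n) i x = dig (atoms_bound n) i y \<longleftrightarrow> dig (atoms_bound n) j x = dig (atoms_bound n) j y) \<and>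
       (dig (atoms_bound n) i x = dig (atoms_bound n) k y \<longleftrightarrow> dig (atoms_bound n) j x = dig (atoms_bound n) k y)))"

definition vertex_cover_code :: "nat \<Rightarrow> nat \<Rightarrow> nat \<Rightarrow> nat \<Rightarrow> bool" where
  "vertex_cover_code n k v e \<longleftrightarrow>
     (\<forall>x<e. x \<in> hmem e \<longrightarrow> (\<exists>y<v. y \<in> hmem v \<and> y \<in> hmem x \<and> fixed_code n k y))"

text \<open>\<open>c\<close> codes the candidate set of vertices. It need only range up to
  \<open>v\<close>, because subsets have no larger codes than the set.\<close>

definition feedback_vertex_code :: "nat \<Rightarrow> nat \<Rightarrow> nat \<Rightarrow> nat \<Rightarrow> bool" where
  "feedback_vertex_code n k v e \<longleftrightarrow> \<not> (\<exists>c<Suc v. (\<exists>u<c. u \<in> hmem c) \<and>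
     (\<forall>u<c. u \<in> hmem c \<longrightarrow> u \<in> hmem v \<and> (\<exists>w<c. w \<in> hmem c \<and>
       hpair u w \<in> hmem e \<and> \<not> fixed_code n k u \<and> \<not> fixed_code n k w)))"

definition feedback_arc_code :: "nat \<Rightarrow> nat \<Rightarrow> nat \<Rightarrow> nat \<Rightarrow> bool" where
  "feedback_arc_code n k v e \<longleftrightarrow> \<not> (\<exists>c<Suc v. (\<exists>u<c. u \<in> hmem c) \<and>
     (\<forall>u<c. u \<in> hmem c \<longrightarrow> u \<in> hmem v \<and> (\<exists>w<c. w \<in> hmem c \<and>
       hpair u w \<in> hmem e \<and> \<not> (fixed_code n k u \<and> fixed_code n k w))))"

text \<open>\<open>pfst n\<close> codes the expression and \<open>psnd n\<close> the valuation,
  which \<open>k\<close> extends by arbitrary values at the other variables. The quantifiers over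
  \<open>v\<close> and \<open>e\<close> split the code of the graph into its unique
  components.\<close>

definition answer :: "(nat \<Rightarrow> nat \<Rightarrow> nat \<Rightarrow> nat \<Rightarrow> bool) \<Rightarrow> nat \<Rightarrow> bool" where
  "answer P n \<longleftrightarrow> (\<exists>k<envs_bound n. matches n k \<and>
     (\<exists>v<val_code n (pfst n) k. \<exists>e<val_code n (pfst n) k.
       val_code n (pfst n) k = hpair v e \<and> P n k v e))"

lemma decidable_matches:
  "computable f \<Longrightarrow> computable g \<Longrightarrow> decidable (\<lambda>z. matches (f z) (g z))"
  by (rule decidable_apply2) (unfold matches_def, intro computable_code_intros)

lemma decidable_fixed_code:
  "computable f \<Longrightarrow> computable g \<Longrightarrow> computable h \<Longrightarrow> decidable (\<lambda>z. fixed_code (f z) (g z) (h z))"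
  by (rule decidable_apply3)
    (unfold fixed_code_def, intro computable_code_intros computable_val_code)

lemma decidable_answer:
  assumes "decidable (\<lambda>z. P (pfst z) (pfst (psnd z)) (pfst (psnd (psnd z))) (psnd (psnd (psnd z))))"
  shows "decidable (answer P)"
  unfolding answer_def
  by (intro computable_code_intros decidable_matches computable_val_code decidable_apply4[OF assms])

lemma decidable_codes:
  "decidable (answer vertex_cover_code)"
  "decidable (answer feedback_vertex_code)"
  "decidable (answer feedback_arc_code)"
  by (rule decidable_answer;
      unfold vertex_cover_code_def feedback_vertex_code_def feedback_arc_code_def;
      intro computable_code_intros decidable_fixed_code)+

lemma ball_hmem_code: "(\<forall>x\<in>hmem h. P x) \<longleftrightarrow> (\<forall>x<h. x \<in> hmem h \<longrightarrow> P x)"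
  and bex_hmem_code: "(\<exists>x\<in>hmem h. P x) \<longleftrightarrow> (\<exists>x<h. x \<in> hmem h \<and> P x)"
  using hmem_less by blast+

text \<open>Dropping bits does not increase a number; having an element forces \<open>h\<close> to
  be the code of a set.\<close>

lemma ex_hmem_subset_code:
  assumes "C \<subseteq> hmem h" "C \<noteq> {}"
  shows "\<exists>c<Suc h. hmem c = C"
proof -
  have odd: "odd h" and C: "C \<subseteq> set_decode (h div 2)"
    using assms by (auto simp: hmem_def split: if_splits)
  have "set_encode C \<le> set_encode (set_decode (h div 2))"
    unfolding set_encode_def using C by (intro sum_mono2) auto
  then have "Suc (2 * set_encode C) < Suc h" using odd by (auto elim: oddE)
  moreover have "finite C" using C finite_set_decode finite_subset by blast
  then have "hmem (Suc (2 * set_encode C)) = C" by (simp add: hmem_def set_encode_inverse)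
  ultimately show ?thesis by blast
qed

lemma cycle_code_iff:
  "(\<exists>C\<subseteq>hmem v. C \<noteq> {} \<and> (\<forall>u\<in>C. \<exists>w\<in>C. R u w)) \<longleftrightarrow>
    (\<exists>c<Suc v. (\<exists>u<c. u \<in> hmem c) \<and>
      (\<forall>u<c. u \<in> hmem c \<longrightarrow> u \<in> hmem v \<and> (\<exists>w<c. w \<in> hmem c \<and> R u w)))" (is "?l \<longleftrightarrow> ?r")
proof -
  have 1: "(\<exists>u<c. u \<in> hmem c) \<longleftrightarrow> hmem c \<noteq> {}" for c using hmem_less by blast
  have 2: "(\<forall>u<c. u \<in> hmem c \<longrightarrow> u \<in> hmem v \<and> (\<exists>w<c. w \<in> hmem c \<and> R u w)) \<longleftrightarrow>
      hmem c \<subseteq> hmem v \<and> (\<forall>u\<in>hmem c. \<exists>w\<in>hmem c. R u w)" for c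
    unfolding ball_hmem_code[symmetric] bex_hmem_code[symmetric] by blast
  show ?thesis
    unfolding 1 2
  proof
    assume ?l
    then obtain C where C: "C \<subseteq> hmem v" "C \<noteq> {}" "\<forall>u\<in>C. \<exists>w\<in>C. R u w" by blast
    then obtain c where "c < Suc v" "hmem c = C" using ex_hmem_subset_code by blast
    with C show "\<exists>c<Suc v. hmem c \<noteq> {} \<and> hmem c \<subseteq> hmem v \<and> (\<forall>u\<in>hmem c. \<exists>w\<in>hmem c. R u w)"
      by blast
  next
    assume "\<exists>c<Suc v. hmem c \<noteq> {} \<and> hmem c \<subseteq> hmem v \<and> (\<forall>u\<in>hmem c. \<exists>w\<in>hmem c. R u w)"
    then obtain c where "hmem c \<subseteq> hmem v \<and> hmem c \<noteq> {} \<and> (\<forall>u\<in>hmem c. \<exists>w\<in>hmem c. R u w)"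
      by blast
    then show ?l by (rule exI)
  qed
qed

context
  fixes n M N :: nat
  assumes M: "vars_bound n = M" and N: "4 * M = N"
begin

interpretation finite_approximation "dec ` {..<M}" "M" "N"
  by (rule finite_approximation_dec) (use M N in simp_all)

lemma val_code_eq_hval: "c < M \<Longrightarrow> k < N ^ M \<Longrightarrow> val_code n c k = hv (dec c) (env M N k)"
  using val_code_eq[of c n k] unfolding M N .

lemma N_pos: "0 < N"
  using M N by simp

lemma fixed_code_iff:
  "fixed_code n k w \<longleftrightarrow> hfixed (env (M) (N) k) w"
proof -
  let ?env = "env (M) (N)"
  have type: "(\<forall>x<M. \<forall>y<M.
       (dig (N) i x = dig (N) i y \<longleftrightarrow> dig (N) j x = dig (N) j y) \<and>
       (dig (N) i x = dig (N) k y \<longleftrightarrow> dig (N) j x = dig (N) k y)) \<longleftrightarrow>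
     (\<forall>x<M. \<forall>y<M. (?env i x = ?env i y \<longleftrightarrow> ?env j x = ?env j y) \<and>
       (?env i x = ?env k y \<longleftrightarrow> ?env j x = ?env k y))" for i j
    by (simp add: env_def)
  have ex: "(\<exists>i<N ^ M. \<exists>j<N ^ M. Q (?env i) (?env j)) \<longleftrightarrow> (\<exists>\<rho>\<in>Env. \<exists>\<rho>'\<in>Env. Q \<rho> \<rho>')" for Q
    using ex_env_iff[OF N_pos, of M "\<lambda>\<rho>. \<exists>\<rho>'\<in>Env. Q \<rho> \<rho>'"]
    by (simp only: ex_env_iff[OF N_pos, of M "Q _"])
  have "fixed_code n k w \<longleftrightarrow> \<not> (\<exists>c<M. \<exists>i<N ^ M. \<exists>j<N ^ M.
      hv (dec c) (?env i) = w \<and> hv (dec c) (?env j) \<noteq> w \<and>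
      (\<forall>x<M. \<forall>y<M. (?env i x = ?env i y \<longleftrightarrow> ?env j x = ?env j y) \<and>
       (?env i x = ?env k y \<longleftrightarrow> ?env j x = ?env k y)))"
    unfolding fixed_code_def M N type by (simp add: val_code_eq_hval cong: conj_cong)
  also have "\<dots> \<longleftrightarrow> hfixed (?env k) w"
    unfolding hfixed_def
      ex[where Q = "\<lambda>\<rho> \<rho>'. hv (dec c) \<rho> = w \<and> hv (dec c) \<rho>' \<noteq> w \<and>
        (\<forall>x<M. \<forall>y<M. (\<rho> x = \<rho> y \<longleftrightarrow> \<rho>' x = \<rho>' y) \<and>
          (\<rho> x = ?env k y \<longleftrightarrow> \<rho>' x = ?env k y))" for c]
    by (simp only: bex_simps lessThan_iff Bex_def image_iff) blast
  finally show ?thesis .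
qed

text \<open>Every matching \<open>k\<close> presents the same graph, possibly with more parameters,
  and the verdict \<open>Q\<close> is the same for all of them. So it does not matter which one is
  found, provided that one exists.\<close>

lemma answer_iff:
  assumes s: "valuation_on (fv e) s" and VE: "pres_value e s = vpair (VSet V) (VSet E)"
    and n: "n = pres_encode e s"
    and P: "\<And>k. approximated_graph (dec ` {..<M}) (M) (N)
        (env (M) (N) k) e V E \<Longrightarrow>
      P n k (hc (VSet V)) (hc (VSet E)) \<longleftrightarrow> Q"
  shows "answer P n \<longleftrightarrow> Q"
proof -
  let ?env = "env (M) (N)"
  have fst: "pfst n = expr_encode e" and snd: "psnd n = list_encode (map prod_encode s)"
    by (simp_all add: n pres_encode_def)
  have c: "pfst n < M" using pfst_le[of n] M by simp
  have e: "dec (pfst n) = e" by (simp add: fst dec_encode)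
  have in_s: "in_list p (psnd n) \<longleftrightarrow> p \<in> prod_encode ` set s" for p
    by (simp add: in_list_iff snd)
  have less: "x < M" "a < N" "prod_encode (x, a) < n" if "(x, a) \<in> set s" for x a
  proof -
    have "prod_encode (x, a) < psnd n" using that in_s by (intro in_list_less) force
    then show "prod_encode (x, a) < n" using psnd_le[of n] by simp
    then show "x < M" "a < N"
      using le_prod_encode_1[of x a] le_prod_encode_2[of a x] M N by simp_all
  qed
  have matches: "matches n k \<longleftrightarrow> (\<forall>(x, a)\<in>set s. ?env k x = a)" for k
    unfolding matches_def M N in_s using less by (fastforce simp: env_def)
  have map_of: "map_of s x = Some a" if "(x, a) \<in> set s" for x a
    using that s by (simp add: valuation_on_def)
  have fv: "\<exists>a. (x, a) \<in> set s" if "x \<in> fv e" for x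
    using that s unfolding valuation_on_def by force
  have graph: "approximated_graph (dec ` {..<M}) (M) (N) (?env k) e V E"
    if k: "matches n k" for k
  proof
    show "?env k \<in> Env" by (rule env_in_envs) (rule N_pos)
    show "e \<in> dec ` {..<M}" using c e by force
    have "denot e (?env k) = denot e (\<lambda>x. the (map_of s x))"
      using k fv map_of unfolding matches by (intro denot_cong) fastforce
    then show "denot e (?env k) = vpair (VSet V) (VSet E)" using VE by (simp add: pres_value_def)
  qed
  have val: "val_code n (pfst n) k = hpair (hc (VSet V)) (hc (VSet E))"
    if k: "matches n k" "k < N ^ M" for k
  proof -
    interpret g: approximated_graph "dec ` {..<M}" "M" "N" "?env k" e V E
      using k(1) by (rule graph)
    show ?thesis using val_code_eq_hval[OF c k(2)] hc_denot[OF g.e\<^sub>0 g.\<sigma>] g.hc_graph by (simp add: e)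
  qed
  have "\<exists>k<N ^ M. matches n k"
  proof -
    \<comment> \<open>Variables without a value in \<open>s\<close> receive \<open>0\<close>, which
      is below \<open>N\<close>, so that a matching code exists.\<close>
    have "(if x \<in> fst ` set s then the (map_of s x) else 0) < N" for x
      using less(2) map_of N_pos by force
    then obtain k where k: "k < N ^ M"
      "\<forall>x<M. dig (N) k x = (if x \<in> fst ` set s then the (map_of s x) else 0)"
      using ex_dig[of "M" "\<lambda>x. if x \<in> fst ` set s then the (map_of s x) else 0" "N"]
      by blast
    have "?env k x = a" if "(x, a) \<in> set s" for x a
      using k(2) less(1)[OF that] map_of[OF that] that by (force simp: env_def)
    with k(1) show ?thesis unfolding matches by blast
  qed
  then show ?thesis
    unfolding answer_def M N using val hpair_eq_iff hpair_less P[OF graph] by metis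
qed

lemma vertex_cover_answer:
  assumes "valuation_on (fv e) s" "pres_value e s = vpair (VSet V) (VSet E)" "n = pres_encode e s"
    "undirected_graph (rcset V) (rcset E)"
  shows "answer vertex_cover_code n \<longleftrightarrow> VertexCover (rcset V) (rcset E)"
proof (rule answer_iff[OF assms(1-3)])
  fix k
  assume "approximated_graph (dec ` {..<M}) (M) (N)
    (env (M) (N) k) e V E"
  from approximated_graph.VertexCover_iff_finite[OF this assms(4)]
  show "vertex_cover_code n k (hc (VSet V)) (hc (VSet E)) \<longleftrightarrow> VertexCover (rcset V) (rcset E)"
    unfolding vertex_cover_code_def fixed_code_iff ball_hmem_code bex_hmem_code by simp
qed

lemma feedback_vertex_answer:
  assumes "valuation_on (fv e) s" "pres_value e s = vpair (VSet V) (VSet E)" "n = pres_encode e s"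
    "directed_graph (rcset V) (rcset E)"
  shows "answer feedback_vertex_code n \<longleftrightarrow> FeedbackVertexSet (rcset V) (rcset E)"
proof (rule answer_iff[OF assms(1-3)])
  fix k
  assume "approximated_graph (dec ` {..<M}) (M) (N)
    (env (M) (N) k) e V E"
  from approximated_graph.FeedbackVertexSet_iff_finite[OF this assms(4)]
  show "feedback_vertex_code n k (hc (VSet V)) (hc (VSet E)) \<longleftrightarrow> FeedbackVertexSet (rcset V) (rcset E)"
    unfolding feedback_vertex_code_def fixed_code_iff cycle_code_iff by simp
qed

lemma feedback_arc_answer:
  assumes "valuation_on (fv e) s" "pres_value e s = vpair (VSet V) (VSet E)" "n = pres_encode e s"
    "directed_graph (rcset V) (rcset E)"
  shows "answer feedback_arc_code n \<longleftrightarrow> FeedbackArcSet (rcset V) (rcset E)"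
proof (rule answer_iff[OF assms(1-3)])
  fix k
  assume "approximated_graph (dec ` {..<M}) (M) (N)
    (env (M) (N) k) e V E"
  from approximated_graph.FeedbackArcSet_iff_finite[OF this assms(4)]
  show "feedback_arc_code n k (hc (VSet V)) (hc (VSet E)) \<longleftrightarrow> FeedbackArcSet (rcset V) (rcset E)"
    unfolding feedback_arc_code_def fixed_code_iff cycle_code_iff by simp
qed

end

lemma graph_problem_decidableI:
  assumes "decidable D"
    and "\<And>e s V E. \<lbrakk>valuation_on (fv e) s; pres_value e s = vpair (VSet V) (VSet E);
      \<G> (rcset V) (rcset E)\<rbrakk> \<Longrightarrow> D (pres_encode e s) \<longleftrightarrow> Q (rcset V) (rcset E)"
  shows "graph_problem_decidable \<G> Q"
proof -
  obtain f where f: "\<And>n. rec_eval f [n] (if D n then 1 else 0)"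
    using assms(1) unfolding decidable_def computable_def by blast
  show ?thesis
    unfolding graph_problem_decidable_def
  proof (intro exI[of _ f] allI impI)
    fix e s V E
    assume "valuation_on (fv e) s" "pres_value e s = vpair (VSet V) (VSet E)" "\<G> (rcset V) (rcset E)"
    from assms(2)[OF this] f[of "pres_encode e s"]
    show "rec_eval f [pres_encode e s] (if Q (rcset V) (rcset E) then 1 else 0)" by simp
  qed
qed

theorem theorem4p9:
  shows "graph_problem_decidable undirected_graph VertexCover \<and>
         graph_problem_decidable directed_graph FeedbackVertexSet \<and>
         graph_problem_decidable directed_graph FeedbackArcSet"
proof (intro conjI)
  show "graph_problem_decidable undirected_graph VertexCover"
    by (rule graph_problem_decidableI[OF decidable_codes(1)])
      (rule vertex_cover_answer[OF refl refl _ _ refl])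
  show "graph_problem_decidable directed_graph FeedbackVertexSet"
    by (rule graph_problem_decidableI[OF decidable_codes(2)])
      (rule feedback_vertex_answer[OF refl refl _ _ refl])
  show "graph_problem_decidable directed_graph FeedbackArcSet"
    by (rule graph_problem_decidableI[OF decidable_codes(3)])
      (rule feedback_arc_answer[OF refl refl _ _ refl])
qed

end
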